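(* Let $0<q,\mu,y<1$, let $s\ge 1$ and let $d_1,\ldots,d_s\in\mathbb{Z}_{\ge 0}$ with $d_1\ge 1$, $d_s\ge 1$. For every $r$ with $1\le r\le s$ and every $n\in\mathbb{Z}_{\ge 0}$, \begin{align*} P_{\rm I}(r,n) &= y^n\frac{(q^{d_r}\mu)_n(y)_\infty}{(q)_n(\mu y)_\infty}\sum_{m}q^{n(m-d_r)}\frac{(\mu y)_m}{(y)_{m-d_r}}\,G_{0,m}(d_1,\ldots,d_r),\\ \rho_{\rm I}(r)-\rho &= \sum_{m}G_{0,m}(d_1,\ldots,d_r)\Bigl(\sum_{k=0}^{m-1}\frac{\mu yq^k}{1-\mu yq^k}-\sum_{k=0}^{m-d_r-1}\frac{yq^k}{1-yq^k}\Bigr),\\ J_{\rm I}(r)_+-J_+ &= -\sum_{m}G_{0,m}(d_1,\ldots,d_r)\sum_{k=0}^{m-1}\frac{yq^k}{(1-\mu yq^k)^2},\\ J_{\rm I}(r)_--J_- &= -\sum_{m}G_{0,m}(d_1,\ldots,d_r)\sum_{k=0}^{m-d_r-1}\frac{yq^k}{(1-yq^k)^2}, \end{align*} where the sums $\sum_m$ extend over $m\in\mathbb{Z}_{\ge0}$ satisfying $d_r\le m\le d_1+\cdots+d_r$.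
   Context: Notation: $(z)_m=\prod_{j=0}^{m-1}(1-zq^j)$ for $m\in\mathbb{Z}_{\ge0}\cup\{\infty\}$; $\binom{m}{k}_q=\frac{(q)_m}{(q)_k(q)_{m-k}}$ for $0\le k\le m$ and $0$ otherwise; $g_m=\frac{(\mu)_m}{(q)_m}$. $q$-bosons: $F=\bigoplus_{m\ge0}\mathbb{C}|m\rangle$ with operators $\mathbf b|m\rangle=|m+1\rangle$, $\mathbf c|m\rangle=(1-q^m)|m-1\rangle$, $\mathbf k|m\rangle=q^m|m\rangle$ (with $|-1\rangle=0$). They satisfy $\mathbf k\mathbf b=q\mathbf b\mathbf k$, $\mathbf k\mathbf c=q^{-1}\mathbf c\mathbf k$, $\mathbf b\mathbf c=1-\mathbf k$, $\mathbf c\mathbf b=1-q\mathbf k$. The algebra $\mathcal B$ they generate has basis $\mathbf b^{\max(t,0)}\mathbf k^{u}\mathbf c^{\max(-t,0)}$ ($u\in\mathbb{Z}_{\ge0}$, $t\in\mathbb{Z}$). For $Q\in\mathcal B$, $Q'$ denotes its projection onto the span of $\{\mathbf k^u: u\ge1\}$, and $\mathrm{Tr}(\mathbf k^u)=(1-q^u)^{-1}$ for $u\ge 1$. Matrix product operators: with $\frac{(\mu\mathbf b)_\infty}{(\mathbf b)_\infty}=\sum_{j\ge0}g_j\mathbf b^j$, $$X_{a,n}=\frac{(\mu)_{a+n}}{(q)_a(q)_n}\frac{(\mu\mathbf b)_\infty}{(\mathbf b)_\infty}\mathbf k^n\mathbf c^a,\qquad A_a=\sum_{n\ge0}X_{a,n}y^n\qquad(a,n\in\mathbb{Z}_{\ge0}).$$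 For a product $Q$ of such operators, $\mathrm{Tr}(Q)'$ means $\mathrm{Tr}(Q')$ computed termwise in the expansion in powers of $y$ coming from the $A_a$'s (for each power of $y$ only finitely many terms have equally many $\mathbf b$'s and $\mathbf c$'s, and these give a polynomial in $\mathbf k$). Conditional probability (of finding $n$ second class particles at site $r$, given $d_i$ first class particles at site $i$ for $1\le i\le s$ and none elsewhere), for $1\le r\le s$: $$P_{\rm I}(r,n)=\lim_{L\to\infty}\frac{y^n\,\mathrm{Tr}(A_{d_1}\cdots A_{d_{r-1}}X_{d_r,n}A_{d_{r+1}}\cdots A_{d_s}A_0^{L-s})'}{\mathrm{Tr}(A_{d_1}\cdots A_{d_s}A_0^{L-s})'}.$$ Local density and currents: $\rho_{\rm I}(r)=\sum_{n\ge0}nP_{\rm I}(r,n)$ and $J_{\rm I}(r)_\pm=\sum_{n\ge l\ge1}l\,w_\pm((0,l)|(d_r,n))P_{\rm I}(r,n)$, where $$w_+((0,l)|(d,n))=\frac{q^{dl}\mu^{l-1}(q)_{l-1}}{(\mu q^{d+n-l})_l}\binom{n}{l}_q,\qquad w_-((0,l)|(d,n))=\frac{(q)_{l-1}}{(\mu q^{d+n-l})_l}\binom{n}{l}_q.$$ Defect-free values: $\rho=\sum_{i\ge0}\frac{(1-\mu)yq^i}{(1-yq^i)(1-\mu yq^i)}$, $J_+=\mu^{-1}h(\mu y)$, $J_-=h(y)$, with $h(\zeta)=\sum_{i\ge0}\frac{\zeta q^i}{(1-\zeta q^i)^2}$. Defect functions: $\phi(l|m)=y^l\frac{(\mu)_l(y)_{m-l}}{(\mu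 y)_m}\binom{m}{l}_q$ (zero unless $0\le l\le m$), and for $m,l\in\mathbb{Z}_{\ge0}$ $$G_{m,l}(d_1,\ldots,d_r)=\sum\prod_{i=1}^{r}\phi(l_i\,|\,m+d_1+\cdots+d_{i-1}-l_1-\cdots-l_{i-1}),$$ the sum being over $l_1,\ldots,l_r\in\mathbb{Z}_{\ge0}$ with $l_1+\cdots+l_r+l=d_1+\cdots+d_r+m$. *)

theory Defs
  imports "HOL-Analysis.Analysis" "HOL-Computational_Algebra.Computational_Algebra"
begin

definition qpoch :: "real \<Rightarrow> real \<Rightarrow> nat \<Rightarrow> real" where
  "qpoch q z m = (\<Prod>j<m. 1 - z * q ^ j)"

definition qpoch_inf :: "real \<Rightarrow> real \<Rightarrow> real" where
  "qpoch_inf q z = prodinf (\<lambda>j. 1 - z * q ^ j)"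

definition qbinom :: "real \<Rightarrow> nat \<Rightarrow> nat \<Rightarrow> real" where
  "qbinom q m k = (if k \<le> m then qpoch q q m / (qpoch q q k * qpoch q q (m - k)) else 0)"

definition gcoef :: "real \<Rightarrow> real \<Rightarrow> nat \<Rightarrow> real" where
  "gcoef q \<mu> m = qpoch q \<mu> m / qpoch q q m"


section \<open>The q-bosons\<close>

text \<open>
  The Fock space \<open>F\<close> is the space of complex polynomials, with \<open>|m\<rangle>\<close> the monomial of
  degree \<open>m\<close>. Its linear endomorphisms form a ring under composition.
\<close>

abbreviation ket :: "nat \<Rightarrow> complex poly" where
  "ket m \<equiv> monom 1 m"

typedef linop = "{f :: complex poly \<Rightarrow> complex poly.
    (\<forall>u v. f (u + v) = f u + f v) \<and> (\<forall>z v. f (smult z v) = smult z (f v))}"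
  morphisms appl Linop
  by (rule exI[of _ id]) simp

setup_lifting type_definition_linop

lemma smult_sum_right: "smult z (sum f A) = (\<Sum>i\<in>A. smult z (f i))"
  by (induction A rule: infinite_finite_induct) (simp_all add: smult_add_right)

lemma appl_add: "appl T (u + v) = appl T u + appl T v"
  using appl[of T] by simp

lemma appl_smult: "appl T (smult z v) = smult z (appl T v)"
  using appl[of T] by simp

instantiation linop :: ring_1
begin

lift_definition zero_linop :: linop is "\<lambda>_. 0" by simp
lift_definition one_linop :: linop is "\<lambda>v. v" by simp
lift_definition plus_linop :: "linop \<Rightarrow> linop \<Rightarrow> linop" is "\<lambda>f g v. f v + g v"
  by (simp add: smult_add_right algebra_simps)
lift_definition uminus_linop :: "linop \<Rightarrow> linop" is "\<lambda>f v. - f v"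
  by simp
lift_definition minus_linop :: "linop \<Rightarrow> linop \<Rightarrow> linop" is "\<lambda>f g v. f v - g v"
  by (simp add: smult_diff_right algebra_simps)
lift_definition times_linop :: "linop \<Rightarrow> linop \<Rightarrow> linop" is "\<lambda>f g v. f (g v)"
  by simp

instance
proof
  show "(0::linop) \<noteq> 1"
    by transfer (metis one_neq_zero)
qed (transfer; force simp: algebra_simps)+

end

lift_definition scal :: "complex \<Rightarrow> linop" is "\<lambda>z v. smult z v"
  by (simp add: smult_add_right mult.commute)

text \<open>The linear operator with prescribed images \<open>e m\<close> of the basis vectors \<open>|m\<rangle>\<close>.\<close>

lift_definition lin_ext :: "(nat \<Rightarrow> complex poly) \<Rightarrow> linop" is
  "\<lambda>e v. \<Sum>m\<le>degree v. smult (coeff v m) (e m)"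
proof (intro CollectI conjI allI)
  fix e :: "nat \<Rightarrow> complex poly"
  have ext: "(\<Sum>m\<le>degree v. smult (coeff v m) (e m)) = (\<Sum>m\<le>N. smult (coeff v m) (e m))"
    if "degree v \<le> N" for v N
    by (rule sum.mono_neutral_left) (use that in \<open>auto simp: coeff_eq_0\<close>)
  show "(\<Sum>m\<le>degree (u + v). smult (coeff (u + v) m) (e m)) =
      (\<Sum>m\<le>degree u. smult (coeff u m) (e m)) + (\<Sum>m\<le>degree v. smult (coeff v m) (e m))" for u v
  proof -
    let ?N = "max (degree u) (degree v)"
    show ?thesis
      using ext[of u ?N] ext[of v ?N] ext[of "u + v" ?N]
      by (simp add: degree_add_le_max smult_add_left sum.distrib)
  qed
  show "(\<Sum>m\<le>degree (smult z v). smult (coeff (smult z v) m) (e m)) =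
      smult z (\<Sum>m\<le>degree v. smult (coeff v m) (e m))" for z v
    using ext[of "smult z v" "degree v"] by (simp add: smult_sum_right degree_smult_le)
qed

lemma appl_lin_ext_ket: "appl (lin_ext e) (ket m) = e m"
  by (simp add: lin_ext.rep_eq degree_monom_eq if_distrib [of "\<lambda>z. smult z _"] cong: if_cong)

definition b_op :: linop where
  "b_op = lin_ext (\<lambda>m. ket (Suc m))"

text \<open>For \<open>m = 0\<close> the coefficient vanishes, so the truncated subtraction is harmless.\<close>

definition c_op :: "real \<Rightarrow> linop" where
  "c_op q = lin_ext (\<lambda>m. smult (1 - of_real q ^ m) (ket (m - 1)))"

definition k_op :: "real \<Rightarrow> linop" where
  "k_op q = lin_ext (\<lambda>m. smult (of_real q ^ m) (ket m))"

lemma appl_0: "appl T 0 = 0"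
  using appl_smult[of T 0 0] by simp

lemma appl_sum: "appl T (sum f A) = (\<Sum>i\<in>A. appl T (f i))"
proof (induction A rule: infinite_finite_induct)
  case (insert x A)
  then show ?case by (simp add: appl_add)
qed (simp_all add: appl_0)

lemma linop_eqI:
  assumes "\<And>m. appl S (ket m) = appl T (ket m)"
  shows "S = T"
proof -
  have "appl S v = appl T v" for v
  proof -
    have *: "v = (\<Sum>m\<le>degree v. smult (coeff v m) (ket m))"
      by (simp add: smult_monom poly_as_sum_of_monoms)
    show ?thesis
      by (subst (1 2) *) (simp add: appl_sum appl_smult assms)
  qed
  then show ?thesis by (metis appl_inject ext)
qed

lemma monom_ket: "monom z m = smult z (ket m)"
  by (simp add: smult_monom)

lemma b_op_monom: "appl b_op (monom z m) = monom z (Suc m)"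
  by (subst monom_ket, subst appl_smult) (simp add: b_op_def appl_lin_ext_ket smult_monom)

lemma c_op_monom: "appl (c_op q) (monom z m) = monom (z * (1 - of_real q ^ m)) (m - 1)"
  by (subst monom_ket, subst appl_smult) (simp add: c_op_def appl_lin_ext_ket smult_monom)

lemma k_op_monom: "appl (k_op q) (monom z m) = monom (z * of_real q ^ m) m"
  by (subst monom_ket, subst appl_smult) (simp add: k_op_def appl_lin_ext_ket smult_monom)

lemmas op_simps = times_linop.rep_eq minus_linop.rep_eq one_linop.rep_eq scal.rep_eq
  b_op_monom c_op_monom k_op_monom smult_monom

lemma qboson_relations:
  assumes "q \<noteq> 0"
  shows "k_op q * b_op = scal (of_real q) * b_op * k_op q"
    and "k_op q * c_op q = scal (inverse (of_real q)) * c_op q * k_op q"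
    and "b_op * c_op q = 1 - k_op q"
    and "c_op q * b_op = 1 - scal (of_real q) * k_op q"
proof -
  show "k_op q * b_op = scal (of_real q) * b_op * k_op q"
    by (rule linop_eqI) (simp add: op_simps)
  show "k_op q * c_op q = scal (inverse (of_real q)) * c_op q * k_op q"
  proof (rule linop_eqI)
    fix m
    show "appl (k_op q * c_op q) (ket m) = appl (scal (inverse (of_real q)) * c_op q * k_op q) (ket m)"
      using assms by (cases m) (simp_all add: op_simps field_simps appl_0 del: monom_eq_1)
  qed
  show "b_op * c_op q = 1 - k_op q"
  proof (rule linop_eqI)
    fix m
    show "appl (b_op * c_op q) (ket m) = appl (1 - k_op q) (ket m)"
      by (cases m) (simp_all add: op_simps diff_monom appl_0 del: monom_eq_1)
  qed
  show "c_op q * b_op = 1 - scal (of_real q) * k_op q"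
    by (rule linop_eqI) (simp add: op_simps diff_monom del: monom_eq_1)
qed


section \<open>Projection onto positive powers of \<open>k\<close> and trace\<close>

definition basis_op :: "real \<Rightarrow> int \<times> nat \<Rightarrow> linop" where
  "basis_op q = (\<lambda>(t, u). b_op ^ nat t * k_op q ^ u * c_op q ^ nat (- t))"

lemma b_op_power_monom: "appl (b_op ^ a) (monom z m) = monom z (m + a)"
  by (induction a arbitrary: z m) (simp_all add: op_simps)

lemma k_op_power_monom: "appl (k_op q ^ u) (monom z m) = monom (z * (of_real q ^ m) ^ u) m"
  by (induction u arbitrary: z m) (simp_all add: op_simps mult_ac)

lemma c_op_power_monom:
  "appl (c_op q ^ a) (monom z m) = monom (z * (\<Prod>i<a. 1 - of_real q ^ (m - i))) (m - a)"
proof (induction a arbitrary: z m)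
  case (Suc a)
  then show ?case by (simp add: op_simps mult_ac)
qed (simp add: op_simps)

lemma basis_op_monom:
  "appl (basis_op q (t, u)) (ket m) =
     monom ((\<Prod>i<nat (- t). 1 - of_real q ^ (m - i)) * (of_real q ^ (m - nat (- t))) ^ u)
       (m - nat (- t) + nat t)"
  by (simp add: basis_op_def times_linop.rep_eq b_op_power_monom k_op_power_monom c_op_power_monom)

lemma appl_sum_op: "appl (sum F A) v = (\<Sum>i\<in>A. appl (F i) v)"
  by (induction A rule: infinite_finite_induct) (simp_all add: plus_linop.rep_eq zero_linop.rep_eq)

lemma basis_op_independent:
  assumes q: "0 < q" "q < 1" and fin: "finite S"
    and zero: "(\<Sum>i\<in>S. scal (f i) * basis_op q i) = 0"
    and i: "i \<in> S"
  shows "f i = 0"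
proof -
  obtain t u where i_eq: "i = (t, u)" by (cases i)
  define a where "a = nat (- t)"
  define U where "U = {u. (t, u) \<in> S}"
  have finU: "finite U"
    using finite_vimageI[OF fin, of "Pair t"] by (simp add: U_def vimage_def inj_on_def)
  define p where "p = (\<Sum>u\<in>U. monom (f (t, u)) u)"
  have root: "poly p (of_real q ^ m) = 0" for m
  proof -
    let ?M = "m + a" and ?D = "m + nat t"
    define C where "C = (\<Prod>i<a. 1 - complex_of_real q ^ (?M - i))"
    have "C \<noteq> 0"
    proof -
      have "1 - complex_of_real q ^ (?M - i) \<noteq> 0" if "i < a" for i
      proof -
        have "q ^ (?M - i) < 1" using q that by (simp add: power_less_one_iff)
        then show ?thesis by (metis eq_iff_diff_eq_0 less_irrefl of_real_1 of_real_eq_iff of_real_power)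
      qed
      then show ?thesis by (simp add: C_def)
    qed
    have summand: "coeff (appl (scal (f j) * basis_op q j) (ket ?M)) ?D =
        (if fst j = t then f j * (C * (of_real q ^ m) ^ snd j) else 0)" if "j \<in> S" for j
    proof -
      obtain t' u' where j: "j = (t', u')" by (cases j)
      have "?M - nat (- t') + nat t' = ?D \<longleftrightarrow> t' = t" if "nat (- t') \<le> ?M"
        using that unfolding a_def by linarith
      moreover have "(\<Prod>i<nat (- t'). 1 - complex_of_real q ^ (?M - i)) = 0" if "\<not> nat (- t') \<le> ?M"
        using that by (intro prod_zero) (auto intro!: bexI[of _ ?M])
      moreover have "nat (- t) \<le> ?M" by (simp add: a_def)
      ultimately show ?thesis
        by (cases "nat (- t') \<le> ?M")
          (auto simp: j times_linop.rep_eq scal.rep_eq basis_op_monom C_def a_def)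
    qed
    have "0 = coeff (appl (\<Sum>i\<in>S. scal (f i) * basis_op q i) (ket ?M)) ?D"
      by (simp add: zero zero_linop.rep_eq)
    also have "\<dots> = (\<Sum>j\<in>S. if fst j = t then f j * (C * (of_real q ^ m) ^ snd j) else 0)"
      by (simp add: appl_sum_op coeff_sum summand)
    also have "\<dots> = (\<Sum>j\<in>Pair t ` U. f j * (C * (of_real q ^ m) ^ snd j))"
      by (rule sum.mono_neutral_cong_right) (use fin in \<open>auto simp: U_def\<close>)
    also have "\<dots> = C * poly p (of_real q ^ m)"
      by (subst sum.reindex)
        (auto simp: inj_on_def p_def poly_sum poly_monom sum_distrib_left mult_ac)
    finally show ?thesis using \<open>C \<noteq> 0\<close> by simp
  qed
  have "inj (\<lambda>m. complex_of_real q ^ m)"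
  proof (rule injI)
    fix m m' assume "complex_of_real q ^ m = complex_of_real q ^ m'"
    then have "q ^ m = q ^ m'" by (metis of_real_eq_iff of_real_power)
    then show "m = m'" using q by (metis power_inject_exp' less_irrefl)
  qed
  then have "infinite (range (\<lambda>m. complex_of_real q ^ m))"
    using finite_imageD by blast
  moreover have "range (\<lambda>m. complex_of_real q ^ m) \<subseteq> {x. poly p x = 0}"
    using root by auto
  ultimately have "p = 0"
    using poly_roots_finite finite_subset by blast
  then have "coeff p u = 0" by simp
  moreover have "coeff p u = f (t, u)"
    using finU i by (simp add: p_def coeff_sum U_def i_eq)
  ultimately show ?thesis by (simp add: i_eq)
qed

text \<open>
  The coefficients of an element of the algebra generated by the q-bosons with respect to the
  basis \<open>basis_op q\<close>. They are only meaningful for elements of that algebra (and \<open>0 < q < 1\<close>).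
\<close>

definition basis_coeff :: "real \<Rightarrow> linop \<Rightarrow> int \<times> nat \<Rightarrow> complex" where
  "basis_coeff q Q = (THE f. finite {i. f i \<noteq> 0} \<and>
      Q = (\<Sum>i | f i \<noteq> 0. scal (f i) * basis_op q i))"

lemma scal_diff: "scal (z - w) = scal z - scal w"
  by transfer (simp add: smult_diff_left fun_eq_iff)

lemma scal_0: "scal 0 = 0"
  by transfer simp

lemma basis_coeff_eqI:
  assumes q: "0 < q" "q < 1" and fin: "finite {i. f i \<noteq> 0}"
    and Q: "Q = (\<Sum>i | f i \<noteq> 0. scal (f i) * basis_op q i)"
  shows "basis_coeff q Q = f"
  unfolding basis_coeff_def
proof (rule the_equality)
  show "finite {i. f i \<noteq> 0} \<and> Q = (\<Sum>i | f i \<noteq> 0. scal (f i) * basis_op q i)"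
    using fin Q by blast
next
  fix g assume g: "finite {i. g i \<noteq> 0} \<and> Q = (\<Sum>i | g i \<noteq> 0. scal (g i) * basis_op q i)"
  let ?S = "{i. f i \<noteq> 0} \<union> {i. g i \<noteq> 0}"
  have S: "finite ?S" using fin g by blast
  have "Q = (\<Sum>i\<in>?S. scal (f i) * basis_op q i)"
    unfolding Q by (rule sum.mono_neutral_left) (use S in \<open>auto simp: scal_0\<close>)
  moreover have "Q = (\<Sum>i\<in>?S. scal (g i) * basis_op q i)"
    unfolding conjunct2[OF g] by (rule sum.mono_neutral_left) (use S in \<open>auto simp: scal_0\<close>)
  ultimately have "(\<Sum>i\<in>?S. scal (g i - f i) * basis_op q i) = 0"
    by (simp add: scal_diff left_diff_distrib sum_subtractf)
  from basis_op_independent[OF q S this] have "g i - f i = 0" if "i \<in> ?S" for i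
    using that by blast
  then show "g = f" by (force simp: fun_eq_iff)
qed

definition k_part :: "real \<Rightarrow> linop \<Rightarrow> linop" where
  "k_part q Q = (\<Sum>u | 1 \<le> u \<and> basis_coeff q Q (0, u) \<noteq> 0.
      scal (basis_coeff q Q (0, u)) * k_op q ^ u)"

text \<open>The trace is only meant for elements of the span of the \<open>k\<^sup>u\<close> with \<open>u \<ge> 1\<close>.\<close>

definition k_trace :: "real \<Rightarrow> linop \<Rightarrow> complex" where
  "k_trace q Q = (\<Sum>u | 1 \<le> u \<and> basis_coeff q Q (0, u) \<noteq> 0.
      basis_coeff q Q (0, u) * (1 / (1 - of_real q ^ u)))"


section \<open>Matrix product operators\<close>

text \<open>
  The operators \<open>X\<close> are infinite series in \<open>b\<close>. They are represented as formal power series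
  over the operators on \<open>F\<close> whose \<open>j\<close>-th coefficient collects the terms containing the factor
  \<open>b\<close> exactly \<open>j\<close> times; this count is additive under products. The operators \<open>A\<close> are formal
  power series in \<open>y\<close> over these. Thus \<open>fps_nth (fps_nth Q N) j\<close> is the part of \<open>Q\<close> of degree
  \<open>N\<close> in \<open>y\<close> with \<open>j\<close> factors \<open>b\<close>.
\<close>

definition b_ratio :: "real \<Rightarrow> real \<Rightarrow> linop fps" where
  "b_ratio q \<mu> = Abs_fps (\<lambda>j. scal (of_real (gcoef q \<mu> j)) * b_op ^ j)"

definition X_op :: "real \<Rightarrow> real \<Rightarrow> nat \<Rightarrow> nat \<Rightarrow> linop fps" where
  "X_op q \<mu> a n =
     fps_const (scal (of_real (qpoch q \<mu> (a + n) / (qpoch q q a * qpoch q q n)))) *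
     b_ratio q \<mu> * fps_const (k_op q ^ n * c_op q ^ a)"

definition A_op :: "real \<Rightarrow> real \<Rightarrow> nat \<Rightarrow> linop fps fps" where
  "A_op q \<mu> a = Abs_fps (\<lambda>n. X_op q \<mu> a n)"

text \<open>
  In the sum over \<open>j\<close> only the terms with equally many factors \<open>b\<close> and \<open>c\<close> contribute to a
  product of operators \<open>X\<close>: the others have no component along the powers of \<open>k\<close>.
\<close>

definition Tr_coeff :: "real \<Rightarrow> linop fps fps \<Rightarrow> nat \<Rightarrow> complex" where
  "Tr_coeff q Q N = (\<Sum>j. k_trace q (k_part q (fps_nth (fps_nth Q N) j)))"

definition Tr' :: "real \<Rightarrow> real \<Rightarrow> linop fps fps \<Rightarrow> complex" where
  "Tr' q y Q = (\<Sum>N. Tr_coeff q Q N * of_real y ^ N)"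


section \<open>Conditional probability, density and currents\<close>

definition word_num :: "real \<Rightarrow> real \<Rightarrow> nat \<Rightarrow> (nat \<Rightarrow> nat) \<Rightarrow> nat \<Rightarrow> nat \<Rightarrow> nat \<Rightarrow> linop fps fps" where
  "word_num q \<mu> s d r n L =
     prod_list (map (\<lambda>i. A_op q \<mu> (d i)) [1..<r]) * fps_const (X_op q \<mu> (d r) n) *
     prod_list (map (\<lambda>i. A_op q \<mu> (d i)) [Suc r..<Suc s]) * A_op q \<mu> 0 ^ (L - s)"

definition word_den :: "real \<Rightarrow> real \<Rightarrow> nat \<Rightarrow> (nat \<Rightarrow> nat) \<Rightarrow> nat \<Rightarrow> linop fps fps" where
  "word_den q \<mu> s d L =
     prod_list (map (\<lambda>i. A_op q \<mu> (d i)) [1..<Suc s]) * A_op q \<mu> 0 ^ (L - s)"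

definition P_fin ::
  "real \<Rightarrow> real \<Rightarrow> real \<Rightarrow> nat \<Rightarrow> (nat \<Rightarrow> nat) \<Rightarrow> nat \<Rightarrow> nat \<Rightarrow> nat \<Rightarrow> complex" where
  "P_fin q \<mu> y s d r n L =
     of_real y ^ n * Tr' q y (word_num q \<mu> s d r n L) / Tr' q y (word_den q \<mu> s d L)"

definition P_I :: "real \<Rightarrow> real \<Rightarrow> real \<Rightarrow> nat \<Rightarrow> (nat \<Rightarrow> nat) \<Rightarrow> nat \<Rightarrow> nat \<Rightarrow> complex" where
  "P_I q \<mu> y s d r n = lim (\<lambda>L. P_fin q \<mu> y s d r n L)"

definition \<rho>_I :: "real \<Rightarrow> real \<Rightarrow> real \<Rightarrow> nat \<Rightarrow> (nat \<Rightarrow> nat) \<Rightarrow> nat \<Rightarrow> complex" where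
  "\<rho>_I q \<mu> y s d r = (\<Sum>n. of_nat n * P_I q \<mu> y s d r n)"

text \<open>\<open>w_plus q \<mu> l d n\<close> is the rate \<open>w\<^sub>+((0,l)|(d,n))\<close>, and similarly for \<open>w_minus\<close>; only
  \<open>1 \<le> l \<le> n\<close> is used.\<close>

definition w_plus :: "real \<Rightarrow> real \<Rightarrow> nat \<Rightarrow> nat \<Rightarrow> nat \<Rightarrow> real" where
  "w_plus q \<mu> l d n = q ^ (d * l) * \<mu> ^ (l - 1) * qpoch q q (l - 1)
     / qpoch q (\<mu> * q ^ (d + n - l)) l * qbinom q n l"

definition w_minus :: "real \<Rightarrow> real \<Rightarrow> nat \<Rightarrow> nat \<Rightarrow> nat \<Rightarrow> real" where
  "w_minus q \<mu> l d n = qpoch q q (l - 1)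
     / qpoch q (\<mu> * q ^ (d + n - l)) l * qbinom q n l"

definition J_term ::
  "(nat \<Rightarrow> nat \<Rightarrow> nat \<Rightarrow> real) \<Rightarrow> real \<Rightarrow> real \<Rightarrow> real \<Rightarrow> nat \<Rightarrow> (nat \<Rightarrow> nat) \<Rightarrow> nat \<Rightarrow> nat \<times> nat \<Rightarrow> complex" where
  "J_term w q \<mu> y s d r = (\<lambda>(n, l). of_nat l * of_real (w l (d r) n) * P_I q \<mu> y s d r n)"

definition J_I_plus :: "real \<Rightarrow> real \<Rightarrow> real \<Rightarrow> nat \<Rightarrow> (nat \<Rightarrow> nat) \<Rightarrow> nat \<Rightarrow> complex" where
  "J_I_plus q \<mu> y s d r =
     infsum (J_term (w_plus q \<mu>) q \<mu> y s d r) {(n, l). 1 \<le> l \<and> l \<le> n}"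

definition J_I_minus :: "real \<Rightarrow> real \<Rightarrow> real \<Rightarrow> nat \<Rightarrow> (nat \<Rightarrow> nat) \<Rightarrow> nat \<Rightarrow> complex" where
  "J_I_minus q \<mu> y s d r =
     infsum (J_term (w_minus q \<mu>) q \<mu> y s d r) {(n, l). 1 \<le> l \<and> l \<le> n}"

definition \<rho>_bulk_term :: "real \<Rightarrow> real \<Rightarrow> real \<Rightarrow> nat \<Rightarrow> real" where
  "\<rho>_bulk_term q \<mu> y i = (1 - \<mu>) * y * q ^ i / ((1 - y * q ^ i) * (1 - \<mu> * y * q ^ i))"

definition \<rho>_bulk :: "real \<Rightarrow> real \<Rightarrow> real \<Rightarrow> real" where
  "\<rho>_bulk q \<mu> y = (\<Sum>i. \<rho>_bulk_term q \<mu> y i)"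

definition h_term :: "real \<Rightarrow> real \<Rightarrow> nat \<Rightarrow> real" where
  "h_term q \<zeta> i = \<zeta> * q ^ i / (1 - \<zeta> * q ^ i)\<^sup>2"

definition h_fun :: "real \<Rightarrow> real \<Rightarrow> real" where
  "h_fun q \<zeta> = (\<Sum>i. h_term q \<zeta> i)"

definition J_plus_bulk :: "real \<Rightarrow> real \<Rightarrow> real \<Rightarrow> real" where
  "J_plus_bulk q \<mu> y = inverse \<mu> * h_fun q (\<mu> * y)"

definition J_minus_bulk :: "real \<Rightarrow> real \<Rightarrow> real" where
  "J_minus_bulk q y = h_fun q y"


section \<open>Defect functions\<close>

text \<open>The upper argument of \<open>\<phi>(l|m)\<close> is an integer, since it can become negative in \<open>G\<close>.\<close>

definition \<phi>_fun :: "real \<Rightarrow> real \<Rightarrow> real \<Rightarrow> nat \<Rightarrow> int \<Rightarrow> real" where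
  "\<phi>_fun q \<mu> y l m =
     (if int l \<le> m
      then y ^ l * (qpoch q \<mu> l * qpoch q y (nat m - l) / qpoch q (\<mu> * y) (nat m))
        * qbinom q (nat m) l
      else 0)"

text \<open>The lists below are indexed from \<open>0\<close>.\<close>

definition G_fun :: "real \<Rightarrow> real \<Rightarrow> real \<Rightarrow> nat \<Rightarrow> nat \<Rightarrow> nat list \<Rightarrow> real" where
  "G_fun q \<mu> y m l ds =
     (\<Sum>ls | length ls = length ds \<and> sum_list ls + l = sum_list ds + m.
        \<Prod>i<length ds. \<phi>_fun q \<mu> y (ls ! i)
          (int m + int (sum_list (take i ds)) - int (sum_list (take i ls))))"

end

theory Submission
  imports Defs
begin

text \<open>
  Acting on the Fock space, \<open>A\<^sub>a\<close> maps \<open>|m\<rangle>\<close> to combinations of \<open>|m - a + j\<rangle>\<close>, \<open>j \<ge> 0\<close>, and the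
  primed trace of a word is the sum over \<open>m\<close> of its diagonal entries minus their limit as
  \<open>m \<rightarrow> \<infinity>\<close>. The vacuum operator \<open>A\<^sub>0\<close> is triangular, with the largest eigenvalue
  \<open>\<Lambda> = (\<mu>y)\<^sub>\<infinity> / (y)\<^sub>\<infinity>\<close> at \<open>m = 0\<close>, so as \<open>L \<rightarrow> \<infinity>\<close> the trace of \<open>Q A\<^sub>0\<^sup>L\<close> is asymptotic to
  \<open>\<Lambda>\<^sup>L \<langle>0|Q|v\<rangle>\<close>, where \<open>v\<^sub>m = (\<mu>y)\<^sub>m / (y\<^sup>m (q)\<^sub>m)\<close>. By the q-Vandermonde identity \<open>v\<close> is a common
  right eigenvector of all \<open>A\<^sub>a\<close>, and conjugation by \<open>v\<close> turns \<open>A\<^sub>a\<close> into a multiple of the stochastic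
  matrix \<open>m \<rightarrow> m - l + a\<close> with probability \<open>\<phi>(l|m)\<close>. Hence \<open>P\<^sub>I(r, n)\<close> is a mixture, with weights
  \<open>G\<^sub>0\<^sub>,\<^sub>m(d\<^sub>1, \<dots>, d\<^sub>r)\<close>, of q-negative binomial distributions. Their means and currents are Lambert-type
  functions \<open>R(z)\<close> for which \<open>R(z) - R(qz)\<close> is elementary; telescoping gives the defect-free values
  and the finite corrections.
\<close>


section \<open>Basic hypergeometric series\<close>

text \<open>The primed trace is defined by coefficients of k^u and powers of y, while the limit of
  large L is visible only on Fock levels. The bridge is 1/(1 - q^u) = 1 + q^u + q^(2u) + ..., and it
  requires exchanging the expansion in y with the sum over levels. All matrix entries are
  nonnegative, but the y^0 part carries a k^0 term, so its diagonal entries do not decay and it must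
  be split off before the exchange. The same k^0 term is the obstacle for large L. For A_0^M it is a
  Taylor coefficient of ((\<mu>z)_\<infinity>/(z)_\<infinity>)^M and grows with M, so dominated
  convergence over the levels m needs a bound of the form B q^m \<Lambda>^M, uniform in M, for the
  difference of entry and k^0 part. Such a bound follows from the strict gap between the two largest
  eigenvalues of A_0. The eigenvector v is unbounded in m, but pairing with it is algebraic: a word
  with C factors c reaches target level p only from source levels at most p + C, so each component
  of its action on v is a finite sum.\<close>

lemma qpoch_0 [simp]: "qpoch q z 0 = 1"
  by (simp add: qpoch_def)

lemma qpoch_Suc: "qpoch q z (Suc m) = qpoch q z m * (1 - z * q ^ m)"
  by (simp add: qpoch_def)

lemma qpoch_add: "qpoch q z (m + n) = qpoch q z m * qpoch q (z * q ^ m) n"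
  by (induction n) (simp_all add: qpoch_Suc power_add mult_ac)

lemma gcoef_0 [simp]: "gcoef q a 0 = 1"
  by (simp add: gcoef_def)

text \<open>The basic hypergeometric series 1phi0(a; -; q, z), which resums the y-expansion of a
  site operator.\<close>

definition qbinomial_series :: "real \<Rightarrow> real \<Rightarrow> real \<Rightarrow> real" where
  "qbinomial_series q a z = (\<Sum>n. gcoef q a n * z ^ n)"

text \<open>The operator z d/dz applied termwise to \<open>qbinomial_series\<close>, so that no
  derivative has to be taken.\<close>

definition qbinomial_euler_series :: "real \<Rightarrow> real \<Rightarrow> real \<Rightarrow> real" where
  "qbinomial_euler_series q a z = (\<Sum>n. of_nat n * (gcoef q a n * z ^ n))"

text \<open>The form in which the hopping rates produce \<open>h_fun\<close>. The term n = 0 is 0/0,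
  which is 0 in HOL.\<close>

definition lambert_series :: "real \<Rightarrow> real \<Rightarrow> real" where
  "lambert_series q z = (\<Sum>n. of_nat n * z ^ n / (1 - q ^ n))"

section \<open>q-Pochhammer symbols, finite and infinite\<close>

locale q_param =
  fixes q :: real
  assumes q_pos: "0 < q" and q_less_1: "q < 1"
begin

lemma q_power_le_1: "q ^ n \<le> 1"
  using q_pos q_less_1 by (simp add: power_le_one)

lemma q_power_pos: "0 < q ^ n"
  using q_pos by simp

lemma one_minus_q_power_pos: "0 < 1 - z * q ^ n" if "0 \<le> z" "z < 1"
proof -
  have "z * q ^ n \<le> z * 1"
    using that q_power_le_1[of n] by (intro mult_left_mono) auto
  then show ?thesis using that by simp
qed

lemma qpoch_pos: "0 < qpoch q z m" if "0 \<le> z" "z < 1"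
  using one_minus_q_power_pos[OF that] by (simp add: qpoch_def prod_pos)

lemma qpoch_nonneg: "0 \<le> qpoch q z m" if "0 \<le> z" "z \<le> 1"
  unfolding qpoch_def
proof (rule prod_nonneg, safe)
  fix j
  have "z * q ^ j \<le> 1 * 1"
    using that q_power_le_1[of j] q_power_pos[of j] by (intro mult_mono) auto
  then show "0 \<le> 1 - z * q ^ j" by simp
qed

lemma qpoch_le_1: "qpoch q z m \<le> 1" if "0 \<le> z" "z \<le> 1"
  unfolding qpoch_def
proof (rule prod_le_1, safe)
  fix j
  have "z * q ^ j \<le> 1 * 1"
    using that q_power_le_1[of j] q_power_pos[of j] by (intro mult_mono) auto
  moreover have "0 \<le> z * q ^ j"
    using that q_power_pos[of j] by simp
  ultimately show "0 \<le> 1 - z * q ^ j" "1 - z * q ^ j \<le> 1" by simp_all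
qed

lemma qpoch_q_pos: "0 < qpoch q q m"
  using qpoch_pos q_pos q_less_1 by simp

lemma gcoef_nonneg: "0 \<le> gcoef q a n" if "0 \<le> a" "a \<le> 1"
  using qpoch_nonneg[OF that] qpoch_q_pos[of n] by (simp add: gcoef_def)

lemma gcoef_pos: "0 < gcoef q a n" if "0 \<le> a" "a < 1"
  using qpoch_pos[OF that] qpoch_q_pos[of n] by (simp add: gcoef_def)

lemma gcoef_Suc: "(1 - q ^ Suc n) * gcoef q a (Suc n) = (1 - a * q ^ n) * gcoef q a n"
proof -
  have "1 - q * q ^ n \<noteq> 0"
    using one_minus_q_power_pos[of q n] q_pos q_less_1 by simp
  then show ?thesis
    using qpoch_q_pos[of n] by (simp add: gcoef_def qpoch_Suc field_simps)
qed

lemma convergent_prod_qpoch: "convergent_prod (\<lambda>j. 1 - z * q ^ j)"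
proof -
  have "summable (\<lambda>j. \<bar>z\<bar> * q ^ j)"
    using q_pos q_less_1 by (intro summable_mult summable_geometric) simp
  then have "abs_convergent_prod (\<lambda>j. 1 - z * q ^ j)"
    using q_pos by (simp add: abs_convergent_prod_conv_summable abs_mult)
  then show ?thesis by (rule abs_convergent_prod_imp_convergent_prod)
qed

lemma qpoch_LIMSEQ: "qpoch q z \<longlonglongrightarrow> qpoch_inf q z"
  using convergent_prod_LIMSEQ[OF convergent_prod_qpoch[of z]]
  unfolding qpoch_inf_def qpoch_def lessThan_Suc_atMost[symmetric]
  by (rule LIMSEQ_imp_Suc)

lemma qpoch_inf_split: "qpoch_inf q z = qpoch q z m * qpoch_inf q (z * q ^ m)"
proof (rule LIMSEQ_unique)
  show "(\<lambda>n. qpoch q z (m + n)) \<longlonglongrightarrow> qpoch_inf q z"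
    using LIMSEQ_ignore_initial_segment[OF qpoch_LIMSEQ, of z m] by (simp add: add.commute)
  show "(\<lambda>n. qpoch q z (m + n)) \<longlonglongrightarrow> qpoch q z m * qpoch_inf q (z * q ^ m)"
    unfolding qpoch_add by (intro tendsto_intros qpoch_LIMSEQ)
qed

lemma qpoch_inf_pos: "0 < qpoch_inf q z" if "0 \<le> z" "z < 1"
proof -
  have "1 - z * q ^ j \<noteq> 0" for j
    using one_minus_q_power_pos[OF that, of j] by simp
  then have "qpoch_inf q z \<noteq> 0"
    unfolding qpoch_inf_def by (intro prodinf_nonzero convergent_prod_qpoch)
  moreover have "0 \<le> qpoch_inf q z"
    by (rule LIMSEQ_le_const[OF qpoch_LIMSEQ]) (use qpoch_pos[OF that] in \<open>auto intro: less_imp_le\<close>)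
  ultimately show ?thesis by simp
qed

text \<open>(q)_n decreases to (q)_\<infinity> > 0 and the numerator is at most 1. This uniform
  bound makes the series in \<open>gcoef\<close> comparable with geometric ones.\<close>

lemma gcoef_bounded: "\<bar>gcoef q a n\<bar> \<le> 1 / qpoch_inf q q" if "0 \<le> a" "a \<le> 1"
proof -
  have pos: "0 < qpoch_inf q q"
    using qpoch_inf_pos q_pos q_less_1 by simp
  have "qpoch q q n = qpoch_inf q q / qpoch_inf q (q * q ^ n)"
    using qpoch_inf_split[of q n] pos by (auto simp: field_simps)
  have "decseq (qpoch q q)"
  proof (rule decseq_SucI)
    fix n
    have "qpoch q q n * (1 - q * q ^ n) \<le> qpoch q q n * 1"
      using qpoch_q_pos[of n] q_pos by (intro mult_left_mono) auto
    then show "qpoch q q (Suc n) \<le> qpoch q q n" by (simp add: qpoch_Suc)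
  qed
  then have "qpoch_inf q q \<le> qpoch q q n"
    by (rule decseq_ge[OF _ qpoch_LIMSEQ])
  then have "gcoef q a n \<le> 1 / qpoch_inf q q"
    unfolding gcoef_def using qpoch_le_1[OF that, of n] pos by (intro frac_le) auto
  then show ?thesis using gcoef_nonneg[OF that, of n] by simp
qed

lemma summable_nat_power: "summable (\<lambda>n. of_nat n * z ^ n)" if "\<bar>z\<bar> < 1" for z :: real
proof -
  have "summable (\<lambda>n. of_nat (Suc n) * z ^ n - z ^ n)"
    using that by (intro summable_diff summable_geometric sums_summable[OF geometric_deriv_sums]) simp_all
  then show ?thesis by (simp add: algebra_simps)
qed

lemma sums_nat_power: "(\<lambda>n. of_nat n * z ^ n) sums (z / (1 - z)\<^sup>2)" if "\<bar>z\<bar> < 1" for z :: real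
proof -
  have "(\<lambda>n. z * (of_nat (Suc n) * z ^ n)) sums (z * (1 / (1 - z)\<^sup>2))"
    using that by (intro sums_mult geometric_deriv_sums) simp
  then have "(\<lambda>n. of_nat (Suc n) * z ^ Suc n) sums (z / (1 - z)\<^sup>2)"
    by (simp add: mult_ac)
  then show ?thesis by (subst (asm) sums_Suc_iff) simp
qed

lemma summable_qbinomial_euler:
  "summable (\<lambda>n. of_nat n * (gcoef q a n * z ^ n))" if "0 \<le> a" "a \<le> 1" "0 \<le> z" "z < 1"
proof (rule summable_comparison_test')
  show "summable (\<lambda>n. 1 / qpoch_inf q q * (of_nat n * z ^ n))"
    using that by (intro summable_mult summable_nat_power) simp
  show "norm (of_nat n * (gcoef q a n * z ^ n)) \<le> 1 / qpoch_inf q q * (of_nat n * z ^ n)"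
    if "0 \<le> n" for n
    using gcoef_bounded[OF \<open>0 \<le> a\<close> \<open>a \<le> 1\<close>, of n] \<open>0 \<le> z\<close>
    using mult_right_mono[of "\<bar>gcoef q a n\<bar>" "1 / qpoch_inf q q" "real n * z ^ n"]
    by (simp add: abs_mult mult_ac)
qed

lemma summable_qbinomial:
  "summable (\<lambda>n. gcoef q a n * z ^ n)" if "0 \<le> a" "a \<le> 1" "0 \<le> z" "z < 1"
proof (rule summable_comparison_test'[of _ 0])
  show "summable (\<lambda>n. 1 / qpoch_inf q q * z ^ n)"
    using that by (intro summable_mult summable_geometric) simp
  show "norm (gcoef q a n * z ^ n) \<le> 1 / qpoch_inf q q * z ^ n" for n
    using gcoef_bounded[OF \<open>0 \<le> a\<close> \<open>a \<le> 1\<close>, of n] \<open>0 \<le> z\<close>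
    using mult_right_mono[of "\<bar>gcoef q a n\<bar>" "1 / qpoch_inf q q" "z ^ n"]
    by (simp add: abs_mult)
qed

section \<open>The q-binomial theorem through its q-difference equation\<close>

lemma times_q_less_1: "0 \<le> q * z" "q * z < 1" if "0 \<le> z" "z < 1"
proof -
  have "q * z \<le> 1 * z"
    using that q_less_1 by (intro mult_right_mono) auto
  then show "0 \<le> q * z" "q * z < 1" using that q_pos by auto
qed

text \<open>The two-term recursion \<open>gcoef_Suc\<close> of the coefficients, multiplied by
  z^(n+1) and summed.\<close>

lemma qbinomial_series_functional:
  assumes "0 \<le> a" "a \<le> 1" "0 \<le> z" "z < 1"
  shows "(1 - z) * qbinomial_series q a z = (1 - a * z) * qbinomial_series q a (q * z)"
proof -
  let ?c = "gcoef q a"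
  have s: "summable (\<lambda>n. ?c n * z ^ n)" and sq: "summable (\<lambda>n. ?c n * (q * z) ^ n)"
    using assms times_q_less_1 by (auto intro!: summable_qbinomial)
  have "qbinomial_series q a z - qbinomial_series q a (q * z) =
      (\<Sum>n. ?c n * z ^ n - ?c n * (q * z) ^ n)"
    unfolding qbinomial_series_def using s sq by (rule suminf_diff)
  also have "\<dots> = (\<Sum>n. (1 - q ^ n) * ?c n * z ^ n)"
    by (simp add: algebra_simps power_mult_distrib)
  also have "\<dots> = (\<Sum>n. (1 - q ^ Suc n) * ?c (Suc n) * z ^ Suc n)"
  proof (subst suminf_split_head)
    have "summable (\<lambda>n. ?c n * z ^ n - ?c n * (q * z) ^ n)"
      using s sq by (rule summable_diff)
    then show "summable (\<lambda>n. (1 - q ^ n) * ?c n * z ^ n)"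
      by (simp add: algebra_simps power_mult_distrib)
  qed simp
  also have "\<dots> = (\<Sum>n. z * (?c n * z ^ n) - a * z * (?c n * (q * z) ^ n))"
    by (rule arg_cong[of _ _ suminf], rule ext) (simp only: gcoef_Suc, simp add: algebra_simps power_mult_distrib)
  also have "\<dots> = z * qbinomial_series q a z - a * z * qbinomial_series q a (q * z)"
    unfolding qbinomial_series_def
    by (intro sums_unique[symmetric] sums_diff sums_mult summable_sums s sq)
  finally show ?thesis by (simp add: algebra_simps)
qed

text \<open>This is z d/dz of \<open>qbinomial_series_functional\<close>, carried out on
  coefficients.\<close>

lemma qbinomial_euler_series_functional:
  assumes "0 \<le> a" "a \<le> 1" "0 \<le> z" "z < 1"
  shows "(1 - z) * qbinomial_euler_series q a z - z * qbinomial_series q a z =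
    (1 - a * z) * qbinomial_euler_series q a (q * z) - a * z * qbinomial_series q a (q * z)"
proof -
  let ?c = "gcoef q a" and ?d = "\<lambda>n. of_nat n * gcoef q a n"
  have s: "summable (\<lambda>n. ?c n * z ^ n)" and sq: "summable (\<lambda>n. ?c n * (q * z) ^ n)"
    using assms times_q_less_1 by (auto intro!: summable_qbinomial)
  have e: "summable (\<lambda>n. ?d n * z ^ n)" and eq: "summable (\<lambda>n. ?d n * (q * z) ^ n)"
    using assms times_q_less_1 summable_qbinomial_euler by (auto simp: mult.assoc)
  have [simp]: "qbinomial_euler_series q a x = (\<Sum>n. ?d n * x ^ n)" for x
    by (simp add: qbinomial_euler_series_def mult.assoc)
  have "qbinomial_euler_series q a z - qbinomial_euler_series q a (q * z) =
      (\<Sum>n. ?d n * z ^ n - ?d n * (q * z) ^ n)"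
    using e eq by (simp add: suminf_diff)
  also have "\<dots> = (\<Sum>n. ?d (Suc n) * z ^ Suc n - ?d (Suc n) * (q * z) ^ Suc n)"
    by (subst suminf_split_head) (use summable_diff[OF e eq] in auto)
  also have "\<dots> = (\<Sum>n. z * (?d n * z ^ n) + z * (?c n * z ^ n)
      - (a * z * (?d n * (q * z) ^ n) + a * z * (?c n * (q * z) ^ n)))"
  proof (rule arg_cong[of _ _ suminf], rule ext)
    fix n
    have "?d (Suc n) * z ^ Suc n - ?d (Suc n) * (q * z) ^ Suc n =
        of_nat (Suc n) * ((1 - q ^ Suc n) * ?c (Suc n)) * z ^ Suc n"
      by (simp add: algebra_simps power_mult_distrib)
    also have "\<dots> = z * (?d n * z ^ n) + z * (?c n * z ^ n)
      - (a * z * (?d n * (q * z) ^ n) + a * z * (?c n * (q * z) ^ n))"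
      unfolding gcoef_Suc by (simp add: algebra_simps power_mult_distrib)
    finally show "?d (Suc n) * z ^ Suc n - ?d (Suc n) * (q * z) ^ Suc n =
        z * (?d n * z ^ n) + z * (?c n * z ^ n)
      - (a * z * (?d n * (q * z) ^ n) + a * z * (?c n * (q * z) ^ n))" .
  qed
  also have "\<dots> = z * qbinomial_euler_series q a z + z * qbinomial_series q a z
      - (a * z * qbinomial_euler_series q a (q * z) + a * z * qbinomial_series q a (q * z))"
  proof -
    have "(\<lambda>n. z * (?d n * z ^ n) + z * (?c n * z ^ n)
      - (a * z * (?d n * (q * z) ^ n) + a * z * (?c n * (q * z) ^ n))) sums
     (z * qbinomial_euler_series q a z + z * qbinomial_series q a z
      - (a * z * qbinomial_euler_series q a (q * z) + a * z * qbinomial_series q a (q * z)))"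
      unfolding qbinomial_series_def \<open>\<And>x. qbinomial_euler_series q a x = (\<Sum>n. ?d n * x ^ n)\<close>
      using s sq e eq by (intro sums_diff sums_add sums_mult summable_sums)
    then show ?thesis by (rule sums_unique[symmetric])
  qed
  finally show ?thesis by (simp only: algebra_simps)
qed

lemma qbinomial_series_ge_1: "1 \<le> qbinomial_series q a z"
  if "0 \<le> a" "a \<le> 1" "0 \<le> z" "z < 1"
proof -
  have "(\<Sum>n<1. gcoef q a n * z ^ n) \<le> qbinomial_series q a z"
    unfolding qbinomial_series_def
    using that gcoef_nonneg by (intro sum_le_suminf summable_qbinomial) auto
  then show ?thesis by simp
qed

lemma mult_le_1_less_1: "0 \<le> z * x" "z * x < 1"
  if "0 \<le> z" "z < 1" "0 \<le> x" "x \<le> 1" for z x :: real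
  using mult_left_mono[of x 1 z] that by auto

text \<open>Every term of positive index carries a factor x^n \<le> x. With x a power of q this
  yields both the limit 1 and the geometric rate on which the trace estimates rest.\<close>

lemma qbinomial_series_scale: "qbinomial_series q a (z * x) - 1 \<le> x * qbinomial_series q a z"
  if "0 \<le> a" "a \<le> 1" "0 \<le> z" "z < 1" "0 \<le> x" "x \<le> 1"
proof -
  let ?c = "gcoef q a"
  have s: "summable (\<lambda>n. ?c n * z ^ n)" and sx: "summable (\<lambda>n. ?c n * (z * x) ^ n)"
    using that mult_le_1_less_1 by (auto intro!: summable_qbinomial)
  have "qbinomial_series q a (z * x) - 1 = (\<Sum>n. ?c (Suc n) * (z * x) ^ Suc n)"
    unfolding qbinomial_series_def using sx by (subst suminf_split_head) auto
  also have "\<dots> \<le> (\<Sum>n. x * (?c (Suc n) * z ^ Suc n))"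
  proof (rule suminf_le)
    show "summable (\<lambda>n. ?c (Suc n) * (z * x) ^ Suc n)"
      using sx by (subst summable_Suc_iff)
    show "summable (\<lambda>n. x * (?c (Suc n) * z ^ Suc n))"
      by (intro summable_mult, subst summable_Suc_iff) (rule s)
    fix n
    have "x ^ Suc n \<le> x" using that by (simp add: mult_left_le power_le_one)
    then have "?c (Suc n) * z ^ Suc n * x ^ Suc n \<le> ?c (Suc n) * z ^ Suc n * x"
      using that gcoef_nonneg by (intro mult_left_mono) auto
    then show "?c (Suc n) * (z * x) ^ Suc n \<le> x * (?c (Suc n) * z ^ Suc n)"
      by (simp only: power_mult_distrib mult_ac)
  qed
  also have "\<dots> = x * (qbinomial_series q a z - 1)"
  proof (rule sums_unique[symmetric, OF sums_mult])
    have "(\<lambda>n. ?c n * z ^ n) sums qbinomial_series q a z"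
      unfolding qbinomial_series_def using s by (rule summable_sums)
    then show "(\<lambda>n. ?c (Suc n) * z ^ Suc n) sums (qbinomial_series q a z - 1)"
      by (subst sums_Suc_iff) simp
  qed
  also have "\<dots> \<le> x * qbinomial_series q a z"
    using that by (simp add: mult_left_mono)
  finally show ?thesis .
qed

lemma q_power_LIMSEQ: "(\<lambda>n. q ^ n) \<longlonglongrightarrow> 0"
  using q_pos q_less_1 by (intro LIMSEQ_power_zero) simp

lemma qbinomial_series_LIMSEQ: "(\<lambda>n. qbinomial_series q a (z * q ^ n)) \<longlonglongrightarrow> 1"
  if "0 \<le> a" "a \<le> 1" "0 \<le> z" "z < 1"
proof (rule tendsto_sandwich)
  show "\<forall>\<^sub>F n in sequentially. 1 \<le> qbinomial_series q a (z * q ^ n)"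
    using that q_power_le_1 less_imp_le[OF q_power_pos]
    by (intro always_eventually allI qbinomial_series_ge_1 mult_le_1_less_1)
  show "\<forall>\<^sub>F n in sequentially. qbinomial_series q a (z * q ^ n) \<le> 1 + q ^ n * qbinomial_series q a z"
    using qbinomial_series_scale[OF that] q_power_le_1 q_power_pos
    by (intro always_eventually allI) (smt (verit))
  have "(\<lambda>n. 1 + q ^ n * qbinomial_series q a z) \<longlonglongrightarrow> 1 + 0 * qbinomial_series q a z"
    by (intro tendsto_intros q_power_LIMSEQ)
  then show "(\<lambda>n. 1 + q ^ n * qbinomial_series q a z) \<longlonglongrightarrow> 1" by simp
qed auto

theorem qbinomial_theorem:
  assumes "0 \<le> a" "a \<le> 1" "0 \<le> z" "z < 1"
  shows "qbinomial_series q a z = qpoch_inf q (a * z) / qpoch_inf q z"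
proof -
  \<comment> \<open>The functional equation applied at z, zq, ..., zq^(n-1), with denominators
    cleared.\<close>
  have iter: "qpoch q z n * qbinomial_series q a z =
      qpoch q (a * z) n * qbinomial_series q a (z * q ^ n)" for n
  proof (induction n)
    case (Suc n)
    have zn: "0 \<le> z * q ^ n" "z * q ^ n < 1"
      using assms q_power_le_1[of n] q_power_pos[of n] mult_le_1_less_1 by auto
    have "qpoch q z (Suc n) * qbinomial_series q a z =
        qpoch q (a * z) n * ((1 - z * q ^ n) * qbinomial_series q a (z * q ^ n))"
      using Suc by (simp add: qpoch_Suc)
    also have "\<dots> = qpoch q (a * z) n * ((1 - a * (z * q ^ n)) * qbinomial_series q a (q * (z * q ^ n)))"
      by (subst qbinomial_series_functional[OF assms(1,2) zn]) simp
    finally show ?case by (simp add: qpoch_Suc mult_ac)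
  qed simp
  have "qpoch_inf q z * qbinomial_series q a z = qpoch_inf q (a * z) * 1"
  proof (rule LIMSEQ_unique)
    show "(\<lambda>n. qpoch q z n * qbinomial_series q a z) \<longlonglongrightarrow> qpoch_inf q z * qbinomial_series q a z"
      by (intro tendsto_intros qpoch_LIMSEQ)
    show "(\<lambda>n. qpoch q z n * qbinomial_series q a z) \<longlonglongrightarrow> qpoch_inf q (a * z) * 1"
      unfolding iter using assms by (intro tendsto_mult qpoch_LIMSEQ qbinomial_series_LIMSEQ)
  qed
  then show ?thesis
    using qpoch_inf_pos[OF assms(3,4)] by (simp add: field_simps)
qed

text \<open>A function vanishing along z q^n is the sum of its q-differences. The infinite sum
  identifies the defect-free values, the finite one the corrections to them.\<close>

lemma q_telescope:
  fixes R g :: "real \<Rightarrow> real"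
  assumes step: "\<And>n. R (z * q ^ n) - R (z * q ^ Suc n) = g (z * q ^ n)"
    and lim: "(\<lambda>n. R (z * q ^ n)) \<longlonglongrightarrow> 0"
  shows "(\<lambda>n. g (z * q ^ n)) sums R z"
    and "R z - R (z * q ^ m) = (\<Sum>k<m. g (z * q ^ k))"
proof -
  show "(\<lambda>n. g (z * q ^ n)) sums R z"
    using telescope_sums'[OF lim] step by simp
  show "R z - R (z * q ^ m) = (\<Sum>k<m. g (z * q ^ k))"
    using sum_lessThan_telescope'[of "\<lambda>k. R (z * q ^ k)" m] by (simp only: step) simp
qed

lemma qbinomial_euler_series_scale:
  assumes "0 \<le> a" "a \<le> 1" "0 \<le> z" "z < 1" "0 \<le> x" "x \<le> 1"
  shows "0 \<le> qbinomial_euler_series q a (z * x)"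
    and "qbinomial_euler_series q a (z * x) \<le> x * qbinomial_euler_series q a z"
proof -
  let ?d = "\<lambda>z n. of_nat n * (gcoef q a n * z ^ n)"
  have s: "summable (?d z)" and sx: "summable (?d (z * x))"
    using assms mult_le_1_less_1 by (auto intro!: summable_qbinomial_euler)
  show "0 \<le> qbinomial_euler_series q a (z * x)"
    unfolding qbinomial_euler_series_def
    using assms gcoef_nonneg by (intro suminf_nonneg sx mult_nonneg_nonneg) auto
  have "?d (z * x) n \<le> x * ?d z n" for n
  proof (cases n)
    case (Suc k)
    have "x ^ n \<le> x" using assms Suc by (simp add: mult_left_le power_le_one)
    then have "?d z n * x ^ n \<le> ?d z n * x"
      using assms gcoef_nonneg by (intro mult_left_mono mult_nonneg_nonneg) auto
    then show ?thesis by (simp only: power_mult_distrib mult_ac)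
  qed simp
  then show "qbinomial_euler_series q a (z * x) \<le> x * qbinomial_euler_series q a z"
    unfolding qbinomial_euler_series_def
    by (subst suminf_mult[OF s, symmetric]) (intro suminf_le sx summable_mult s)
qed

text \<open>The ratio is the logarithmic derivative z F'/F of F = (az)_\<infinity>/(z)_\<infinity>.
  Dividing the differentiated functional equation by the original one makes its q-difference
  rational.\<close>

lemma qbinomial_euler_ratio:
  assumes "0 \<le> a" "a \<le> 1" "0 \<le> z" "z < 1"
  shows "(\<lambda>n. z * q ^ n / (1 - z * q ^ n) - a * z * q ^ n / (1 - a * z * q ^ n)) sums
      (qbinomial_euler_series q a z / qbinomial_series q a z)"
    and "qbinomial_euler_series q a z / qbinomial_series q a z
      - qbinomial_euler_series q a (z * q ^ m) / qbinomial_series q a (z * q ^ m) =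
      (\<Sum>k<m. z * q ^ k / (1 - z * q ^ k) - a * z * q ^ k / (1 - a * z * q ^ k))"
proof -
  define R where "R = (\<lambda>z. qbinomial_euler_series q a z / qbinomial_series q a z)"
  define g where "g = (\<lambda>z. z / (1 - z) - a * z / (1 - a * z))"
  have zn: "0 \<le> z * q ^ n" "z * q ^ n < 1" for n
    using mult_le_1_less_1[OF assms(3,4) less_imp_le[OF q_power_pos] q_power_le_1] by auto
  have step: "R w - R (w * q) = g w" if w: "0 \<le> w" "w < 1" for w
  proof -
    let ?D = "qbinomial_euler_series q a" and ?F = "qbinomial_series q a"
    have F: "0 < ?F w" "0 < ?F (q * w)"
      using qbinomial_series_ge_1[OF assms(1,2) w]
        qbinomial_series_ge_1[OF assms(1,2) times_q_less_1[OF w]] by linarith+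
    have aw: "0 < 1 - a * w" using mult_le_1_less_1[of w a] w assms by (simp add: mult.commute)
    \<comment> \<open>The common value of both sides of the functional equation; it is the
      denominator for both sides of the differentiated one.\<close>
    define X where "X = (1 - w) * ?F w"
    have X: "X = (1 - a * w) * ?F (q * w)"
      using qbinomial_series_functional[OF assms(1,2) w] by (simp add: X_def)
    have "R w - w / (1 - w) = ((1 - w) * ?D w - w * ?F w) / X"
      unfolding R_def X_def using w F by (simp add: field_simps)
    also have "\<dots> = ((1 - a * w) * ?D (q * w) - a * w * ?F (q * w)) / X"
      by (simp only: qbinomial_euler_series_functional[OF assms(1,2) w])
    also have "\<dots> = R (q * w) - a * w / (1 - a * w)"
      unfolding R_def X using aw F by (simp add: field_simps)
    finally show ?thesis by (simp add: g_def mult.commute)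
  qed
  have lim: "(\<lambda>n. R (z * q ^ n)) \<longlonglongrightarrow> 0"
  proof (rule tendsto_sandwich)
    have F: "1 \<le> qbinomial_series q a (z * q ^ n)" for n
      using qbinomial_series_ge_1[OF assms(1,2) zn] .
    have D: "0 \<le> qbinomial_euler_series q a (z * q ^ n)"
      "qbinomial_euler_series q a (z * q ^ n) \<le> q ^ n * qbinomial_euler_series q a z" for n
      using qbinomial_euler_series_scale[OF assms less_imp_le[OF q_power_pos] q_power_le_1] by auto
    show "\<forall>\<^sub>F n in sequentially. 0 \<le> R (z * q ^ n)"
      using F D unfolding R_def
      by (intro always_eventually allI divide_nonneg_nonneg) (auto intro: order_trans[OF zero_le_one])
    have "R (z * q ^ n) \<le> q ^ n * qbinomial_euler_series q a z" for n
    proof -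
      have "R (z * q ^ n) \<le> qbinomial_euler_series q a (z * q ^ n) / 1"
        unfolding R_def using F[of n] D[of n] by (intro divide_left_mono) auto
      then show ?thesis using D(2)[of n] by simp
    qed
    then show "\<forall>\<^sub>F n in sequentially. R (z * q ^ n) \<le> q ^ n * qbinomial_euler_series q a z"
      by simp
    have "(\<lambda>n. q ^ n * qbinomial_euler_series q a z) \<longlonglongrightarrow> 0 * qbinomial_euler_series q a z"
      by (intro tendsto_intros q_power_LIMSEQ)
    then show "(\<lambda>n. q ^ n * qbinomial_euler_series q a z) \<longlonglongrightarrow> 0" by simp
  qed auto
  have "R (z * q ^ n) - R (z * q ^ Suc n) = g (z * q ^ n)" for n
    using step[OF zn, of n] by (simp add: mult_ac)
  from q_telescope[OF this lim] show
    "(\<lambda>n. z * q ^ n / (1 - z * q ^ n) - a * z * q ^ n / (1 - a * z * q ^ n)) sums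
      (qbinomial_euler_series q a z / qbinomial_series q a z)"
    "qbinomial_euler_series q a z / qbinomial_series q a z
      - qbinomial_euler_series q a (z * q ^ m) / qbinomial_series q a (z * q ^ m) =
      (\<Sum>k<m. z * q ^ k / (1 - z * q ^ k) - a * z * q ^ k / (1 - a * z * q ^ k))"
    by (simp_all add: R_def g_def mult.assoc)
qed

lemma summable_lambert: "summable (\<lambda>n. of_nat n * z ^ n / (1 - q ^ n))" if "0 \<le> z" "z < 1"
proof (rule summable_comparison_test'[of _ 1])
  show "summable (\<lambda>n. of_nat n * z ^ n / (1 - q))"
    using that by (intro summable_divide summable_nat_power) simp
  show "norm (of_nat n * z ^ n / (1 - q ^ n)) \<le> of_nat n * z ^ n / (1 - q)" if "1 \<le> n" for n
  proof -
    have "q ^ n \<le> q ^ 1" using that q_pos q_less_1 by (intro power_decreasing) auto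
    then have "of_nat n * z ^ n / (1 - q ^ n) \<le> of_nat n * z ^ n / (1 - q)"
      using \<open>0 \<le> z\<close> q_less_1 by (intro divide_left_mono mult_pos_pos) auto
    then show ?thesis using \<open>0 \<le> z\<close> q_power_le_1[of n] by (simp add: abs_mult)
  qed
qed

text \<open>The factor 1 - q^n cancels in each term and leaves the sum of n z^n; at n = 0 both
  quotients are 0 by the convention 0/0 = 0.\<close>

lemma lambert_series_step: "lambert_series q z - lambert_series q (z * q) = z / (1 - z)\<^sup>2"
  if "0 \<le> z" "z < 1"
proof -
  have zq: "0 \<le> z * q" "z * q < 1"
    using times_q_less_1[OF that] by (simp_all add: mult.commute)
  have "(\<lambda>n. of_nat n * z ^ n / (1 - q ^ n) - of_nat n * (z * q) ^ n / (1 - q ^ n)) sums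
      (lambert_series q z - lambert_series q (z * q))"
    unfolding lambert_series_def
    by (intro sums_diff summable_sums summable_lambert that zq)
  also have "(\<lambda>n. of_nat n * z ^ n / (1 - q ^ n) - of_nat n * (z * q) ^ n / (1 - q ^ n)) =
      (\<lambda>n. of_nat n * z ^ n)"
  proof
    fix n
    show "of_nat n * z ^ n / (1 - q ^ n) - of_nat n * (z * q) ^ n / (1 - q ^ n) = of_nat n * z ^ n"
    proof (cases n)
      case (Suc k)
      have "q ^ n \<noteq> 1" using one_minus_q_power_pos[of q k] q_pos q_less_1 Suc by simp
      moreover have "of_nat n * z ^ n - of_nat n * (z * q) ^ n = of_nat n * z ^ n * (1 - q ^ n)"
        by (simp add: algebra_simps power_mult_distrib)
      ultimately show ?thesis by (simp add: diff_divide_distrib[symmetric])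
    qed simp
  qed
  finally show ?thesis
    using sums_unique2 sums_nat_power[of z] that by (metis abs_of_nonneg)
qed

lemma lambert_series_telescope:
  assumes "0 \<le> z" "z < 1"
  shows "(\<lambda>n. z * q ^ n / (1 - z * q ^ n)\<^sup>2) sums lambert_series q z"
    and "lambert_series q z - lambert_series q (z * q ^ m) = (\<Sum>k<m. z * q ^ k / (1 - z * q ^ k)\<^sup>2)"
proof -
  let ?t = "\<lambda>z n. of_nat n * z ^ n / (1 - q ^ n)"
  have zn: "0 \<le> z * q ^ n" "z * q ^ n < 1" for n
    using mult_le_1_less_1[OF assms less_imp_le[OF q_power_pos] q_power_le_1] by auto
  have lim: "(\<lambda>n. lambert_series q (z * q ^ n)) \<longlonglongrightarrow> 0"
  proof (rule tendsto_sandwich)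
    show "\<forall>\<^sub>F n in sequentially. 0 \<le> lambert_series q (z * q ^ n)"
      unfolding lambert_series_def using zn q_power_le_1
      by (intro always_eventually allI suminf_nonneg summable_lambert zn) auto
    have "lambert_series q (z * q ^ n) \<le> q ^ n * lambert_series q z" for n
    proof -
      have "?t (z * q ^ n) k \<le> q ^ n * ?t z k" for k
      proof (cases k)
        case (Suc l)
        have "(q ^ n) ^ k \<le> q ^ n"
          using Suc q_power_le_1[of n] q_power_pos[of n] by (simp add: mult_left_le power_le_one)
        then have "?t z k * (q ^ n) ^ k \<le> ?t z k * q ^ n"
          using assms q_power_le_1 by (intro mult_left_mono) auto
        then show ?thesis by (simp add: power_mult_distrib mult_ac)
      qed simp
      then show ?thesis
        unfolding lambert_series_def
        by (subst suminf_mult[OF summable_lambert[OF assms], symmetric])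
          (intro suminf_le summable_mult summable_lambert zn assms)
    qed
    then show "\<forall>\<^sub>F n in sequentially. lambert_series q (z * q ^ n) \<le> q ^ n * lambert_series q z"
      by simp
    have "(\<lambda>n. q ^ n * lambert_series q z) \<longlonglongrightarrow> 0 * lambert_series q z"
      by (intro tendsto_intros q_power_LIMSEQ)
    then show "(\<lambda>n. q ^ n * lambert_series q z) \<longlonglongrightarrow> 0" by simp
  qed auto
  have "lambert_series q (z * q ^ n) - lambert_series q (z * q ^ Suc n) =
      z * q ^ n / (1 - z * q ^ n)\<^sup>2" for n
    using lambert_series_step[OF zn, of n] by (simp add: mult_ac)
  from q_telescope[of "lambert_series q" _ "\<lambda>z. z / (1 - z)\<^sup>2", OF this lim]
  show "(\<lambda>n. z * q ^ n / (1 - z * q ^ n)\<^sup>2) sums lambert_series q z"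
    "lambert_series q z - lambert_series q (z * q ^ m) = (\<Sum>k<m. z * q ^ k / (1 - z * q ^ k)\<^sup>2)"
    by simp_all
qed

text \<open>Purely algebraic: 1 - q^(p+1) is split as (1 - q^(p+1-i)) + q^(p+1-i) (1 - q^i), and
  \<open>gcoef_Suc\<close> lowers one index in each part.\<close>

lemma q_vandermonde:
  "(\<Sum>i\<le>p. gcoef q a i * b ^ i * gcoef q b (p - i)) = gcoef q (a * b) p"
proof (induction p)
  case (Suc p)
  let ?f = "\<lambda>i. gcoef q a i * b ^ i" and ?g = "gcoef q b"
  have f: "(1 - q ^ Suc i) * ?f (Suc i) = b * (1 - a * q ^ i) * ?f i" for i
    using gcoef_Suc[of i a] by (simp add: mult_ac)
  have "(1 - q ^ Suc p) * (\<Sum>i\<le>Suc p. ?f i * ?g (Suc p - i)) =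
      (\<Sum>i\<le>Suc p. ?f i * ((1 - q ^ (Suc p - i)) * ?g (Suc p - i)))
      + (\<Sum>i\<le>Suc p. (1 - q ^ i) * ?f i * (q ^ (Suc p - i) * ?g (Suc p - i)))"
    unfolding sum_distrib_left sum.distrib[symmetric]
  proof (rule sum.cong)
    fix i assume "i \<in> {..Suc p}"
    then have "q ^ Suc p = q ^ i * q ^ (Suc p - i)"
      by (simp add: power_add[symmetric])
    then show "(1 - q ^ Suc p) * (?f i * ?g (Suc p - i)) =
        ?f i * ((1 - q ^ (Suc p - i)) * ?g (Suc p - i))
        + (1 - q ^ i) * ?f i * (q ^ (Suc p - i) * ?g (Suc p - i))"
      by (simp add: algebra_simps)
  qed simp
  also have "(\<Sum>i\<le>Suc p. ?f i * ((1 - q ^ (Suc p - i)) * ?g (Suc p - i))) =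
      (\<Sum>i\<le>p. ?f i * ((1 - b * q ^ (p - i)) * ?g (p - i)))"
  proof -
    have "(\<Sum>i\<le>Suc p. ?f i * ((1 - q ^ (Suc p - i)) * ?g (Suc p - i))) =
        (\<Sum>i\<le>p. ?f i * ((1 - q ^ Suc (p - i)) * ?g (Suc (p - i))))"
      by (simp add: Suc_diff_le)
    then show ?thesis by (simp only: gcoef_Suc)
  qed
  also have "(\<Sum>i\<le>Suc p. (1 - q ^ i) * ?f i * (q ^ (Suc p - i) * ?g (Suc p - i))) =
      (\<Sum>i\<le>p. b * (1 - a * q ^ i) * ?f i * (q ^ (p - i) * ?g (p - i)))"
    by (subst sum.atMost_Suc_shift) (simp only: f, simp)
  \<comment> \<open>The coefficients add up independently of i: (1 - b q^(p-i)) + b q^(p-i) (1 - a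
    q^i) = 1 - a b q^p.\<close>
  also have "(\<Sum>i\<le>p. ?f i * ((1 - b * q ^ (p - i)) * ?g (p - i))) +
      (\<Sum>i\<le>p. b * (1 - a * q ^ i) * ?f i * (q ^ (p - i) * ?g (p - i))) =
      (1 - a * b * q ^ p) * (\<Sum>i\<le>p. ?f i * ?g (p - i))"
    unfolding sum_distrib_left sum.distrib[symmetric]
  proof (rule sum.cong)
    fix i assume "i \<in> {..p}"
    then have "q ^ p = q ^ i * q ^ (p - i)"
      by (simp add: power_add[symmetric])
    then show "?f i * ((1 - b * q ^ (p - i)) * ?g (p - i))
        + b * (1 - a * q ^ i) * ?f i * (q ^ (p - i) * ?g (p - i)) =
        (1 - a * b * q ^ p) * (?f i * ?g (p - i))"
      by (simp add: algebra_simps)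
  qed simp
  finally have "(1 - q ^ Suc p) * (\<Sum>i\<le>Suc p. ?f i * ?g (Suc p - i)) =
      (1 - q ^ Suc p) * gcoef q (a * b) (Suc p)"
    by (simp only: Suc.IH gcoef_Suc)
  moreover have "1 - q ^ Suc p \<noteq> 0"
    using one_minus_q_power_pos[of q p] q_pos q_less_1 by simp
  ultimately show ?case by simp
qed simp

end


section \<open>Traces of graded operators\<close>

text \<open>\<open>C\<close> counts factors c and \<open>j\<close> factors b. The second clause
  guards the truncated \<open>m + j - C\<close>: where the true target level would be negative, the
  coefficient must vanish.\<close>

definition op_acts :: "real \<Rightarrow> nat \<Rightarrow> nat \<Rightarrow> linop \<Rightarrow> real poly \<Rightarrow> bool" where
  "op_acts q C j T P \<longleftrightarrow> (\<forall>m. appl T (ket m) = monom (of_real (poly P (q ^ m))) (m + j - C)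
      \<and> (m + j < C \<longrightarrow> poly P (q ^ m) = 0))"

context q_param
begin

text \<open>The q^i are pairwise distinct roots. At x = q^m the product is the matrix element of
  c^s, so this permits pulling c^s out of a lowering operator.\<close>

lemma poly_divisible_by_q_powers:
  fixes P :: "real poly"
  assumes "\<And>i. i < s \<Longrightarrow> poly P (q ^ i) = 0"
  shows "\<exists>R. \<forall>x. poly P x = poly R x * (\<Prod>i<s. 1 - x / q ^ i)"
  using assms
proof (induction s)
  case (Suc s)
  then obtain R where R: "\<And>x. poly P x = poly R x * (\<Prod>i<s. 1 - x / q ^ i)" by auto
  have "1 - q ^ s / q ^ i \<noteq> 0" if "i < s" for i
  proof
    assume "1 - q ^ s / q ^ i = 0"
    then have "q ^ s = q ^ i" using q_pos by (simp add: field_simps)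
    then show False using that q_pos q_less_1 by (simp add: power_inject_exp')
  qed
  then have "(\<Prod>i<s. 1 - q ^ s / q ^ i) \<noteq> 0" by simp
  then have "poly R (q ^ s) = 0" using R Suc.prems by (metis lessI mult_eq_0_iff)
  then obtain R' where R': "R = [:- (q ^ s), 1:] * R'"
    by (metis dvdE poly_eq_0_iff_dvd)
  have "poly P x = poly (smult (- (q ^ s)) R') x * (\<Prod>i<Suc s. 1 - x / q ^ i)" for x
    using q_pos by (simp add: R R' field_simps)
  then show ?case by blast
qed (use assms in \<open>auto intro: exI[of _ P]\<close>)

lemma basis_coeff_sum:
  assumes "T = (\<Sum>u\<le>degree R. scal (of_real (coeff R u)) * basis_op q (t, u))"
  shows "basis_coeff q T = (\<lambda>(t', u). if t' = t then of_real (coeff R u) else 0)"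
proof (rule basis_coeff_eqI[OF q_pos q_less_1])
  let ?f = "\<lambda>(t', u). if t' = t then complex_of_real (coeff R u) else 0"
  have supp: "{i. ?f i \<noteq> 0} = Pair t ` {u. coeff R u \<noteq> 0}"
    by (auto split: if_splits)
  have "{u. coeff R u \<noteq> 0} \<subseteq> {..degree R}" by (auto intro: le_degree)
  then show "finite {i. ?f i \<noteq> 0}" unfolding supp using finite_subset by blast
  have "(\<Sum>i | ?f i \<noteq> 0. scal (?f i) * basis_op q i) =
      (\<Sum>u | coeff R u \<noteq> 0. scal (of_real (coeff R u)) * basis_op q (t, u))"
    unfolding supp by (subst sum.reindex) (auto simp: inj_on_def)
  also have "\<dots> = T"
    unfolding assms by (rule sum.mono_neutral_left) (auto intro: le_degree simp: scal_0)
  finally show "T = (\<Sum>i | ?f i \<noteq> 0. scal (?f i) * basis_op q i)" by simp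
qed

lemma appl_basis_sum:
  "appl (\<Sum>u\<le>degree R. scal (of_real (coeff R u)) * basis_op q (t, u)) (ket m) =
    monom (of_real (poly R (q ^ (m - nat (- t)))) * (\<Prod>i<nat (- t). 1 - of_real q ^ (m - i)))
      (m - nat (- t) + nat t)"
proof -
  have "(\<Sum>u\<le>degree R. monom (z u) k) = monom (sum z {..degree R}) k" for z :: "nat \<Rightarrow> complex" and k
    by (rule poly_eqI) (simp add: coeff_sum)
  then show ?thesis
    by (simp add: appl_sum_op times_linop.rep_eq scal.rep_eq basis_op_monom smult_monom
        poly_altdef sum_distrib_left mult_ac)
qed

lemma basis_coeff_op_acts_diag:
  assumes "op_acts q C C T P"
  shows "basis_coeff q T = (\<lambda>(t, u). if t = 0 then of_real (coeff P u) else 0)"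
proof (rule basis_coeff_sum, rule linop_eqI)
  fix m
  show "appl T (ket m) = appl (\<Sum>u\<le>degree P. scal (of_real (coeff P u)) * basis_op q (0, u)) (ket m)"
    using assms by (simp add: appl_basis_sum op_acts_def)
qed

text \<open>The operator is b^t P(k) when raising and R'(k) c^s when lowering; either way it has a
  single degree t \<noteq> 0 and hence no pure power of k.\<close>

lemma basis_coeff_op_acts_off_diag:
  assumes "op_acts q C j T P" "j \<noteq> C"
  shows "basis_coeff q T (0, u) = 0"
proof (cases "C < j")
  case True
  have "T = (\<Sum>u\<le>degree P. scal (of_real (coeff P u)) * basis_op q (int j - int C, u))"
  proof (rule linop_eqI)
    fix m
    have "nat (int C - int j) = 0" "nat (int j - int C) = j - C" "m + (j - C) = m + j - C"
      using True by auto
    then show "appl T (ket m) =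
        appl (\<Sum>u\<le>degree P. scal (of_real (coeff P u)) * basis_op q (int j - int C, u)) (ket m)"
      using assms by (simp add: appl_basis_sum op_acts_def)
  qed
  from basis_coeff_sum[OF this] show ?thesis using True by simp
next
  case False
  define s where "s = C - j"
  have s: "s > 0" "C = j + s" using False assms by (auto simp: s_def)
  have act: "appl T (ket m) = monom (of_real (poly P (q ^ m))) (m - s)"
    "m < s \<Longrightarrow> poly P (q ^ m) = 0" for m
    using assms by (auto simp: op_acts_def s)
  then obtain R where R: "\<And>x. poly P x = poly R x * (\<Prod>i<s. 1 - x / q ^ i)"
    using poly_divisible_by_q_powers[of s P] by auto
  \<comment> \<open>In \<open>basis_op\<close> the powers of k stand to the left of c^s and see the
    level m - s; the rescaling by q^s compensates.\<close>
  define R' where "R' = R \<circ>\<^sub>p [:0, q ^ s:]"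
  have "T = (\<Sum>u\<le>degree R'. scal (of_real (coeff R' u)) * basis_op q (- int s, u))"
  proof (rule linop_eqI)
    fix m
    have "complex_of_real (poly P (q ^ m)) =
        of_real (poly R' (q ^ (m - s))) * (\<Prod>i<s. 1 - of_real q ^ (m - i))"
    proof (cases "m < s")
      case True
      then have "(\<Prod>i<s. 1 - complex_of_real q ^ (m - i)) = 0"
        by (intro prod_zero) (auto intro!: bexI[of _ m])
      then show ?thesis using act True by simp
    next
      case False
      have "(\<Prod>i<s. 1 - q ^ m / q ^ i) = (\<Prod>i<s. 1 - q ^ (m - i))"
        using False q_pos by (intro prod.cong) (simp_all add: power_diff)
      moreover have "q ^ (m - s) * q ^ s = q ^ m"
        using False by (simp add: power_add[symmetric])
      ultimately have "poly P (q ^ m) = poly R' (q ^ (m - s)) * (\<Prod>i<s. 1 - q ^ (m - i))"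
        by (simp add: R R'_def poly_pcompose)
      then show ?thesis by simp
    qed
    then show "appl T (ket m) =
        appl (\<Sum>u\<le>degree R'. scal (of_real (coeff R' u)) * basis_op q (- int s, u)) (ket m)"
      unfolding appl_basis_sum act by simp
  qed
  from basis_coeff_sum[OF this] show ?thesis using s by simp
qed

text \<open>The geometric series for 1/(1 - q^u): the prescribed trace is the sum of the entries
  over all levels once their limit, the constant term, is removed.\<close>

lemma geometric_trace:
  "(\<lambda>m. poly P (q ^ m) - poly P 0) sums
    (\<Sum>u | 1 \<le> u \<and> coeff P u \<noteq> 0. coeff P u * (1 / (1 - q ^ u)))"
proof -
  let ?U = "{u. 1 \<le> u \<and> coeff P u \<noteq> 0}"
  have sub: "?U \<subseteq> {1..degree P}" by (auto intro: le_degree)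
  have "(\<lambda>m. \<Sum>u\<in>?U. coeff P u * (q ^ u) ^ m) sums (\<Sum>u\<in>?U. coeff P u * (1 / (1 - q ^ u)))"
  proof (intro sums_sum sums_mult geometric_sums)
    fix u assume "u \<in> ?U"
    then show "norm (q ^ u) < 1" using q_pos q_less_1 by (simp add: power_less_one_iff)
  qed
  moreover have "(\<Sum>u\<in>?U. coeff P u * (q ^ u) ^ m) = poly P (q ^ m) - poly P 0" for m
  proof -
    have "(\<Sum>u\<in>?U. coeff P u * (q ^ u) ^ m) = (\<Sum>u=1..degree P. coeff P u * (q ^ m) ^ u)"
      using sub by (intro sum.mono_neutral_cong_left) (auto simp: power_mult[symmetric] mult.commute)
    also have "\<dots> = poly P (q ^ m) - poly P 0"
      unfolding poly_altdef[of P "q ^ m"]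
      by (simp add: sum.atLeast1_atMost_eq sum.atMost_shift poly_0_coeff_0 lessThan_Suc_atMost[symmetric]
          sum.lessThan_Suc_shift del: sum.lessThan_Suc)
    finally show ?thesis .
  qed
  ultimately show ?thesis by simp
qed

lemma k_trace_k_part_diag:
  assumes "op_acts q C C T P"
  shows "k_trace q (k_part q T) = of_real (\<Sum>m. poly P (q ^ m) - poly P 0)"
proof -
  define R where "R = P - [:poly P 0:]"
  have coeff_R: "coeff R u = (if u = 0 then 0 else coeff P u)" for u
    by (simp add: R_def poly_0_coeff_0 coeff_pCons split: nat.splits)
  note bc = basis_coeff_op_acts_diag[OF assms]
  have "k_part q T = (\<Sum>u | 1 \<le> u \<and> coeff P u \<noteq> 0. scal (of_real (coeff P u)) * basis_op q (0, u))"
    by (simp add: k_part_def bc basis_op_def)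
  also have "\<dots> = (\<Sum>u\<le>degree R. scal (of_real (coeff R u)) * basis_op q (0, u))"
    by (rule sum.mono_neutral_cong_left)
      (use le_degree[of R] in \<open>auto simp: coeff_R scal_0 split: if_splits\<close>)
  finally have "basis_coeff q (k_part q T) = (\<lambda>(t, u). if t = 0 then of_real (coeff R u) else 0)"
    by (rule basis_coeff_sum)
  then have "k_trace q (k_part q T) =
      (\<Sum>u | 1 \<le> u \<and> coeff P u \<noteq> 0. of_real (coeff P u) * (1 / (1 - of_real q ^ u)))"
    unfolding k_trace_def by (intro sum.cong) (auto simp: coeff_R)
  also have "\<dots> = of_real (\<Sum>m. poly P (q ^ m) - poly P 0)"
    unfolding sums_unique[OF geometric_trace, symmetric] by simp
  finally show ?thesis .
qed

lemma k_trace_k_part_off_diag: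
  assumes "op_acts q C j T P" "j \<noteq> C"
  shows "k_trace q (k_part q T) = 0"
proof -
  have "k_part q T = 0"
    by (simp add: k_part_def basis_coeff_op_acts_off_diag[OF assms])
  \<comment> \<open>\<open>basis_coeff\<close> is a definite description, so even its value at the
    zero operator has to come from an explicit expansion.\<close>
  moreover have "op_acts q 0 0 0 0"
    by (simp add: op_acts_def zero_linop.rep_eq)
  ultimately show ?thesis
    unfolding k_trace_def by (simp add: basis_coeff_op_acts_diag)
qed

end


section \<open>Transfer coefficients\<close>

text \<open>Tonelli for double series. It turns the termwise trace in powers of y into a sum over
  Fock levels.\<close>

lemma sums_swap_nonneg:
  fixes c :: "nat \<Rightarrow> nat \<Rightarrow> real"
  assumes nonneg: "\<And>N m. 0 \<le> c N m"
    and row: "\<And>N. c N sums t N"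
    and col: "\<And>m. (\<lambda>N. c N m) sums u m"
    and u: "summable u"
  shows "t sums suminf u"
proof -
  have row': "((\<lambda>m. c N m) has_sum t N) UNIV" for N
    using sums_nonneg_imp_has_sum[OF row nonneg] .
  have col': "((\<lambda>N. c N m) has_sum u m) UNIV" for m
    using sums_nonneg_imp_has_sum[OF col nonneg] .
  have "0 \<le> u m" for m
    using has_sum_nonneg[OF col'] nonneg by simp
  then have u': "(u has_sum suminf u) UNIV"
    using sums_nonneg_imp_has_sum summable_sums[OF u] by blast
  have "((\<lambda>(m, N). c N m) has_sum suminf u) (UNIV \<times> UNIV)"
  proof (rule has_sum_SigmaI[OF _ u'])
    show "(\<lambda>(m, N). c N m) summable_on UNIV \<times> UNIV"
      by (rule summable_on_SigmaI[where g = u])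
        (use col' u' nonneg in \<open>auto dest: has_sum_imp_summable\<close>)
  qed (use col' in simp)
  then have "((\<lambda>(N, m). c N m) has_sum suminf u) (UNIV \<times> UNIV)"
    by (subst has_sum_swap) simp
  then have "(t has_sum suminf u) UNIV"
    by (rule has_sum_SigmaD) (use row' in simp)
  then show ?thesis by (rule has_sum_imp_sums)
qed

text \<open>A geometric rate instead of mere convergence: it makes f - l summable over the levels
  and is inherited by sums, products and shifts, hence by words of operators.\<close>

definition q_tends :: "real \<Rightarrow> (nat \<Rightarrow> real) \<Rightarrow> real \<Rightarrow> bool" where
  "q_tends q f l \<longleftrightarrow> (\<exists>K. \<forall>m. \<bar>f m - l\<bar> \<le> K * q ^ m)"

text \<open>\<open>C\<close> is the number of factors \<open>c\<close> in \<open>Q\<close>. The part of \<open>Q\<close> with \<open>j\<close> factors \<open>b\<close> sends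
  \<open>|m\<rangle>\<close> to \<open>|m + j - C\<rangle>\<close>; \<open>S j m\<close> is its coefficient, summed over the powers of \<open>y\<close>, and \<open>T j\<close> is
  the contribution of \<open>k\<^sup>0\<close>, which the primed trace discards.\<close>

definition transfer ::
  "real \<Rightarrow> real \<Rightarrow> nat \<Rightarrow> linop fps fps \<Rightarrow> (nat \<Rightarrow> nat \<Rightarrow> real) \<Rightarrow> (nat \<Rightarrow> real) \<Rightarrow> bool" where
  "transfer q y C Q S T \<longleftrightarrow> (\<exists>P.
     (\<forall>N j. op_acts q C j (fps_nth (fps_nth Q N) j) (P N j)) \<and>
     (\<forall>N j m. 0 \<le> poly (P N j) (q ^ m)) \<and>
     (\<forall>N j. 0 < N \<longrightarrow> poly (P N j) 0 = 0) \<and>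
     (\<forall>j m. (\<lambda>N. poly (P N j) (q ^ m) * y ^ N) sums S j m) \<and>
     (\<forall>j. poly (P 0 j) 0 = T j)) \<and>
   (\<forall>j. q_tends q (S j) (T j))"

text \<open>At q^m this is (1 - q^m)...(1 - q^(m-a+1)), the matrix element of c^a, written as a
  polynomial in k with constant term 1.\<close>

definition falling_poly :: "real \<Rightarrow> nat \<Rightarrow> real poly" where
  "falling_poly q a = (\<Prod>i<a. [:1, - (1 / q ^ i):])"

context q_param
begin

lemma q_tendsE:
  assumes "q_tends q f l"
  obtains K where "0 \<le> K" "\<And>m. \<bar>f m - l\<bar> \<le> K * q ^ m"
proof -
  from assms obtain K where K: "\<And>m. \<bar>f m - l\<bar> \<le> K * q ^ m" by (auto simp: q_tends_def)
  have "0 \<le> K" using K[of 0] by simp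
  then show ?thesis using that K by blast
qed

lemma q_tends_const: "q_tends q (\<lambda>_. l) l"
  by (auto simp: q_tends_def intro: exI[of _ 0])

lemma q_tends_add:
  assumes "q_tends q f l" "q_tends q g k"
  shows "q_tends q (\<lambda>m. f m + g m) (l + k)"
proof -
  obtain K K' where "\<And>m. \<bar>f m - l\<bar> \<le> K * q ^ m" "\<And>m. \<bar>g m - k\<bar> \<le> K' * q ^ m"
    using assms by (auto simp: q_tends_def)
  then have "\<bar>f m + g m - (l + k)\<bar> \<le> (K + K') * q ^ m" for m
    using abs_triangle_ineq[of "f m - l" "g m - k"] by (smt (verit) distrib_right)
  then show ?thesis by (auto simp: q_tends_def)
qed

lemma q_tends_sum: "(\<And>i. i \<in> A \<Longrightarrow> q_tends q (f i) (l i)) \<Longrightarrow> q_tends q (\<lambda>m. \<Sum>i\<in>A. f i m) (sum l A)"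
  by (induction A rule: infinite_finite_induct) (auto intro: q_tends_add q_tends_const)

lemma q_tends_mult:
  assumes "q_tends q f l" "q_tends q g k"
  shows "q_tends q (\<lambda>m. f m * g m) (l * k)"
proof -
  obtain K K' where K: "0 \<le> K" "\<And>m. \<bar>f m - l\<bar> \<le> K * q ^ m"
    and K': "0 \<le> K'" "\<And>m. \<bar>g m - k\<bar> \<le> K' * q ^ m"
    using assms by (metis q_tendsE)
  have "\<bar>f m * g m - l * k\<bar> \<le> (K * (\<bar>k\<bar> + K') + \<bar>l\<bar> * K') * q ^ m" for m
  proof -
    have "\<bar>g m - k\<bar> \<le> K' * 1"
      using K'(2)[of m] mult_left_mono[OF q_power_le_1[of m] K'(1)] by linarith
    then have g: "\<bar>g m\<bar> \<le> \<bar>k\<bar> + K'" by linarith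
    have "f m * g m - l * k = (f m - l) * g m + l * (g m - k)"
      by (simp add: algebra_simps)
    then have "\<bar>f m * g m - l * k\<bar> \<le> \<bar>f m - l\<bar> * \<bar>g m\<bar> + \<bar>l\<bar> * \<bar>g m - k\<bar>"
      by (metis abs_mult abs_triangle_ineq)
    also have "\<dots> \<le> (K * q ^ m) * (\<bar>k\<bar> + K') + \<bar>l\<bar> * (K' * q ^ m)"
      using K K' g q_power_pos[of m] by (intro add_mono mult_mono mult_left_mono) auto
    finally show ?thesis by (simp add: algebra_simps)
  qed
  then show ?thesis by (auto simp: q_tends_def)
qed

text \<open>The shift costs at most a factor q^(-b) in the constant, also where
  \<open>m + a - b\<close> truncates to 0.\<close>

lemma q_tends_shift:
  assumes "q_tends q f l"
  shows "q_tends q (\<lambda>m. f (m + a - b)) l"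
proof -
  obtain K where K: "0 \<le> K" "\<And>m. \<bar>f m - l\<bar> \<le> K * q ^ m"
    using assms by (metis q_tendsE)
  have "\<bar>f (m + a - b) - l\<bar> \<le> (K / q ^ b) * q ^ m" for m
  proof -
    have "q ^ (m + a - b) * q ^ b = q ^ (m + a - b + b)" by (simp add: power_add)
    also have "\<dots> \<le> q ^ m"
      using q_pos q_less_1 by (intro power_decreasing) auto
    finally have "q ^ (m + a - b) \<le> q ^ m / q ^ b"
      using q_power_pos[of b] by (simp add: pos_le_divide_eq)
    then have "K * q ^ (m + a - b) \<le> K * (q ^ m / q ^ b)"
      using K(1) by (intro mult_left_mono)
    then show ?thesis using K(2)[of "m + a - b"] by simp
  qed
  then show ?thesis unfolding q_tends_def by blast
qed

lemma q_tends_power: "q_tends q (\<lambda>m. q ^ m) 0"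
  using less_imp_le[OF q_power_pos] by (auto simp: q_tends_def intro!: exI[of _ 1])

lemma q_tends_poly: "q_tends q (\<lambda>m. poly P (q ^ m)) (poly P 0)"
proof (induction P)
  case (pCons a P)
  have "q_tends q (\<lambda>m. a + q ^ m * poly P (q ^ m)) (a + 0 * poly P 0)"
    by (intro q_tends_add q_tends_const q_tends_mult q_tends_power pCons)
  then show ?case by simp
qed (simp add: q_tends_const)

lemma q_tends_summable:
  assumes "q_tends q f l"
  shows "summable (\<lambda>m. f m - l)"
proof -
  obtain K where K: "\<And>m. \<bar>f m - l\<bar> \<le> K * q ^ m"
    using assms by (metis q_tendsE)
  show ?thesis
  proof (rule summable_comparison_test'[of "\<lambda>m. K * q ^ m" 0])
    show "summable (\<lambda>m. K * q ^ m)"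
      using q_pos q_less_1 by (intro summable_mult summable_geometric) simp
  qed (use K in simp)
qed

lemma transferE:
  assumes "transfer q y C Q S T"
  obtains P where "\<And>N j. op_acts q C j (fps_nth (fps_nth Q N) j) (P N j)"
    "\<And>N j m. 0 \<le> poly (P N j) (q ^ m)"
    "\<And>N j. 0 < N \<Longrightarrow> poly (P N j) 0 = 0"
    "\<And>j m. (\<lambda>N. poly (P N j) (q ^ m) * y ^ N) sums S j m"
    "\<And>j. poly (P 0 j) 0 = T j"
  using assms unfolding transfer_def by blast

lemma transfer_vanish:
  assumes "transfer q y C Q S T" "m + j < C"
  shows "S j m = 0"
proof -
  obtain P where P: "\<And>N j. op_acts q C j (fps_nth (fps_nth Q N) j) (P N j)"
    "\<And>j m. (\<lambda>N. poly (P N j) (q ^ m) * y ^ N) sums S j m"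
    using transferE[OF assms(1)] by metis
  have "poly (P N j) (q ^ m) = 0" for N
    using P(1)[of j N] assms(2) by (simp add: op_acts_def)
  then show ?thesis using sums_unique[OF P(2)[of j m]] by simp
qed

text \<open>The right factor acts first and moves m to m + (j - i) - C', where the left factor is
  then evaluated. The number of b's and the power of y both convolve.\<close>

lemma transfer_mult:
  assumes y: "0 \<le> y" and QS: "transfer q y C Q S T" and QS': "transfer q y C' Q' S' T'"
  shows "transfer q y (C + C') (Q * Q')
    (\<lambda>j m. \<Sum>i\<le>j. S i (m + (j - i) - C') * S' (j - i) m) (\<lambda>j. \<Sum>i\<le>j. T i * T' (j - i))"
proof -
  obtain P where P: "\<And>N j. op_acts q C j (fps_nth (fps_nth Q N) j) (P N j)"
    "\<And>N j m. 0 \<le> poly (P N j) (q ^ m)"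
    "\<And>N j. 0 < N \<Longrightarrow> poly (P N j) 0 = 0"
    "\<And>j m. (\<lambda>N. poly (P N j) (q ^ m) * y ^ N) sums S j m"
    "\<And>j. poly (P 0 j) 0 = T j"
    by (rule transferE[OF QS]) (rule that)
  obtain P' where P': "\<And>N j. op_acts q C' j (fps_nth (fps_nth Q' N) j) (P' N j)"
    "\<And>N j m. 0 \<le> poly (P' N j) (q ^ m)"
    "\<And>N j. 0 < N \<Longrightarrow> poly (P' N j) 0 = 0"
    "\<And>j m. (\<lambda>N. poly (P' N j) (q ^ m) * y ^ N) sums S' j m"
    "\<And>j. poly (P' 0 j) 0 = T' j"
    by (rule transferE[OF QS']) (rule that)
  \<comment> \<open>The change of level becomes the substitution x -> q^(j-i-C') x, with an integer
    exponent because it can be negative.\<close>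
  define R where "R = (\<lambda>N j. \<Sum>n\<le>N. \<Sum>i\<le>j.
      (P n i \<circ>\<^sub>p [:0, q powi (int (j - i) - int C'):]) * P' (N - n) (j - i))"
  have vanish': "poly (P' n j) (q ^ m) = 0" if "m + j < C'" for n j m
    using P'(1)[of j n] that by (simp add: op_acts_def)
  have vanish: "poly (P n j) (q ^ m) = 0" if "m + j < C" for n j m
    using P(1)[of j n] that by (simp add: op_acts_def)
  \<comment> \<open>Where the intermediate level would be negative the right factor vanishes, so the
    true and the truncated shift agree on products.\<close>
  have shift: "poly (P n i) (q ^ m * q powi (int k - int C')) * poly (P' n' k) (q ^ m) =
      poly (P n i) (q ^ (m + k - C')) * poly (P' n' k) (q ^ m)" for n n' i k m
  proof (cases "m + k < C'")
    case False
    then have "int m + (int k - int C') = int (m + k - C')"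
      by (simp add: of_nat_diff)
    then have "q ^ (m + k - C') = q powi (int m + (int k - int C'))"
      by (simp only: power_int_of_nat)
    also have "\<dots> = q ^ m * q powi (int k - int C')"
      using q_pos by (simp add: power_int_add)
    finally show ?thesis by simp
  qed (simp add: vanish')
  have R: "poly (R N j) (q ^ m) = (\<Sum>n\<le>N. \<Sum>i\<le>j.
      poly (P n i) (q ^ (m + (j - i) - C')) * poly (P' (N - n) (j - i)) (q ^ m))" for N j m
  proof -
    have "poly [:0, c:] x = x * c" for c x :: real by simp
    then show ?thesis by (simp only: R_def poly_sum poly_mult poly_pcompose shift)
  qed
  have R0: "poly (R N j) 0 = (\<Sum>n\<le>N. \<Sum>i\<le>j. poly (P n i) 0 * poly (P' (N - n) (j - i)) 0)" for N j
    by (simp add: R_def poly_sum poly_pcompose)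
  have acts: "op_acts q (C + C') j (fps_nth (fps_nth (Q * Q') N) j) (R N j)" for N j
  proof -
    have summand: "appl (fps_nth (fps_nth Q n) i * fps_nth (fps_nth Q' (N - n)) (j - i)) (ket m) =
        monom (of_real (poly (P n i) (q ^ (m + (j - i) - C')) * poly (P' (N - n) (j - i)) (q ^ m)))
          (m + j - (C + C'))" if "i \<le> j" for n i m
    proof (cases "m + (j - i) < C'")
      case True
      then show ?thesis
        using P'(1)[of "j - i" "N - n"] by (simp add: op_acts_def times_linop.rep_eq vanish' appl_0)
    next
      case False
      have "appl (fps_nth (fps_nth Q n) i) (monom z p) = monom (z * of_real (poly (P n i) (q ^ p))) (p + i - C)"
        for z p
      proof -
        have "appl (fps_nth (fps_nth Q n) i) (ket p) = monom (of_real (poly (P n i) (q ^ p))) (p + i - C)"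
          using P(1)[of i n] by (simp add: op_acts_def)
        then show ?thesis
          by (subst monom_ket, subst appl_smult) (simp add: smult_monom)
      qed
      moreover have "m + (j - i) - C' + i - C = m + j - (C + C')"
        using False that by simp
      ultimately show ?thesis
        using P'(1)[of "j - i" "N - n"] by (simp add: op_acts_def times_linop.rep_eq mult.commute)
    qed
    have monom_sum: "(\<Sum>i\<in>A. monom (z i) k) = monom (sum z A) k" for z :: "nat \<Rightarrow> complex" and k A
      by (rule poly_eqI) (simp add: coeff_sum)
    show ?thesis
      unfolding op_acts_def
    proof (intro allI conjI impI)
      fix m
      have "appl (fps_nth (fps_nth (Q * Q') N) j) (ket m) =
          (\<Sum>n\<le>N. \<Sum>i\<le>j. appl (fps_nth (fps_nth Q n) i * fps_nth (fps_nth Q' (N - n)) (j - i)) (ket m))"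
        by (simp add: fps_mult_nth fps_sum_nth appl_sum_op atLeast0AtMost)
      also have "\<dots> = monom (of_real (poly (R N j) (q ^ m))) (m + j - (C + C'))"
        by (simp add: summand R monom_sum)
      finally show "appl (fps_nth (fps_nth (Q * Q') N) j) (ket m) =
          monom (of_real (poly (R N j) (q ^ m))) (m + j - (C + C'))" .
    next
      fix m assume m: "m + j < C + C'"
      have "poly (P n i) (q ^ (m + (j - i) - C')) * poly (P' n' (j - i)) (q ^ m) = 0" if "i \<le> j" for n n' i
      proof (cases "m + (j - i) < C'")
        case False
        then have "m + (j - i) - C' + i < C" using m that by linarith
        then show ?thesis by (simp add: vanish)
      qed (simp add: vanish')
      then show "poly (R N j) (q ^ m) = 0" unfolding R by (intro sum.neutral ballI) auto
    qed
  qed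
  have nonneg: "0 \<le> poly (R N j) (q ^ m)" for N j m
    unfolding R by (intro sum_nonneg mult_nonneg_nonneg P(2) P'(2))
  \<comment> \<open>One of n and N - n is positive, so one constant term vanishes: k^0 occurs only
    at y^0.\<close>
  have zero: "poly (R N j) 0 = 0" if "0 < N" for N j
  proof -
    have "poly (P n i) 0 * poly (P' (N - n) i') 0 = 0" for n i i'
      using P(3)[of n i] P'(3)[of "N - n" i'] that by (cases "n = 0") auto
    then show ?thesis unfolding R0 by (intro sum.neutral ballI) auto
  qed
  have sums: "(\<lambda>N. poly (R N j) (q ^ m) * y ^ N) sums (\<Sum>i\<le>j. S i (m + (j - i) - C') * S' (j - i) m)" for j m
  proof -
    have "(\<lambda>N. \<Sum>i\<le>j. \<Sum>n\<le>N. (poly (P n i) (q ^ (m + (j - i) - C')) * y ^ n) *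
        (poly (P' (N - n) (j - i)) (q ^ m) * y ^ (N - n))) sums
        (\<Sum>i\<le>j. S i (m + (j - i) - C') * S' (j - i) m)"
    proof (rule sums_sum)
      fix i
      let ?a = "\<lambda>n. poly (P n i) (q ^ (m + (j - i) - C')) * y ^ n"
      let ?b = "\<lambda>n. poly (P' n (j - i)) (q ^ m) * y ^ n"
      have abs: "norm (?a n) = ?a n" "norm (?b n) = ?b n" for n
        using P(2) P'(2) y by simp_all
      have "(\<lambda>N. \<Sum>n\<le>N. ?a n * ?b (N - n)) sums (suminf ?a * suminf ?b)"
        by (rule Cauchy_product_sums; unfold abs; rule sums_summable[OF P(4)] sums_summable[OF P'(4)])
      then show "(\<lambda>N. \<Sum>n\<le>N. ?a n * ?b (N - n)) sums (S i (m + (j - i) - C') * S' (j - i) m)"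
        using P(4)[of i] P'(4)[of "j - i" m] by (simp add: sums_iff)
    qed
    moreover have "(\<Sum>i\<le>j. \<Sum>n\<le>N. (poly (P n i) (q ^ (m + (j - i) - C')) * y ^ n) *
        (poly (P' (N - n) (j - i)) (q ^ m) * y ^ (N - n))) = poly (R N j) (q ^ m) * y ^ N" for N
    proof -
      have "y ^ n * y ^ (N - n) = y ^ N" if "n \<le> N" for n
        using that by (simp add: power_add[symmetric])
      then show ?thesis
        unfolding R sum_distrib_right
        by (subst sum.swap) (auto intro!: sum.cong simp: mult_ac)
    qed
    ultimately show ?thesis by simp
  qed
  have init: "poly (R 0 j) 0 = (\<Sum>i\<le>j. T i * T' (j - i))" for j
    by (simp add: R0 P(5) P'(5))
  have "q_tends q (\<lambda>m. \<Sum>i\<le>j. S i (m + (j - i) - C') * S' (j - i) m) (\<Sum>i\<le>j. T i * T' (j - i))" for j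
    using QS QS' unfolding transfer_def by (intro q_tends_sum q_tends_mult q_tends_shift) auto
  then show ?thesis
    unfolding transfer_def using acts nonneg zero sums init by (intro conjI exI[of _ R]) auto
qed

lemma transfer_one: "transfer q y 0 1 (\<lambda>j m. if j = 0 then 1 else 0) (\<lambda>j. if j = 0 then 1 else 0)"
  unfolding transfer_def
proof (intro conjI exI[of _ "\<lambda>N j. if N = 0 \<and> j = 0 then 1 else 0"] allI)
  show "op_acts q 0 j (fps_nth (fps_nth 1 N) j) (if N = 0 \<and> j = 0 then 1 else 0)" for N j
    by (simp add: op_acts_def one_linop.rep_eq zero_linop.rep_eq)
  show "(\<lambda>N. poly (if N = 0 \<and> j = 0 then 1 else 0) (q ^ m) * y ^ N) sums (if j = 0 then 1 else 0)"
    for j m :: nat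
    using sums_single[of 0 "\<lambda>N. if j = 0 then 1 else 0 :: real"]
    by (rule sums_cong[THEN iffD1, rotated]) auto
qed (auto simp: q_tends_const)

lemma transfer_trace:
  assumes y: "0 \<le> y" and QS: "transfer q y C Q S T"
  shows "summable (\<lambda>N. Tr_coeff q Q N * of_real y ^ N)"
    and "Tr' q y Q = of_real (\<Sum>m. S C m - T C)"
proof -
  obtain P where P: "\<And>N j. op_acts q C j (fps_nth (fps_nth Q N) j) (P N j)"
    "\<And>N j m. 0 \<le> poly (P N j) (q ^ m)"
    "\<And>N j. 0 < N \<Longrightarrow> poly (P N j) 0 = 0"
    "\<And>j m. (\<lambda>N. poly (P N j) (q ^ m) * y ^ N) sums S j m"
    "\<And>j. poly (P 0 j) 0 = T j"
    by (rule transferE[OF QS]) (rule that)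
  have ST: "summable (\<lambda>m. S C m - T C)"
    using QS by (intro q_tends_summable) (simp add: transfer_def)
  define t where "t = (\<lambda>N. \<Sum>m. poly (P N C) (q ^ m) - poly (P N C) 0)"
  have t: "(\<lambda>m. poly (P N C) (q ^ m) - poly (P N C) 0) sums t N" for N
    unfolding t_def using geometric_trace by (rule summable_sums[OF sums_summable])
  have coeff: "Tr_coeff q Q N = of_real (t N)" for N
  proof -
    \<comment> \<open>Only the component with as many b's as c's has a part along the powers of
      k.\<close>
    have "Tr_coeff q Q N = (\<Sum>j\<in>{C}. k_trace q (k_part q (fps_nth (fps_nth Q N) j)))"
      unfolding Tr_coeff_def using k_trace_k_part_off_diag[OF P(1)]
      by (intro suminf_finite) auto
    then show ?thesis using k_trace_k_part_diag[OF P(1)] by (simp add: t_def)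
  qed
  \<comment> \<open>The y^0 part is excluded, since its diagonal entries tend to the constant term
    and need not be summable over m. The other entries are nonnegative without constant term, so the
    summations can be exchanged; the y^0 part returns at the end as \<open>t 0\<close>.\<close>
  define c where "c = (\<lambda>N m. if N = 0 then 0 else poly (P N C) (q ^ m) * y ^ N)"
  define p where "p = (\<lambda>m. poly (P 0 C) (q ^ m))"
  have col: "(\<lambda>N. c N m) sums (S C m - p m)" for m
  proof -
    have "(\<lambda>N. poly (P N C) (q ^ m) * y ^ N - (if N = 0 then p m else 0)) sums (S C m - p m)"
      using P(4) sums_single[of 0 "\<lambda>_. p m"] by (rule sums_diff)
    then show ?thesis
      by (rule sums_cong[THEN iffD1, rotated]) (auto simp: c_def p_def)
  qed
  have p: "summable (\<lambda>m. p m - T C)" "t 0 = (\<Sum>m. p m - T C)"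
    using t[of 0] by (simp_all add: p_def P(5) sums_iff)
  have "(\<lambda>N. if N = 0 then 0 else t N * y ^ N) sums (\<Sum>m. S C m - p m)"
  proof (rule sums_swap_nonneg[OF _ _ col])
    show "0 \<le> c N m" for N m
      using P(2) y by (simp add: c_def)
    show "c N sums (if N = 0 then 0 else t N * y ^ N)" for N
      using sums_mult2[OF t[of N]] by (cases "N = 0") (simp_all add: c_def P(3) sums_zero)
    show "summable (\<lambda>m. S C m - p m)"
      using summable_diff[OF ST p(1)] by simp
  qed
  then have "(\<lambda>N. (if N = 0 then 0 else t N * y ^ N) + (if N = 0 then t 0 else 0)) sums
      ((\<Sum>m. S C m - p m) + t 0)"
    using sums_single[of 0 "\<lambda>_. t 0"] by (rule sums_add)
  moreover have "(\<Sum>m. S C m - p m) + t 0 = (\<Sum>m. S C m - T C)"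
    unfolding p(2) using suminf_diff[OF ST p(1)] by simp
  ultimately have "(\<lambda>N. t N * y ^ N) sums (\<Sum>m. S C m - T C)"
    by (simp add: if_distrib cong: if_cong) (rule sums_cong[THEN iffD1, rotated], assumption, auto)
  then have "(\<lambda>N. Tr_coeff q Q N * of_real y ^ N) sums of_real (\<Sum>m. S C m - T C)"
    unfolding coeff by (simp flip: of_real_power of_real_mult add: sums_of_real_iff)
  then show "summable (\<lambda>N. Tr_coeff q Q N * of_real y ^ N)"
    "Tr' q y Q = of_real (\<Sum>m. S C m - T C)"
    by (simp_all add: Tr'_def sums_iff)
qed

end


section \<open>Site operators\<close>

context q_param
begin

lemma falling_poly_0: "poly (falling_poly q a) 0 = 1"
  by (simp add: falling_poly_def poly_prod)

lemma falling_poly_prod: "poly (falling_poly q a) (q ^ m) = (\<Prod>i<a. 1 - q ^ (m - i))"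
proof (cases "m < a")
  case True
  have "(\<Prod>i<a. 1 - q ^ m / q ^ i) = 0"
    using True q_pos by (intro prod_zero) (auto intro!: bexI[of _ m])
  moreover have "(\<Prod>i<a. 1 - q ^ (m - i)) = 0"
    using True by (intro prod_zero) (auto intro!: bexI[of _ m])
  moreover have "poly (falling_poly q a) (q ^ m) = (\<Prod>i<a. 1 - q ^ m / q ^ i)"
    by (simp add: falling_poly_def poly_prod)
  ultimately show ?thesis by (simp only:)
next
  case False
  have "(\<Prod>i<a. 1 - q ^ m / q ^ i) = (\<Prod>i<a. 1 - q ^ (m - i))"
    using False q_pos by (intro prod.cong) (simp_all add: power_diff)
  then show ?thesis by (simp add: falling_poly_def poly_prod)
qed

lemma falling_poly_eq_0: "poly (falling_poly q a) (q ^ m) = 0" if "m < a"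
  unfolding falling_poly_prod using that by (auto intro!: prod_zero bexI[of _ m])

lemma falling_poly_eq: "poly (falling_poly q a) (q ^ (p + a)) = qpoch q q (p + a) / qpoch q q p"
proof (induction a)
  case (Suc a)
  have "poly (falling_poly q (Suc a)) (q ^ (p + Suc a)) =
      (1 - q ^ (p + Suc a)) * (\<Prod>i<a. 1 - q ^ (p + Suc a - Suc i))"
    unfolding falling_poly_prod by (subst prod.lessThan_Suc_shift) simp
  also have "(\<Prod>i<a. 1 - q ^ (p + Suc a - Suc i)) = qpoch q q (p + a) / qpoch q q p"
    using Suc.IH unfolding falling_poly_prod by simp
  finally show ?case by (simp add: qpoch_Suc)
qed (use qpoch_q_pos[of p] in \<open>simp add: falling_poly_def\<close>)

lemma falling_poly_nonneg: "0 \<le> poly (falling_poly q a) (q ^ m)"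
  unfolding falling_poly_prod using q_power_le_1 by (intro prod_nonneg) simp

lemma qbinomial_series_mono: "qbinomial_series q a x \<le> qbinomial_series q a z"
  if "0 \<le> a" "a \<le> 1" "0 \<le> x" "x \<le> z" "z < 1"
  unfolding qbinomial_series_def using that gcoef_nonneg
  by (intro suminf_le summable_qbinomial mult_left_mono power_mono) auto

end

locale zero_range = q_param +
  fixes \<mu> y :: real
  assumes mu_pos: "0 < \<mu>" and mu_less_1: "\<mu> < 1" and y_pos: "0 < y" and y_less_1: "y < 1"
begin

text \<open>The diagonal entry of A_0 at level m, that is
  (\<mu>yq^m)_\<infinity>/(yq^m)_\<infinity>; A_0 is triangular, so these are its
  eigenvalues.\<close>

definition lam :: "nat \<Rightarrow> real" where
  "lam m = qbinomial_series q \<mu> (y * q ^ m)"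

definition right_vec :: "nat \<Rightarrow> real" where
  "right_vec m = qpoch q (\<mu> * y) m / (y ^ m * qpoch q q m)"

text \<open>In X the powers of k stand left of c^a and see q^(m-a), hence the substitution x/q^a.
  The prefactor is written as g_a times \<open>gcoef q (\<mu> * q ^ a) n\<close>, so that summing
  over n gives a q-binomial series.\<close>

definition X_poly :: "nat \<Rightarrow> nat \<Rightarrow> nat \<Rightarrow> real poly" where
  "X_poly a n j = smult (gcoef q \<mu> j * (gcoef q \<mu> a * gcoef q (\<mu> * q ^ a) n))
     ((monom 1 n \<circ>\<^sub>p [:0, 1 / q ^ a:]) * falling_poly q a)"

lemma mu_q_power: "0 \<le> \<mu> * q ^ a" "\<mu> * q ^ a < 1"
  using mult_le_1_less_1[of \<mu> "q ^ a"] mu_pos mu_less_1 q_power_le_1[of a] q_power_pos[of a] by auto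

lemma y_q_power: "0 \<le> y * q ^ a" "y * q ^ a < 1"
  using mult_le_1_less_1[of y "q ^ a"] y_pos y_less_1 q_power_le_1[of a] q_power_pos[of a] by auto

lemma mu_y: "0 \<le> \<mu> * y" "\<mu> * y < 1"
  using mult_le_1_less_1[of \<mu> y] mu_pos mu_less_1 y_pos y_less_1 by auto

lemma X_poly_eq: "poly (X_poly a n j) (q ^ m) =
    gcoef q \<mu> j * (gcoef q \<mu> a * gcoef q (\<mu> * q ^ a) n * q ^ (n * (m - a))) * poly (falling_poly q a) (q ^ m)"
proof (cases "m < a")
  case False
  then have "q ^ m / q ^ a = q ^ (m - a)" using q_pos by (simp add: power_diff)
  then show ?thesis
    by (simp add: X_poly_def poly_pcompose poly_monom power_mult[symmetric] mult.commute[of n])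
qed (simp add: X_poly_def falling_poly_eq_0)

lemma X_poly_0: "poly (X_poly a n j) 0 = (if n = 0 then gcoef q \<mu> j * gcoef q \<mu> a else 0)"
  by (auto simp: X_poly_def poly_pcompose poly_monom falling_poly_0)

lemma X_poly_nonneg: "0 \<le> poly (X_poly a n j) (q ^ m)"
  unfolding X_poly_eq using mu_pos mu_less_1 mu_q_power[of a] q_pos
  by (intro mult_nonneg_nonneg gcoef_nonneg falling_poly_nonneg) auto

lemma op_acts_X: "op_acts q a j (fps_nth (X_op q \<mu> a n) j) (X_poly a n j)"
  unfolding op_acts_def
proof (intro allI conjI impI)
  fix m
  have coeff: "qpoch q \<mu> (a + n) / (qpoch q q a * qpoch q q n) = gcoef q \<mu> a * gcoef q (\<mu> * q ^ a) n"
    by (simp add: gcoef_def qpoch_add)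
  have "appl (fps_nth (X_op q \<mu> a n) j) (ket m) =
      monom (of_real (gcoef q \<mu> j * (gcoef q \<mu> a * gcoef q (\<mu> * q ^ a) n) *
        ((\<Prod>i<a. 1 - q ^ (m - i)) * q ^ (n * (m - a))))) (m - a + j)"
    by (simp add: X_op_def b_ratio_def coeff times_linop.rep_eq scal.rep_eq appl_smult
        b_op_power_monom c_op_power_monom k_op_power_monom smult_monom power_mult[symmetric] mult_ac)
  then have act: "appl (fps_nth (X_op q \<mu> a n) j) (ket m) =
      monom (of_real (poly (X_poly a n j) (q ^ m))) (m - a + j)"
    unfolding X_poly_eq falling_poly_prod by (simp only: mult_ac)
  show "appl (fps_nth (X_op q \<mu> a n) j) (ket m) =
      monom (of_real (poly (X_poly a n j) (q ^ m))) (m + j - a)"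
  proof (cases "m < a")
    case True
    then show ?thesis unfolding act by (simp add: X_poly_eq falling_poly_eq_0)
  next
    case False
    then show ?thesis unfolding act by simp
  qed
next
  fix m assume "m + j < a"
  then show "poly (X_poly a n j) (q ^ m) = 0" by (simp add: X_poly_eq falling_poly_eq_0)
qed

lemma transfer_X:
  "transfer q y a (fps_const (X_op q \<mu> a n))
     (\<lambda>j m. gcoef q \<mu> j * (gcoef q \<mu> a * gcoef q (\<mu> * q ^ a) n * q ^ (n * (m - a))) * poly (falling_poly q a) (q ^ m))
     (\<lambda>j. if n = 0 then gcoef q \<mu> j * gcoef q \<mu> a else 0)"
  unfolding transfer_def X_poly_eq[symmetric] X_poly_0[symmetric]
proof (intro conjI exI[of _ "\<lambda>N j. if N = 0 then X_poly a n j else 0"] allI)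
  show "op_acts q a j (fps_nth (fps_nth (fps_const (X_op q \<mu> a n)) N) j) (if N = 0 then X_poly a n j else 0)"
    for N j
    using op_acts_X by (simp add: op_acts_def zero_linop.rep_eq)
  show "(\<lambda>N. poly (if N = 0 then X_poly a n j else 0) (q ^ m) * y ^ N) sums poly (X_poly a n j) (q ^ m)"
    for j m
    using sums_single[of 0 "\<lambda>N. poly (X_poly a n j) (q ^ m)"]
    by (rule sums_cong[THEN iffD1, rotated]) auto
qed (auto simp: X_poly_nonneg q_tends_poly)

lemma transfer_A:
  "transfer q y a (A_op q \<mu> a)
     (\<lambda>j m. gcoef q \<mu> j * (gcoef q \<mu> a * qbinomial_series q (\<mu> * q ^ a) (y * q ^ (m - a))) * poly (falling_poly q a) (q ^ m))
     (\<lambda>j. gcoef q \<mu> j * gcoef q \<mu> a)"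
  unfolding transfer_def
proof (intro conjI exI[of _ "\<lambda>N j. X_poly a N j"] allI impI)
  show "op_acts q a j (fps_nth (fps_nth (A_op q \<mu> a) N) j) (X_poly a N j)" for N j
    using op_acts_X by (simp add: A_op_def)
  show "(\<lambda>N. poly (X_poly a N j) (q ^ m) * y ^ N) sums
    (gcoef q \<mu> j * (gcoef q \<mu> a * qbinomial_series q (\<mu> * q ^ a) (y * q ^ (m - a))) * poly (falling_poly q a) (q ^ m))"
    for j m
  proof -
    have "(\<lambda>N. gcoef q (\<mu> * q ^ a) N * (y * q ^ (m - a)) ^ N) sums
        qbinomial_series q (\<mu> * q ^ a) (y * q ^ (m - a))"
      unfolding qbinomial_series_def
      using mu_q_power[of a] y_q_power by (intro summable_sums summable_qbinomial) auto
    then have "(\<lambda>N. gcoef q \<mu> j * (gcoef q \<mu> a * (gcoef q (\<mu> * q ^ a) N * (y * q ^ (m - a)) ^ N)) * poly (falling_poly q a) (q ^ m)) sums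
        (gcoef q \<mu> j * (gcoef q \<mu> a * qbinomial_series q (\<mu> * q ^ a) (y * q ^ (m - a))) * poly (falling_poly q a) (q ^ m))"
      by (intro sums_mult sums_mult2)
    moreover have "gcoef q \<mu> j * (gcoef q \<mu> a * (gcoef q (\<mu> * q ^ a) N * (y * q ^ (m - a)) ^ N)) * poly (falling_poly q a) (q ^ m)
        = poly (X_poly a N j) (q ^ m) * y ^ N" for N
    proof -
      have "(y * q ^ (m - a)) ^ N = y ^ N * q ^ (N * (m - a))"
        by (metis power_mult_distrib power_mult mult.commute)
      then show ?thesis unfolding X_poly_eq by (simp only: mult_ac)
    qed
    ultimately show ?thesis by (simp only:)
  qed
  have "q_tends q (\<lambda>m. qbinomial_series q (\<mu> * q ^ a) (y * q ^ m)) 1"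
    unfolding q_tends_def
  proof (intro exI allI)
    fix m
    have "1 \<le> qbinomial_series q (\<mu> * q ^ a) (y * q ^ m)"
      using mu_q_power[of a] y_q_power[of m] by (intro qbinomial_series_ge_1) auto
    moreover have "qbinomial_series q (\<mu> * q ^ a) (y * q ^ m) - 1 \<le> q ^ m * qbinomial_series q (\<mu> * q ^ a) y"
      using mu_q_power[of a] y_pos y_less_1 q_power_pos[of m] q_power_le_1[of m]
      by (intro qbinomial_series_scale) auto
    ultimately show "\<bar>qbinomial_series q (\<mu> * q ^ a) (y * q ^ m) - 1\<bar> \<le>
        qbinomial_series q (\<mu> * q ^ a) y * q ^ m" by (simp add: mult.commute)
  qed
  from q_tends_shift[OF this, of 0 a]
  have lim: "q_tends q (\<lambda>m. qbinomial_series q (\<mu> * q ^ a) (y * q ^ (m - a))) 1" by simp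
  show "q_tends q (\<lambda>m. gcoef q \<mu> j * (gcoef q \<mu> a * qbinomial_series q (\<mu> * q ^ a) (y * q ^ (m - a))) *
      poly (falling_poly q a) (q ^ m)) (gcoef q \<mu> j * gcoef q \<mu> a)" for j
  proof -
    have "q_tends q (\<lambda>m. gcoef q \<mu> j * (gcoef q \<mu> a * qbinomial_series q (\<mu> * q ^ a) (y * q ^ (m - a))) *
      poly (falling_poly q a) (q ^ m)) (gcoef q \<mu> j * (gcoef q \<mu> a * 1) * poly (falling_poly q a) 0)"
      by (intro q_tends_mult q_tends_const q_tends_poly lim)
    then show ?thesis by (simp add: falling_poly_0)
  qed
qed (auto simp: X_poly_nonneg X_poly_0)

text \<open>The transfer coefficients of \<open>A\<^sub>0\<^sup>M\<close>.\<close>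

primrec vac_power :: "nat \<Rightarrow> nat \<Rightarrow> nat \<Rightarrow> real" where
  "vac_power 0 j m = (if j = 0 then 1 else 0)"
| "vac_power (Suc M) j m = (\<Sum>i\<le>j. gcoef q \<mu> i * lam (m + (j - i)) * vac_power M (j - i) m)"

text \<open>The part of A_0^M at k^0: the Taylor coefficients of
  ((\<mu>z)_\<infinity>/(z)_\<infinity>)^M, since the eigenvalues of A_0 tend to 1 as the level
  grows.\<close>

primrec vac_power_inf :: "nat \<Rightarrow> nat \<Rightarrow> real" where
  "vac_power_inf 0 j = (if j = 0 then 1 else 0)"
| "vac_power_inf (Suc M) j = (\<Sum>i\<le>j. gcoef q \<mu> i * vac_power_inf M (j - i))"

lemma transfer_vac_power: "transfer q y 0 (A_op q \<mu> 0 ^ M) (vac_power M) (vac_power_inf M)"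
proof (induction M)
  case 0
  have "vac_power 0 = (\<lambda>j m. if j = 0 then 1 else 0)" "vac_power_inf 0 = (\<lambda>j. if j = 0 then 1 else 0)"
    by (auto simp: fun_eq_iff)
  then show ?case using transfer_one by simp
next
  case (Suc M)
  have "vac_power (Suc M) = (\<lambda>j m. \<Sum>i\<le>j. gcoef q \<mu> i * lam (m + (j - i)) * vac_power M (j - i) m)"
    "vac_power_inf (Suc M) = (\<lambda>j. \<Sum>i\<le>j. gcoef q \<mu> i * vac_power_inf M (j - i))"
    by (auto simp: fun_eq_iff)
  then show ?case
    using transfer_mult[OF less_imp_le[OF y_pos] transfer_A[of 0] Suc]
    by (simp add: lam_def falling_poly_def)
qed

section \<open>Spectral gap of the vacuum operator and growth of its powers\<close>

lemma lam_ge_1: "1 \<le> lam m"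
  unfolding lam_def using mu_pos mu_less_1 y_q_power by (intro qbinomial_series_ge_1) auto

lemma lam_antimono: "m \<le> n \<Longrightarrow> lam n \<le> lam m"
  unfolding lam_def using mu_pos mu_less_1 y_q_power y_pos q_pos q_less_1
  by (intro qbinomial_series_mono mult_left_mono power_decreasing) auto

text \<open>The ratio of the first two eigenvalues is (1 - \<mu>y)/(1 - y), which exceeds 1 because
  \<mu> < 1.\<close>

lemma lam_1_less: "lam 1 < lam 0"
proof -
  have "(1 - y) * lam 0 = (1 - \<mu> * y) * lam 1"
    using qbinomial_series_functional[of \<mu> y] mu_pos mu_less_1 y_pos y_less_1
    by (simp add: lam_def mult.commute)
  moreover have "1 - y < 1 - \<mu> * y" using mu_less_1 y_pos by simp
  then have "(1 - y) * lam 1 < (1 - \<mu> * y) * lam 1"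
    using lam_ge_1[of 1] by (intro mult_strict_right_mono) auto
  ultimately have "(1 - y) * lam 1 < (1 - y) * lam 0" by simp
  then show ?thesis using y_less_1 by simp
qed

lemma lam_minus_1: "lam m - 1 \<le> q ^ m * lam 0"
  unfolding lam_def using qbinomial_series_scale[of \<mu> y "q ^ m"]
    mu_pos mu_less_1 y_pos y_less_1 q_power_pos[of m] q_power_le_1[of m] by simp

lemma vac_power_inf_nonneg: "0 \<le> vac_power_inf M j"
  using mu_pos mu_less_1 by (induction M arbitrary: j) (auto intro!: sum_nonneg mult_nonneg_nonneg gcoef_nonneg)

lemma vac_power_lower: "vac_power_inf M j \<le> vac_power M j m"
proof (induction M arbitrary: j)
  case (Suc M)
  have "gcoef q \<mu> i * vac_power_inf M (j - i) \<le> gcoef q \<mu> i * lam (m + (j - i)) * vac_power M (j - i) m" for i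
  proof -
    have "1 * vac_power_inf M (j - i) \<le> lam (m + (j - i)) * vac_power M (j - i) m"
      using Suc lam_ge_1 vac_power_inf_nonneg by (intro mult_mono) (auto intro: order_trans[OF zero_le_one])
    then have "gcoef q \<mu> i * (1 * vac_power_inf M (j - i)) \<le> gcoef q \<mu> i * (lam (m + (j - i)) * vac_power M (j - i) m)"
      using mu_pos mu_less_1 by (intro mult_left_mono gcoef_nonneg) auto
    then show ?thesis by (simp add: mult.assoc)
  qed
  then show ?case unfolding vac_power.simps vac_power_inf.simps by (intro sum_mono)
qed auto

lemma vac_power_nonneg: "0 \<le> vac_power M j m"
  using vac_power_inf_nonneg vac_power_lower by (rule order_trans)

text \<open>A_0 never lowers the level, so each eigenvalue met on the way is at most the one at the
  source.\<close>

lemma vac_power_upper: "vac_power M j m \<le> lam m ^ M * vac_power_inf M j"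
proof (induction M arbitrary: j)
  case (Suc M)
  have "gcoef q \<mu> i * lam (m + (j - i)) * vac_power M (j - i) m \<le>
      gcoef q \<mu> i * lam m * (lam m ^ M * vac_power_inf M (j - i))" for i
    using mu_pos mu_less_1 lam_ge_1 Suc vac_power_nonneg
    by (intro mult_mono mult_nonneg_nonneg gcoef_nonneg lam_antimono)
      (auto intro: order_trans[OF zero_le_one])
  then have "vac_power (Suc M) j m \<le> (\<Sum>i\<le>j. gcoef q \<mu> i * lam m * (lam m ^ M * vac_power_inf M (j - i)))"
    unfolding vac_power.simps by (intro sum_mono)
  then show ?case by (simp add: sum_distrib_left mult_ac)
qed auto

text \<open>A coefficient of a power series with nonnegative coefficients is at most
  \<open>\<epsilon>\<close> to the minus \<open>j\<close> times its value at \<open>\<epsilon>\<close>; for small \<open>\<epsilon>\<close> that value is close to \<open>1\<close>.\<close>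

lemma vac_power_inf_bound:
  obtains \<beta> E where "1 \<le> \<beta>" "\<beta> * lam 1 < lam 0" "\<And>j. 0 \<le> E j"
    "\<And>M j. vac_power_inf M j \<le> E j * \<beta> ^ M"
proof -
  \<comment> \<open>The k^0 part may grow like \<beta>^M as long as \<beta> fits into the gap
    between \<open>lam 1\<close> and \<open>lam 0\<close>; an eigenvalue \<open>lam n\<close> with n
    large does.\<close>
  have "(\<lambda>n. lam n * lam 1) \<longlonglongrightarrow> 1 * lam 1"
    unfolding lam_def using mu_pos mu_less_1 y_pos y_less_1
    by (intro tendsto_intros qbinomial_series_LIMSEQ) auto
  then have "\<forall>\<^sub>F n in sequentially. lam n * lam 1 < lam 0"
    using lam_1_less by (intro order_tendstoD) auto
  then obtain n where n: "lam n * lam 1 < lam 0"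
    by (auto simp: eventually_sequentially)
  \<comment> \<open>At this point the power series has exactly the value \<open>lam n\<close>, which
    serves as \<beta>.\<close>
  define \<epsilon> where "\<epsilon> = y * q ^ n"
  have eps: "0 < \<epsilon>" "\<epsilon> < 1" using y_q_power y_pos q_pos by (simp_all add: \<epsilon>_def)
  have "vac_power_inf M j \<le> (1 / \<epsilon>) ^ j * lam n ^ M" for M j
  proof (induction M arbitrary: j)
    case (Suc M)
    have g: "0 \<le> gcoef q \<mu> i" for i using mu_pos mu_less_1 by (intro gcoef_nonneg) auto
    have "vac_power_inf (Suc M) j \<le> (\<Sum>i\<le>j. gcoef q \<mu> i * ((1 / \<epsilon>) ^ (j - i) * lam n ^ M))"
      using g Suc by (auto intro!: sum_mono mult_left_mono)
    also have "\<dots> = (\<Sum>i\<le>j. gcoef q \<mu> i * \<epsilon> ^ i) * ((1 / \<epsilon>) ^ j * lam n ^ M)"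
      unfolding sum_distrib_right
    proof (intro sum.cong refl)
      fix i assume "i \<in> {..j}"
      then have "(1 / \<epsilon>) ^ j = (1 / \<epsilon>) ^ i * (1 / \<epsilon>) ^ (j - i)"
        by (simp only: power_add[symmetric] atMost_iff le_add_diff_inverse)
      moreover have "\<epsilon> ^ i * (1 / \<epsilon>) ^ i = 1"
        using eps by (simp add: power_one_over)
      ultimately show "gcoef q \<mu> i * ((1 / \<epsilon>) ^ (j - i) * lam n ^ M) =
          gcoef q \<mu> i * \<epsilon> ^ i * ((1 / \<epsilon>) ^ j * lam n ^ M)"
        by simp
    qed
    also have "(\<Sum>i\<le>j. gcoef q \<mu> i * \<epsilon> ^ i) \<le> lam n"
      unfolding lam_def qbinomial_series_def \<epsilon>_def[symmetric]
      using eps mu_pos mu_less_1 g by (intro sum_le_suminf summable_qbinomial) auto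
    finally show ?case using eps lam_ge_1[of n] by (simp add: mult_right_mono mult_ac)
  qed (use eps in simp)
  moreover have "0 \<le> (1 / \<epsilon>) ^ j" for j using eps by simp
  ultimately show ?thesis
    using n lam_ge_1[of n] by (intro that[of "lam n" "\<lambda>j. (1 / \<epsilon>) ^ j"])
qed

text \<open>The q-binomial theorem gives infinite products at yq^p and \<mu>yq^(p+a); splitting off
  finite factors leaves a rational multiple of the top eigenvalue, the same for every a.\<close>

lemma qbinomial_series_shift:
  "qbinomial_series q (\<mu> * q ^ a) (y * q ^ p) = lam 0 * qpoch q y p / qpoch q (\<mu> * y) (p + a)"
proof -
  have "qbinomial_series q (\<mu> * q ^ a) (y * q ^ p) =
      qpoch_inf q (\<mu> * y * q ^ (p + a)) / qpoch_inf q (y * q ^ p)"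
    using mu_q_power[of a] y_q_power[of p] by (subst qbinomial_theorem) (auto simp: power_add mult_ac)
  moreover have "lam 0 = qpoch_inf q (\<mu> * y) / qpoch_inf q y"
    unfolding lam_def using mu_pos mu_less_1 y_pos y_less_1 by (subst qbinomial_theorem) auto
  moreover have "0 < qpoch q y p" "0 < qpoch q (\<mu> * y) (p + a)" "0 < qpoch_inf q (y * q ^ p)"
    using qpoch_pos qpoch_inf_pos y_q_power mu_y y_pos y_less_1 by auto
  moreover note qpoch_inf_split[of "\<mu> * y" "p + a"] qpoch_inf_split[of y p]
  ultimately show ?thesis by simp
qed

end


section \<open>The vacuum operator and its top eigenvector\<close>

text \<open>Transfer coefficients are indexed by the source level; here they act as a matrix on the
  column vector \<open>w\<close>, with \<open>p\<close> the target level.\<close>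

definition dual_action :: "nat \<Rightarrow> (nat \<Rightarrow> nat \<Rightarrow> real) \<Rightarrow> (nat \<Rightarrow> real) \<Rightarrow> nat \<Rightarrow> real" where
  "dual_action C S w p = (\<Sum>i\<le>p + C. S i (p + C - i) * w (p + C - i))"

lemma dual_action_mult:
  assumes vanish: "\<And>j m. m + j < C' \<Longrightarrow> S' j m = 0"
  shows "dual_action (C + C') (\<lambda>j m. \<Sum>i\<le>j. S i (m + (j - i) - C') * S' (j - i) m) w p =
    dual_action C S (dual_action C' S' w) p"
proof -
  define n where "n = p + C"
  define g where "g = (\<lambda>i j. S i (n - i) * (S' j (n + C' - (i + j)) * w (n + C' - (i + j))))"
  have "dual_action (C + C') (\<lambda>j m. \<Sum>i\<le>j. S i (m + (j - i) - C') * S' (j - i) m) w p =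
      (\<Sum>k\<le>n + C'. \<Sum>i\<le>k. g i (k - i))"
    unfolding dual_action_def add.assoc[symmetric] n_def[symmetric] sum_distrib_right
  proof (intro sum.cong refl)
    fix k i assume "k \<in> {..n + C'}" "i \<in> {..k}"
    then have "n + C' - k + (k - i) - C' = n - i" "i + (k - i) = k" by auto
    then show "S i (n + C' - k + (k - i) - C') * S' (k - i) (n + C' - k) * w (n + C' - k) = g i (k - i)"
      by (simp only: g_def mult.assoc)
  qed
  also have "\<dots> = (\<Sum>(i, j)\<in>{(i, j). i + j \<le> n + C'}. g i j)"
    by (rule sum.triangle_reindex_eq[symmetric])
  also have "{(i, j). i + j \<le> n + C'} = Sigma {..n + C'} (\<lambda>i. {..n + C' - i})" by auto
  also have "(\<Sum>(i, j)\<in>\<dots>. g i j) = (\<Sum>i\<le>n + C'. \<Sum>j\<le>n + C' - i. g i j)"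
    by (rule sum.Sigma[symmetric]) auto
  \<comment> \<open>For i > n the intermediate level n - i would be negative, and there the right
    factor vanishes.\<close>
  also have "\<dots> = (\<Sum>i\<le>n. \<Sum>j\<le>n + C' - i. g i j)"
  proof (rule sum.mono_neutral_right)
    show "\<forall>i\<in>{..n + C'} - {..n}. (\<Sum>j\<le>n + C' - i. g i j) = 0"
    proof (intro ballI sum.neutral)
      fix i j assume "i \<in> {..n + C'} - {..n}" "j \<in> {..n + C' - i}"
      then have "n + C' - (i + j) + j < C'" by auto
      then show "g i j = 0" by (simp add: g_def vanish)
    qed
  qed auto
  also have "\<dots> = dual_action C S (dual_action C' S' w) p"
    unfolding dual_action_def n_def[symmetric] sum_distrib_left
  proof (intro sum.cong refl)
    fix i assume "i \<in> {..n}"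
    then show "{..n + C' - i} = {..n - i + C'}" by auto
    fix j assume "j \<in> {..n - i + C'}"
    then have "n + C' - (i + j) = n - i + C' - j" using \<open>i \<in> {..n}\<close> by auto
    then show "g i j = S i (n - i) * (S' j (n - i + C' - j) * w (n - i + C' - j))"
      by (simp only: g_def)
  qed
  finally show ?thesis .
qed

lemma sum_triangle_swap:
  fixes g :: "nat \<Rightarrow> nat \<Rightarrow> 'a::comm_monoid_add"
  shows "(\<Sum>l\<le>j. \<Sum>i\<le>j - l. g l i) = (\<Sum>i\<le>j. \<Sum>l\<le>j - i. g l i)"
proof -
  have "(\<Sum>l\<le>j. \<Sum>i\<le>j - l. g l i) = (\<Sum>(l, i)\<in>Sigma {..j} (\<lambda>l. {..j - l}). g l i)"
    by (rule sum.Sigma) auto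
  also have "\<dots> = (\<Sum>(i, l)\<in>Sigma {..j} (\<lambda>l. {..j - l}). g l i)"
    by (rule sum.reindex_bij_witness[of _ "\<lambda>(a, b). (b, a)" "\<lambda>(a, b). (b, a)"]) auto
  also have "\<dots> = (\<Sum>i\<le>j. \<Sum>l\<le>j - i. g l i)"
    by (rule sum.Sigma[symmetric]) auto
  finally show ?thesis .
qed

context zero_range
begin

text \<open>The Markov operator of the stochastic matrix, in its backward form on functions of the
  level.\<close>

definition step :: "nat \<Rightarrow> (nat \<Rightarrow> real) \<Rightarrow> nat \<Rightarrow> real" where
  "step a f p = (\<Sum>l\<le>p. \<phi>_fun q \<mu> y l (int p) * f (p - l + a))"

lemma phi_eq: "\<phi>_fun q \<mu> y l (int p) =
    gcoef q \<mu> l * y ^ l * gcoef q y (p - l) / gcoef q (\<mu> * y) p" if "l \<le> p"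
  using that qpoch_q_pos[of p] by (simp add: \<phi>_fun_def qbinom_def gcoef_def mult_ac)

text \<open>q-Vandermonde with parameters \<mu> and y is precisely this normalisation.\<close>

lemma sum_phi: "(\<Sum>l\<le>p. \<phi>_fun q \<mu> y l (int p)) = 1"
proof -
  have "(\<Sum>l\<le>p. \<phi>_fun q \<mu> y l (int p)) =
      (\<Sum>l\<le>p. gcoef q \<mu> l * y ^ l * gcoef q y (p - l)) / gcoef q (\<mu> * y) p"
    unfolding sum_divide_distrib by (intro sum.cong) (auto simp: phi_eq)
  also have "\<dots> = 1"
    unfolding q_vandermonde using gcoef_pos[OF mu_y, of p] by simp
  finally show ?thesis .
qed

lemma step_const: "step a (\<lambda>_. c) p = c"
  by (simp add: step_def sum_distrib_right[symmetric] sum_phi)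

lemma right_vec_pos: "0 < right_vec p"
  unfolding right_vec_def using qpoch_pos[OF mu_y, of p] qpoch_q_pos[of p] y_pos by simp

lemma right_vec_0: "right_vec 0 = 1"
  by (simp add: right_vec_def)

text \<open>The quotient of \<open>right_vec\<close> at source and target absorbs c^a and turns g_i
  into \<open>\<phi>_fun\<close>, up to (\<mu>y)_m/(y)_(m-a). The factor \<kappa> is left free
  because A and X differ only there.\<close>

lemma site_action:
  assumes S: "\<And>i m. S i m = gcoef q \<mu> i * \<kappa> (m - a) * poly (falling_poly q a) (q ^ m)"
  shows "dual_action a S (\<lambda>p. right_vec p * f p) p = right_vec p / y ^ a *
    step a (\<lambda>m. \<kappa> (m - a) * qpoch q (\<mu> * y) m / qpoch q y (m - a) * f m) p"
proof -
  \<comment> \<open>Terms with i > p start below level a, where c^a vanishes.\<close>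
  have "dual_action a S (\<lambda>p. right_vec p * f p) p =
      (\<Sum>i\<le>p. S i (p + a - i) * (right_vec (p + a - i) * f (p + a - i)))"
    unfolding dual_action_def
    by (rule sum.mono_neutral_right) (auto simp: S falling_poly_eq_0)
  also have "\<dots> = (\<Sum>i\<le>p. right_vec p / y ^ a * (\<phi>_fun q \<mu> y i (int p) *
      (\<kappa> (p - i) * qpoch q (\<mu> * y) (p - i + a) / qpoch q y (p - i) * f (p - i + a))))"
  proof (intro sum.cong refl)
    fix i assume "i \<in> {..p}"
    define k where "k = p - i"
    have p: "p = k + i" using \<open>i \<in> {..p}\<close> by (auto simp: k_def)
    have e: "k + i + a - i = k + a" by simp
    have pos: "0 < qpoch q q k" "0 < qpoch q q (k + i)" "0 < qpoch q q (k + a)" "0 < qpoch q y k"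
      "0 < qpoch q (\<mu> * y) (k + i)" "0 < qpoch q (\<mu> * y) (k + a)"
      using qpoch_q_pos qpoch_pos mu_y y_pos y_less_1 by auto
    have "S i (k + a) * (right_vec (k + a) * f (k + a)) =
      right_vec (k + i) / y ^ a * (\<phi>_fun q \<mu> y i (int (k + i)) *
      (\<kappa> k * qpoch q (\<mu> * y) (k + a) / qpoch q y k * f (k + a)))"
      unfolding S falling_poly_eq right_vec_def phi_eq[OF le_add2] using pos y_pos
      by (simp add: gcoef_def power_add)
    then show "S i (p + a - i) * (right_vec (p + a - i) * f (p + a - i)) =
        right_vec p / y ^ a * (\<phi>_fun q \<mu> y i (int p) *
      (\<kappa> (p - i) * qpoch q (\<mu> * y) (p - i + a) / qpoch q y (p - i) * f (p - i + a)))"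
      unfolding p add_diff_cancel_right' e .
  qed
  also have "\<dots> = right_vec p / y ^ a *
    step a (\<lambda>m. \<kappa> (m - a) * qpoch q (\<mu> * y) m / qpoch q y (m - a) * f m) p"
    unfolding step_def by (simp add: sum_distrib_left)
  finally show ?thesis .
qed

text \<open>The eigenvalue of A_a on \<open>right_vec\<close>.\<close>

definition site_weight :: "nat \<Rightarrow> real" where
  "site_weight a = lam 0 * gcoef q \<mu> a / y ^ a"

definition A_action :: "nat \<Rightarrow> (nat \<Rightarrow> real) \<Rightarrow> nat \<Rightarrow> real" where
  "A_action a = dual_action a (\<lambda>j m. gcoef q \<mu> j *
     (gcoef q \<mu> a * qbinomial_series q (\<mu> * q ^ a) (y * q ^ (m - a))) * poly (falling_poly q a) (q ^ m))"

definition X_action :: "nat \<Rightarrow> nat \<Rightarrow> (nat \<Rightarrow> real) \<Rightarrow> nat \<Rightarrow> real" where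
  "X_action a n = dual_action a (\<lambda>j m. gcoef q \<mu> j *
     (gcoef q \<mu> a * gcoef q (\<mu> * q ^ a) n * q ^ (n * (m - a))) * poly (falling_poly q a) (q ^ m))"

text \<open>For a \<le> m, the ratio of the entries of X_(a,n) and A_a at level m; times y^n it is a
  probability in n.\<close>

definition occupation :: "nat \<Rightarrow> nat \<Rightarrow> nat \<Rightarrow> real" where
  "occupation a n m =
     gcoef q (\<mu> * q ^ a) n * q ^ (n * (m - a)) * qpoch q (\<mu> * y) m / qpoch q y (m - a) / lam 0"

lemma step_cong: "step a f p = step a g p" if "\<And>m. a \<le> m \<Longrightarrow> f m = g m"
  unfolding step_def using that by (intro sum.cong) auto

lemma step_mult: "step a (\<lambda>m. c * f m) p = c * step a f p"
  unfolding step_def by (simp add: sum_distrib_left mult_ac)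

text \<open>By \<open>qbinomial_series_shift\<close> the leftover Pochhammer factors cancel; f = 1
  then shows \<open>right_vec\<close> to be an eigenvector for every a at once.\<close>

lemma A_action_right_vec:
  "A_action a (\<lambda>p. right_vec p * f p) p = site_weight a * (right_vec p * step a f p)"
proof -
  have "step a (\<lambda>m. gcoef q \<mu> a * qbinomial_series q (\<mu> * q ^ a) (y * q ^ (m - a)) *
      qpoch q (\<mu> * y) m / qpoch q y (m - a) * f m) p = step a (\<lambda>m. (lam 0 * gcoef q \<mu> a) * f m) p"
  proof (rule step_cong)
    fix m assume "a \<le> m"
    have "0 < qpoch q y (m - a)" "0 < qpoch q (\<mu> * y) m"
      using qpoch_pos mu_y y_pos y_less_1 by auto
    then show "gcoef q \<mu> a * qbinomial_series q (\<mu> * q ^ a) (y * q ^ (m - a)) *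
      qpoch q (\<mu> * y) m / qpoch q y (m - a) * f m = lam 0 * gcoef q \<mu> a * f m"
      using \<open>a \<le> m\<close> by (simp add: qbinomial_series_shift)
  qed
  then show ?thesis
    unfolding A_action_def
    by (subst site_action[OF refl]) (simp add: step_mult site_weight_def)
qed

lemma X_action_right_vec:
  "X_action a n right_vec p = site_weight a * (right_vec p * step a (occupation a n) p)"
proof -
  have "step a (\<lambda>m. gcoef q \<mu> a * gcoef q (\<mu> * q ^ a) n * q ^ (n * (m - a)) *
      qpoch q (\<mu> * y) m / qpoch q y (m - a) * 1) p = step a (\<lambda>m. (lam 0 * gcoef q \<mu> a) * occupation a n m) p"
    using lam_ge_1[of 0] by (intro step_cong) (simp add: occupation_def)
  then show ?thesis
    unfolding X_action_def
    using site_action[where \<kappa> = "\<lambda>k. gcoef q \<mu> a * gcoef q (\<mu> * q ^ a) n * q ^ (n * k)" and f = "\<lambda>_. 1", OF refl, of a p]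
    by (simp add: step_mult site_weight_def)
qed

lemma A_0_eigenvector: "(\<Sum>i\<le>p. gcoef q \<mu> i * lam (p - i) * right_vec (p - i)) = lam 0 * right_vec p"
proof -
  have "A_action 0 (\<lambda>p. right_vec p * 1) p = lam 0 * right_vec p"
    unfolding A_action_right_vec by (simp add: step_const site_weight_def)
  then show ?thesis
    by (simp add: A_action_def dual_action_def lam_def falling_poly_def)
qed

text \<open>The eigenvector equation of A_0^M read at target level j, where l is the source
  level.\<close>

lemma vac_power_right_vec: "(\<Sum>l\<le>j. vac_power M (j - l) l * right_vec l) = lam 0 ^ M * right_vec j"
proof (induction M arbitrary: j)
  case 0
  have "(\<Sum>l\<le>j. vac_power 0 (j - l) l * right_vec l) = (\<Sum>l\<in>{j}. vac_power 0 (j - l) l * right_vec l)"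
    by (rule sum.mono_neutral_right) auto
  then show ?case by simp
next
  case (Suc M)
  define g where "g = (\<lambda>l i. gcoef q \<mu> i * lam (j - i) * vac_power M (j - l - i) l * right_vec l)"
  have "(\<Sum>l\<le>j. vac_power (Suc M) (j - l) l * right_vec l) = (\<Sum>l\<le>j. \<Sum>i\<le>j - l. g l i)"
    unfolding vac_power.simps sum_distrib_right g_def by (intro sum.cong) (auto simp: Nat.add_diff_assoc)
  also have "\<dots> = (\<Sum>i\<le>j. \<Sum>l\<le>j - i. g l i)"
    by (rule sum_triangle_swap)
  also have "\<dots> = (\<Sum>i\<le>j. gcoef q \<mu> i * lam (j - i) * (lam 0 ^ M * right_vec (j - i)))"
    unfolding Suc.IH[symmetric] sum_distrib_left g_def
    by (intro sum.cong) (auto simp: mult_ac add.commute)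
  also have "\<dots> = lam 0 ^ M * (\<Sum>i\<le>j. gcoef q \<mu> i * lam (j - i) * right_vec (j - i))"
    by (simp add: sum_distrib_left mult_ac)
  finally show ?case unfolding A_0_eigenvector by (simp only: power_Suc mult_ac)
qed

text \<open>A Bernoulli-type bound that keeps the factor x - 1; at x = \<open>lam m\<close> this
  factor supplies the decay q^m.\<close>

lemma power_minus_1_le: "x ^ M - 1 \<le> of_nat M * (x - 1) * x ^ M" if "1 \<le> x" for x :: real
proof (induction M)
  case (Suc M)
  have "x ^ Suc M - 1 = x * (x ^ M - 1) + (x - 1)" by (simp add: algebra_simps)
  also have "\<dots> \<le> x * (of_nat M * (x - 1) * x ^ M) + (x - 1) * x ^ Suc M"
    using Suc that one_le_power[OF that, of "Suc M"]
    by (intro add_mono mult_left_mono) (auto intro: mult_left_mono[of 1 _ "x - 1", simplified])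
  finally show ?case by (simp add: algebra_simps)
qed simp

text \<open>The input for dominated convergence in the trace: relative to \<open>lam 0 ^ M\<close>
  only source level 0 survives, the k^0 part disappears, and the bounds are uniform in M.\<close>

lemma vac_power_limits:
  shows "(\<lambda>M. vac_power M j m / lam 0 ^ M) \<longlonglongrightarrow> (if m = 0 then right_vec j else 0)"
    and "(\<lambda>M. vac_power_inf M j / lam 0 ^ M) \<longlonglongrightarrow> 0"
    and "\<exists>E\<ge>0. \<forall>M m. vac_power M j m \<le> E * lam 0 ^ M \<and>
      vac_power M j m - vac_power_inf M j \<le> E * q ^ m * lam 0 ^ M"
proof -
  obtain \<beta> E where beta: "1 \<le> \<beta>" "\<beta> * lam 1 < lam 0" and E: "\<And>j. 0 \<le> E j"
    and inf: "\<And>M j. vac_power_inf M j \<le> E j * \<beta> ^ M"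
    using vac_power_inf_bound by metis
  \<comment> \<open>The rate at which everything but source level 0 dies out; \<beta> was chosen to
    make it less than 1.\<close>
  define r where "r = \<beta> * lam 1 / lam 0"
  have lam: "0 < lam 0" "1 \<le> lam 1" using lam_ge_1[of 0] lam_ge_1[of 1] by auto
  have r: "0 \<le> r" "r < 1" using beta lam by (auto simp: r_def)
  have r_power: "r ^ M * lam 0 ^ M = \<beta> ^ M * lam 1 ^ M" for M
    using lam by (simp add: r_def power_mult_distrib power_divide)
  have low: "vac_power M j m \<le> E j * r ^ M * lam 0 ^ M" if "m \<noteq> 0" for M j m
  proof -
    have "vac_power M j m \<le> lam m ^ M * vac_power_inf M j" by (rule vac_power_upper)
    also have "\<dots> \<le> lam 1 ^ M * (E j * \<beta> ^ M)"
      using that lam_ge_1 inf vac_power_inf_nonneg lam_antimono[of 1 m]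
      by (intro mult_mono power_mono) (auto intro: order_trans[OF zero_le_one] zero_le_power)
    finally show ?thesis using r_power[of M] by (simp add: mult_ac)
  qed
  \<comment> \<open>A single term of the eigenvector identity, whose terms are all
    nonnegative.\<close>
  have top: "vac_power M j 0 \<le> right_vec j * lam 0 ^ M" for M j
  proof -
    have "(\<Sum>l\<in>{0}. vac_power M (j - l) l * right_vec l) \<le> (\<Sum>l\<le>j. vac_power M (j - l) l * right_vec l)"
      using vac_power_nonneg less_imp_le[OF right_vec_pos] by (intro sum_mono2) auto
    then show ?thesis unfolding vac_power_right_vec by (simp add: right_vec_0 mult.commute)
  qed
  have inf_r: "vac_power_inf M j \<le> E j * r ^ M * lam 0 ^ M" for M j
  proof -
    have "E j * \<beta> ^ M * 1 \<le> E j * \<beta> ^ M * lam 1 ^ M"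
      using E beta lam by (intro mult_left_mono mult_nonneg_nonneg one_le_power) auto
    then show ?thesis using inf[of M j] r_power[of M] by (simp add: mult.assoc)
  qed
  have r_lim: "(\<lambda>M. E j * r ^ M) \<longlonglongrightarrow> 0" for j
  proof -
    have "(\<lambda>M. E j * r ^ M) \<longlonglongrightarrow> E j * 0"
      using r by (intro tendsto_intros LIMSEQ_power_zero) auto
    then show ?thesis by simp
  qed
  have lim: "(\<lambda>M. vac_power M j m / lam 0 ^ M) \<longlonglongrightarrow> 0" if "m \<noteq> 0" for j m
    by (rule tendsto_sandwich[OF _ _ tendsto_const r_lim[of j]])
      (use low[OF that] vac_power_nonneg lam in \<open>auto simp: field_simps\<close>)
  show "(\<lambda>M. vac_power_inf M j / lam 0 ^ M) \<longlonglongrightarrow> 0"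
    by (rule tendsto_sandwich[OF _ _ tendsto_const r_lim[of j]])
      (use inf_r vac_power_inf_nonneg lam in \<open>auto simp: field_simps\<close>)
  show "(\<lambda>M. vac_power M j m / lam 0 ^ M) \<longlonglongrightarrow> (if m = 0 then right_vec j else 0)"
  proof (cases "m = 0")
    case True
    \<comment> \<open>The limit at level 0 is what the eigenvector identity leaves once the terms
      with l \<ge> 1 have tended to 0.\<close>
    have "(\<lambda>M. right_vec j - (\<Sum>l\<in>{..j} - {0}. vac_power M (j - l) l / lam 0 ^ M * right_vec l)) \<longlonglongrightarrow>
        right_vec j - (\<Sum>l\<in>{..j} - {0}. 0 * right_vec l)"
      by (intro tendsto_intros lim) auto
    moreover have "right_vec j - (\<Sum>l\<in>{..j} - {0}. vac_power M (j - l) l / lam 0 ^ M * right_vec l) =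
        vac_power M j 0 / lam 0 ^ M" for M
    proof -
      have "lam 0 ^ M * right_vec j = vac_power M j 0 + (\<Sum>l\<in>{..j} - {0}. vac_power M (j - l) l * right_vec l)"
        unfolding vac_power_right_vec[symmetric] by (subst sum.remove[of _ 0]) (auto simp: right_vec_0)
      moreover have "(\<Sum>l\<in>{..j} - {0}. vac_power M (j - l) l / lam 0 ^ M * right_vec l) =
          (\<Sum>l\<in>{..j} - {0}. vac_power M (j - l) l * right_vec l) / lam 0 ^ M"
        by (simp add: sum_divide_distrib)
      ultimately show ?thesis using lam by (simp add: field_simps)
    qed
    ultimately show ?thesis using True by simp
  qed (use lim in simp)
  \<comment> \<open>\<open>power_minus_1_le\<close> costs a factor M, which r^M absorbs.\<close>
  have "Bseq (\<lambda>M. of_nat M * r ^ M)"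
    using r by (intro convergent_imp_Bseq convergentI[OF summable_LIMSEQ_zero[OF summable_nat_power]]) auto
  then obtain B where B: "0 < B" "\<And>M. \<bar>of_nat M * r ^ M\<bar> \<le> B"
    by (auto simp: Bseq_def)
  define E' where "E' = right_vec j + E j + E j * lam 0 * B"
  have E'_ge: "right_vec j \<le> E'" "E j \<le> E'" "E j * lam 0 * B \<le> E'" "0 \<le> E'"
    using E[of j] lam B right_vec_pos[of j] by (auto simp: E'_def)
  show "\<exists>E\<ge>0. \<forall>M m. vac_power M j m \<le> E * lam 0 ^ M \<and>
      vac_power M j m - vac_power_inf M j \<le> E * q ^ m * lam 0 ^ M"
  proof (intro exI[of _ E'] conjI allI)
    show "0 \<le> E'" by (rule E'_ge)
    fix M m
    have lamM: "0 < lam 0 ^ M" using lam by simp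
    show "vac_power M j m \<le> E' * lam 0 ^ M"
    proof (cases "m = 0")
      case True
      have "right_vec j * lam 0 ^ M \<le> E' * lam 0 ^ M"
        using E'_ge lamM by (intro mult_right_mono) auto
      then show ?thesis using top[of M j] True by simp
    next
      case False
      have "E j * r ^ M \<le> E' * 1"
        using E'_ge E[of j] r by (intro mult_mono power_le_one) auto
      then have "E j * r ^ M * lam 0 ^ M \<le> E' * lam 0 ^ M"
        using lamM by (intro mult_right_mono) auto
      then show ?thesis using low[OF False, of M j] by simp
    qed
    show "vac_power M j m - vac_power_inf M j \<le> E' * q ^ m * lam 0 ^ M"
    proof (cases "m = 0")
      case True
      have "right_vec j * lam 0 ^ M \<le> E' * lam 0 ^ M"
        using E'_ge lamM by (intro mult_right_mono) auto
      then show ?thesis using top[of M j] vac_power_inf_nonneg[of M j] True by simp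
    next
      case False
      have "vac_power M j m - vac_power_inf M j \<le> (lam m ^ M - 1) * vac_power_inf M j"
        using vac_power_upper[of M j m] by (simp add: algebra_simps)
      also have "\<dots> \<le> (of_nat M * (q ^ m * lam 0) * lam 1 ^ M) * (E j * \<beta> ^ M)"
      proof (rule mult_mono[OF _ inf])
        have "lam m ^ M - 1 \<le> of_nat M * (lam m - 1) * lam m ^ M"
          by (rule power_minus_1_le[OF lam_ge_1])
        also have "\<dots> \<le> of_nat M * (q ^ m * lam 0) * lam 1 ^ M"
          using False lam_minus_1[of m] lam_ge_1[of m] lam_antimono[of 1 m] q_pos lam
          by (intro mult_mono power_mono mult_nonneg_nonneg) auto
        finally show "lam m ^ M - 1 \<le> of_nat M * (q ^ m * lam 0) * lam 1 ^ M" .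
      qed (use vac_power_inf_nonneg lam q_pos in auto)
      also have "\<dots> = (E j * lam 0) * (of_nat M * r ^ M) * (q ^ m * lam 0 ^ M)"
        using r_power[of M] by (simp add: mult_ac)
      also have "\<dots> \<le> (E j * lam 0) * B * (q ^ m * lam 0 ^ M)"
        using B(2)[of M] E[of j] lam q_pos by (intro mult_right_mono mult_left_mono) auto
      also have "\<dots> \<le> E' * (q ^ m * lam 0 ^ M)"
        using E'_ge q_pos lam by (intro mult_right_mono) auto
      finally show ?thesis by (simp add: mult.assoc)
    qed
  qed
qed

end


section \<open>The infinite-volume limit\<close>

context zero_range
begin

text \<open>The limit depends only on the action on column vectors, so the transfer coefficients and
  their k^0 parts are hidden here and words act by composition.\<close>

definition realizes :: "nat \<Rightarrow> linop fps fps \<Rightarrow> ((nat \<Rightarrow> real) \<Rightarrow> nat \<Rightarrow> real) \<Rightarrow> bool" where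
  "realizes C Q \<Omega> \<longleftrightarrow> (\<exists>S T. transfer q y C Q S T \<and> \<Omega> = dual_action C S)"

lemma realizes_mult:
  assumes "realizes C Q \<Omega>" "realizes C' Q' \<Omega>'"
  shows "realizes (C + C') (Q * Q') (\<Omega> \<circ> \<Omega>')"
proof -
  obtain S T S' T' where tr: "transfer q y C Q S T" "transfer q y C' Q' S' T'"
    and \<Omega>: "\<Omega> = dual_action C S" "\<Omega>' = dual_action C' S'"
    using assms by (auto simp: realizes_def)
  have "\<Omega> \<circ> \<Omega>' = dual_action (C + C') (\<lambda>j m. \<Sum>i\<le>j. S i (m + (j - i) - C') * S' (j - i) m)"
    unfolding \<Omega> comp_def by (intro ext dual_action_mult[OF transfer_vanish[OF tr(2)], symmetric])
  then show ?thesis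
    unfolding realizes_def using transfer_mult[OF less_imp_le[OF y_pos] tr] by blast
qed

lemma realizes_1: "realizes 0 1 id"
proof -
  have "dual_action 0 (\<lambda>j m. if j = 0 then 1 else 0) w p = w p" for w p
  proof -
    have "dual_action 0 (\<lambda>j m. if j = 0 then 1 else 0) w p = (\<Sum>i\<in>{0}. w (p - i))"
      unfolding dual_action_def by (rule sum.mono_neutral_cong_right) auto
    then show ?thesis by simp
  qed
  then have "id = dual_action 0 (\<lambda>j m. if j = 0 then 1 else 0)" by (auto simp: fun_eq_iff)
  then show ?thesis
    unfolding realizes_def using transfer_one by blast
qed

lemma realizes_A: "realizes a (A_op q \<mu> a) (A_action a)"
  unfolding realizes_def A_action_def using transfer_A by blast

lemma realizes_X: "realizes a (fps_const (X_op q \<mu> a n)) (X_action a n)"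
  unfolding realizes_def X_action_def using transfer_X by blast

lemma realizes_A_word: "realizes (sum_list xs) (prod_list (map (A_op q \<mu>) xs)) (foldr A_action xs)"
proof (induction xs)
  case (Cons a xs)
  show ?case using realizes_mult[OF realizes_A Cons.IH, of a] by (simp add: comp_def)
qed (use realizes_1 in \<open>simp add: id_def\<close>)

text \<open>Conjugation by \<open>right_vec\<close> carries over from sites to words: read from left
  to right, the word is a run of the chain, and the site weights collect into a scalar.\<close>

lemma foldr_A_action:
  "foldr A_action xs (\<lambda>p. c * (right_vec p * f p)) =
    (\<lambda>p. (\<Prod>a\<leftarrow>xs. site_weight a) * c * (right_vec p * foldr step xs f p))"
proof (induction xs)
  case (Cons a xs)
  have act: "A_action a (\<lambda>p. k * (right_vec p * g p)) p = k * (site_weight a * (right_vec p * step a g p))" for k g p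
  proof -
    have "A_action a (\<lambda>p. k * (right_vec p * g p)) p = A_action a (\<lambda>p. right_vec p * (k * g p)) p"
      by (simp add: mult.left_commute)
    then show ?thesis unfolding A_action_right_vec step_mult by (simp add: mult.left_commute)
  qed
  show ?case
    by (rule ext) (simp only: foldr_Cons comp_apply Cons.IH act, simp add: mult_ac)
qed simp

lemma foldr_step_const: "foldr step xs (\<lambda>_. c) = (\<lambda>_. c)"
proof (induction xs)
  case (Cons a xs)
  have "step a (\<lambda>_. c) = (\<lambda>_. c)" by (simp add: fun_eq_iff step_const)
  then show ?case by (simp add: Cons.IH)
qed simp

lemma A_word_eigenvector:
  "foldr A_action xs right_vec p = (\<Prod>a\<leftarrow>xs. site_weight a) * right_vec p"
  using foldr_A_action[of xs 1 "\<lambda>_. 1"] by (simp add: foldr_step_const)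

text \<open>Sites to the right of the observed one act on the eigenvector by scalars, so the
  distribution at a site depends only on the word up to it.\<close>

lemma defect_word_action:
  "foldr A_action xs (X_action a n (foldr A_action zs right_vec)) 0 =
    (\<Prod>x\<leftarrow>xs @ a # zs. site_weight x) * foldr step (xs @ [a]) (occupation a n) 0"
proof -
  let ?c = "\<Prod>x\<leftarrow>zs. site_weight x"
  have "foldr A_action zs right_vec = (\<lambda>p. ?c * right_vec p)"
    by (simp add: fun_eq_iff A_word_eigenvector)
  moreover have "X_action a n (\<lambda>p. ?c * right_vec p) = (\<lambda>p. (?c * site_weight a) * (right_vec p * step a (occupation a n) p))"
  proof
    fix p
    have "X_action a n (\<lambda>p. ?c * right_vec p) p = ?c * X_action a n right_vec p"
      unfolding X_action_def dual_action_def by (simp add: sum_distrib_left mult_ac)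
    then show "X_action a n (\<lambda>p. ?c * right_vec p) p = (?c * site_weight a) * (right_vec p * step a (occupation a n) p)"
      by (simp add: X_action_right_vec)
  qed
  ultimately show ?thesis by (simp add: foldr_A_action right_vec_0)
qed

text \<open>After division by the top eigenvalue of the vacuum operator only the level \<open>m = 0\<close>
  survives in the trace.\<close>

theorem trace_limit:
  assumes "realizes C Q \<Omega>"
  shows "summable (\<lambda>N. Tr_coeff q (Q * A_op q \<mu> 0 ^ M) N * of_real y ^ N)"
    and "(\<lambda>M. Tr' q y (Q * A_op q \<mu> 0 ^ M) / of_real (lam 0 ^ M)) \<longlonglongrightarrow> of_real (\<Omega> right_vec 0)"
proof -
  obtain S T where tr: "transfer q y C Q S T" and \<Omega>: "\<Omega> = dual_action C S"
    using assms by (auto simp: realizes_def)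
  define F where "F = (\<lambda>M m. \<Sum>i\<le>C. S i (m + (C - i)) * vac_power M (C - i) m)"
  define H where "H = (\<lambda>M. \<Sum>i\<le>C. T i * vac_power_inf M (C - i))"
  have tr': "transfer q y C (Q * A_op q \<mu> 0 ^ M)
      (\<lambda>j m. \<Sum>i\<le>j. S i (m + (j - i)) * vac_power M (j - i) m) (\<lambda>j. \<Sum>i\<le>j. T i * vac_power_inf M (j - i))" for M
    using transfer_mult[OF less_imp_le[OF y_pos] tr transfer_vac_power[of M]] by simp
  show "summable (\<lambda>N. Tr_coeff q (Q * A_op q \<mu> 0 ^ M) N * of_real y ^ N)"
    by (rule transfer_trace[OF less_imp_le[OF y_pos] tr'])
  have Tr: "Tr' q y (Q * A_op q \<mu> 0 ^ M) = of_real (\<Sum>m. F M m - H M)" for M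
    using transfer_trace(2)[OF less_imp_le[OF y_pos] tr'[of M]] by (simp add: F_def H_def)
  have summ: "summable (\<lambda>m. F M m - H M)" for M
    using tr'[of M] unfolding transfer_def F_def H_def by (intro q_tends_summable) blast
  have lam: "0 < lam 0" using lam_ge_1[of 0] by simp
  define a where "a = (\<lambda>m M. (F M m - H M) / lam 0 ^ M)"
  have "\<exists>K\<ge>0. \<forall>m. \<bar>S i (m + (C - i)) - T i\<bar> \<le> K * q ^ m" for i
  proof -
    have "q_tends q (S i) (T i)" using tr by (simp add: transfer_def)
    from q_tends_shift[OF this, of "C - i" 0] have "q_tends q (\<lambda>m. S i (m + (C - i))) (T i)" by simp
    then show ?thesis by (metis q_tendsE)
  qed
  then obtain K where K: "\<And>i. 0 \<le> K i" "\<And>i m. \<bar>S i (m + (C - i)) - T i\<bar> \<le> K i * q ^ m" by metis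
  obtain E where E: "\<And>j. 0 \<le> E j" "\<And>j M m. vac_power M j m \<le> E j * lam 0 ^ M"
    "\<And>j M m. vac_power M j m - vac_power_inf M j \<le> E j * q ^ m * lam 0 ^ M"
    using vac_power_limits(3) by metis
  define B where "B = (\<Sum>i\<le>C. K i * E (C - i) + \<bar>T i\<bar> * E (C - i))"
  have bound: "\<bar>a m M\<bar> \<le> B * q ^ m" for m M
  proof -
    have lamM: "0 < lam 0 ^ M" using lam by simp
    have "\<bar>F M m - H M\<bar> \<le> (\<Sum>i\<le>C. \<bar>S i (m + (C - i)) * vac_power M (C - i) m - T i * vac_power_inf M (C - i)\<bar>)"
      unfolding F_def H_def sum_subtractf[symmetric] by (rule sum_abs)
    also have "\<dots> \<le> (\<Sum>i\<le>C. (K i * E (C - i) + \<bar>T i\<bar> * E (C - i)) * q ^ m * lam 0 ^ M)"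
    proof (rule sum_mono)
      fix i
      let ?v = "vac_power M (C - i) m" and ?w = "vac_power_inf M (C - i)"
      \<comment> \<open>In the first part the decay in m comes from \<open>Q\<close>, in the second
        from the vacuum powers.\<close>
      have "S i (m + (C - i)) * ?v - T i * ?w = (S i (m + (C - i)) - T i) * ?v + T i * (?v - ?w)"
        by (simp add: algebra_simps)
      then have "\<bar>S i (m + (C - i)) * ?v - T i * ?w\<bar> \<le> \<bar>S i (m + (C - i)) - T i\<bar> * \<bar>?v\<bar> + \<bar>T i\<bar> * \<bar>?v - ?w\<bar>"
        by (metis abs_mult abs_triangle_ineq)
      also have "\<dots> \<le> (K i * q ^ m) * (E (C - i) * lam 0 ^ M) + \<bar>T i\<bar> * (E (C - i) * q ^ m * lam 0 ^ M)"
        using K E(2,3) vac_power_nonneg[of M "C - i" m] vac_power_lower[of M "C - i" m] q_pos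
        by (intro add_mono mult_mono mult_left_mono) auto
      finally show "\<bar>S i (m + (C - i)) * ?v - T i * ?w\<bar> \<le> (K i * E (C - i) + \<bar>T i\<bar> * E (C - i)) * q ^ m * lam 0 ^ M"
        by (simp add: algebra_simps)
    qed
    also have "\<dots> = B * q ^ m * lam 0 ^ M" by (simp add: B_def sum_distrib_right)
    finally show ?thesis using lamM by (simp add: a_def abs_divide field_simps)
  qed
  have lim: "a m \<longlonglongrightarrow> (if m = 0 then \<Omega> right_vec 0 else 0)" for m
  proof -
    have "(\<lambda>M. (\<Sum>i\<le>C. S i (m + (C - i)) * (vac_power M (C - i) m / lam 0 ^ M))
        - (\<Sum>i\<le>C. T i * (vac_power_inf M (C - i) / lam 0 ^ M))) \<longlonglongrightarrow>
      (\<Sum>i\<le>C. S i (m + (C - i)) * (if m = 0 then right_vec (C - i) else 0)) - (\<Sum>i\<le>C. T i * 0)"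
      by (intro tendsto_intros vac_power_limits)
    also have "(\<lambda>M. (\<Sum>i\<le>C. S i (m + (C - i)) * (vac_power M (C - i) m / lam 0 ^ M))
        - (\<Sum>i\<le>C. T i * (vac_power_inf M (C - i) / lam 0 ^ M))) = a m"
      by (simp add: fun_eq_iff a_def F_def H_def diff_divide_distrib sum_divide_distrib)
    finally show ?thesis by (auto simp: \<Omega> dual_action_def)
  qed
  \<comment> \<open>Tannery's theorem: the limit in M passes inside the sum over levels, dominated
    by B q^m.\<close>
  have "(\<lambda>M. \<Sum>m. a m M) \<longlonglongrightarrow> (\<Sum>m. if m = 0 then \<Omega> right_vec 0 else 0)"
  proof (rule tannerys_theorem[THEN conjunct2, THEN conjunct2])
    show "\<forall>\<^sub>F (k, n) in at_top \<times>\<^sub>F sequentially. norm (a k n) \<le> B * q ^ k"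
      using bound by (intro always_eventually) auto
    show "summable (\<lambda>k. B * q ^ k)"
      using q_pos q_less_1 by (intro summable_mult summable_geometric) simp
  qed (use lim in auto)
  also have "(\<Sum>m. if m = 0 then \<Omega> right_vec 0 else 0) = \<Omega> right_vec 0"
    using sums_single[of 0 "\<lambda>_. \<Omega> right_vec 0"] by (simp add: sums_iff)
  finally have "(\<lambda>M. complex_of_real (\<Sum>m. a m M)) \<longlonglongrightarrow> of_real (\<Omega> right_vec 0)"
    by (rule tendsto_of_real)
  moreover have "Tr' q y (Q * A_op q \<mu> 0 ^ M) / of_real (lam 0 ^ M) = of_real (\<Sum>m. a m M)" for M
    unfolding Tr a_def using suminf_divide[OF summ[of M], of "lam 0 ^ M"] by (simp del: of_real_power)
  ultimately show "(\<lambda>M. Tr' q y (Q * A_op q \<mu> 0 ^ M) / of_real (lam 0 ^ M)) \<longlonglongrightarrow> of_real (\<Omega> right_vec 0)"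
    by simp
qed

lemma site_weight_pos: "0 < site_weight a"
  unfolding site_weight_def using lam_ge_1[of 0] gcoef_pos[of \<mu> a] mu_pos mu_less_1 y_pos by simp

lemma prod_list_site_weight_pos: "0 < (\<Prod>a\<leftarrow>xs. site_weight a)"
  by (induction xs) (simp_all add: site_weight_pos)

theorem defect_probability:
  assumes d: "1 \<le> r" "r \<le> s"
  shows "\<And>M. summable (\<lambda>N. Tr_coeff q (word_num q \<mu> s d r n M) N * of_real y ^ N)"
    and "\<And>M. summable (\<lambda>N. Tr_coeff q (word_den q \<mu> s d M) N * of_real y ^ N)"
    and "P_fin q \<mu> y s d r n \<longlonglongrightarrow>
      of_real (y ^ n * foldr step (map d [1..<Suc r]) (occupation (d r) n) 0)"
proof -
  define xs where "xs = map d [1..<r]"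
  define zs where "zs = map d [Suc r..<Suc s]"
  define num where "num = prod_list (map (A_op q \<mu>) xs) * fps_const (X_op q \<mu> (d r) n) * prod_list (map (A_op q \<mu>) zs)"
  define den where "den = prod_list (map (A_op q \<mu>) (xs @ d r # zs))"
  have upt: "[1..<Suc s] = [1..<r] @ r # [Suc r..<Suc s]"
    using d upt_add_eq_append[of 1 r "Suc s - r"] by (simp add: upt_conv_Cons del: upt_Suc)
  have word_num: "word_num q \<mu> s d r n L = num * A_op q \<mu> 0 ^ (L - s)" for L
    by (simp add: word_num_def num_def xs_def zs_def comp_def)
  have word_den: "word_den q \<mu> s d L = den * A_op q \<mu> 0 ^ (L - s)" for L
    unfolding word_den_def den_def xs_def zs_def upt by (simp add: comp_def)
  have num: "realizes (sum_list xs + d r + sum_list zs) num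
      (foldr A_action xs \<circ> X_action (d r) n \<circ> foldr A_action zs)"
    unfolding num_def by (intro realizes_mult realizes_A_word realizes_X)
  have den: "realizes (sum_list (xs @ d r # zs)) den (foldr A_action (xs @ d r # zs))"
    unfolding den_def by (rule realizes_A_word)
  show "summable (\<lambda>N. Tr_coeff q (word_num q \<mu> s d r n M) N * of_real y ^ N)" for M
    unfolding word_num by (rule trace_limit(1)[OF num])
  show "summable (\<lambda>N. Tr_coeff q (word_den q \<mu> s d M) N * of_real y ^ N)" for M
    unfolding word_den by (rule trace_limit(1)[OF den])
  \<comment> \<open>The observed site contributes the same weight to numerator and denominator, so
    this scalar cancels.\<close>
  let ?c = "\<Prod>a\<leftarrow>xs @ d r # zs. site_weight a" and ?e = "foldr step (xs @ [d r]) (occupation (d r) n) 0"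
  have lim: "(\<lambda>M. of_real y ^ n * (Tr' q y (num * A_op q \<mu> 0 ^ M) / of_real (lam 0 ^ M)) /
      (Tr' q y (den * A_op q \<mu> 0 ^ M) / of_real (lam 0 ^ M))) \<longlonglongrightarrow>
      of_real y ^ n * of_real (?c * ?e) / of_real ?c"
  proof (intro tendsto_intros)
    show "(\<lambda>M. Tr' q y (num * A_op q \<mu> 0 ^ M) / of_real (lam 0 ^ M)) \<longlonglongrightarrow> of_real (?c * ?e)"
      using trace_limit(2)[OF num] defect_word_action[of xs "d r" n zs] by simp
    show "(\<lambda>M. Tr' q y (den * A_op q \<mu> 0 ^ M) / of_real (lam 0 ^ M)) \<longlonglongrightarrow> of_real ?c"
      using trace_limit(2)[OF den] A_word_eigenvector[of "xs @ d r # zs" 0] by (simp add: right_vec_0)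
    show "complex_of_real ?c \<noteq> 0"
      using prod_list_site_weight_pos[of "xs @ d r # zs"] by (simp del: map_append)
  qed
  have limit: "of_real y ^ n * complex_of_real (?c * ?e) / of_real ?c = of_real (y ^ n * ?e)"
    using prod_list_site_weight_pos[of "xs @ d r # zs"] by (simp del: map_append)
  have ratio: "of_real y ^ n * (Tr' q y (num * A_op q \<mu> 0 ^ M) / of_real (lam 0 ^ M)) /
      (Tr' q y (den * A_op q \<mu> 0 ^ M) / of_real (lam 0 ^ M)) =
      of_real y ^ n * Tr' q y (num * A_op q \<mu> 0 ^ M) / Tr' q y (den * A_op q \<mu> 0 ^ M)" for M
    using lam_ge_1[of 0] by simp
  note lim[unfolded limit ratio]
  then have "(\<lambda>L. P_fin q \<mu> y s d r n (L + s)) \<longlonglongrightarrow> of_real (y ^ n * ?e)"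
    by (simp add: P_fin_def word_num word_den)
  then have "P_fin q \<mu> y s d r n \<longlonglongrightarrow> of_real (y ^ n * ?e)"
    by (rule LIMSEQ_offset)
  moreover have "map d [1..<Suc r] = xs @ [d r]"
    using d by (simp add: xs_def)
  ultimately show "P_fin q \<mu> y s d r n \<longlonglongrightarrow>
      of_real (y ^ n * foldr step (map d [1..<Suc r]) (occupation (d r) n) 0)" by simp
qed

end


section \<open>Defect functions as a Markov chain\<close>

lemma finite_lists_sum: "finite {ls :: nat list. length ls = n \<and> sum_list ls + m = k}"
proof (rule finite_subset)
  show "{ls. length ls = n \<and> sum_list ls + m = k} \<subseteq> {ls. set ls \<subseteq> {..k} \<and> length ls = n}"
    using member_le_sum_list by (fastforce intro: order_trans[OF member_le_sum_list])
qed (simp add: finite_lists_length_eq)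

context zero_range
begin

lemma G_fun_Nil: "G_fun q \<mu> y p m [] = (if m = p then 1 else 0)"
proof -
  have "{ls. length ls = 0 \<and> sum_list ls + m = p} = (if m = p then {[]} else {})" by auto
  then show ?thesis by (simp add: G_fun_def)
qed

text \<open>First-step decomposition: G is the probability that the chain with increments
  \<open>a # ds\<close>, started at p, ends at m.\<close>

lemma G_fun_Cons:
  "G_fun q \<mu> y p m (a # ds) = (\<Sum>l\<le>p. \<phi>_fun q \<mu> y l (int p) * G_fun q \<mu> y (p - l + a) m ds)"
proof -
  \<comment> \<open>The total fixed by the constraint on the lists; it bounds the first entry and
    keeps the index set finite.\<close>
  define k where "k = a + sum_list ds + p"
  define n where "n = length ds"
  define f where "f = (\<lambda>p ds (ls :: nat list). \<Prod>i<length ds. \<phi>_fun q \<mu> y (ls ! i)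
    (int p + int (sum_list (take i ds)) - int (sum_list (take i ls))))"
  let ?L = "\<lambda>l. {ls :: nat list. length ls = n \<and> sum_list ls + (m + l) = k}"
  \<comment> \<open>For l > p the truncated p - l + a is not the true level, but then the first
    factor vanishes.\<close>
  have f_Cons: "f p (a # ds) (l # ls) = \<phi>_fun q \<mu> y l (int p) * f (p - l + a) ds ls" for l ls
  proof (cases "l \<le> p")
    case True
    then show ?thesis
      unfolding f_def by (simp add: prod.lessThan_Suc_shift of_nat_diff algebra_simps del: prod.lessThan_Suc)
  next
    case False
    then have "\<phi>_fun q \<mu> y l (int p) = 0" by (simp add: \<phi>_fun_def)
    then show ?thesis
      unfolding f_def by (simp add: prod.lessThan_Suc_shift del: prod.lessThan_Suc)
  qed
  have "{ls. length ls = length (a # ds) \<and> sum_list ls + m = sum_list (a # ds) + p} =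
      (\<lambda>(l, ls). l # ls) ` (SIGMA l:{..k}. ?L l)"
  proof (intro set_eqI iffI)
    fix ls assume "ls \<in> {ls. length ls = length (a # ds) \<and> sum_list ls + m = sum_list (a # ds) + p}"
    then obtain l ls' where "ls = l # ls'" "length ls' = n" "l + sum_list ls' + m = k"
      by (cases ls) (auto simp: n_def k_def)
    then show "ls \<in> (\<lambda>(l, ls). l # ls) ` (SIGMA l:{..k}. ?L l)"
      by (auto intro!: image_eqI[of _ _ "(l, ls')"])
  qed (auto simp: n_def k_def)
  then have "G_fun q \<mu> y p m (a # ds) = (\<Sum>ls\<in>(\<lambda>(l, ls). l # ls) ` (SIGMA l:{..k}. ?L l). f p (a # ds) ls)"
    by (simp only: G_fun_def f_def)
  also have "\<dots> = (\<Sum>(l, ls)\<in>(SIGMA l:{..k}. ?L l). f p (a # ds) (l # ls))"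
    by (subst sum.reindex) (auto simp: inj_on_def case_prod_unfold)
  also have "\<dots> = (\<Sum>l\<le>k. \<Sum>ls\<in>?L l. f p (a # ds) (l # ls))"
    by (rule sum.Sigma[symmetric]) (simp_all add: finite_lists_sum)
  also have "\<dots> = (\<Sum>l\<le>k. \<phi>_fun q \<mu> y l (int p) * (\<Sum>ls\<in>?L l. f (p - l + a) ds ls))"
    by (simp only: f_Cons sum_distrib_left)
  also have "\<dots> = (\<Sum>l\<le>p. \<phi>_fun q \<mu> y l (int p) * (\<Sum>ls\<in>?L l. f (p - l + a) ds ls))"
    by (rule sum.mono_neutral_right) (auto simp: k_def \<phi>_fun_def)
  also have "\<dots> = (\<Sum>l\<le>p. \<phi>_fun q \<mu> y l (int p) * G_fun q \<mu> y (p - l + a) m ds)"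
  proof (rule sum.cong)
    fix l assume "l \<in> {..p}"
    then have "?L l = {ls. length ls = length ds \<and> sum_list ls + m = sum_list ds + (p - l + a)}"
      by (auto simp: n_def k_def)
    then show "\<phi>_fun q \<mu> y l (int p) * (\<Sum>ls\<in>?L l. f (p - l + a) ds ls) =
        \<phi>_fun q \<mu> y l (int p) * G_fun q \<mu> y (p - l + a) m ds"
      by (simp only: G_fun_def f_def)
  qed simp
  finally show ?thesis .
qed

text \<open>An expectation over the final level. The hypothesis makes the range contain every level
  the chain can reach.\<close>

lemma sum_G_fun:
  assumes "p + sum_list ds \<le> k"
  shows "(\<Sum>m\<le>k. G_fun q \<mu> y p m ds * f m) = foldr step ds f p"
  using assms
proof (induction ds arbitrary: p)
  case Nil
  then show ?case by (simp add: G_fun_Nil if_distrib[of "\<lambda>x. x * _"] cong: if_cong)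
next
  case (Cons a ds)
  have "(\<Sum>m\<le>k. G_fun q \<mu> y p m (a # ds) * f m) =
      (\<Sum>l\<le>p. \<phi>_fun q \<mu> y l (int p) * (\<Sum>m\<le>k. G_fun q \<mu> y (p - l + a) m ds * f m))"
    unfolding G_fun_Cons sum_distrib_right sum_distrib_left by (subst sum.swap) (simp add: mult.assoc)
  also have "\<dots> = (\<Sum>l\<le>p. \<phi>_fun q \<mu> y l (int p) * foldr step ds f (p - l + a))"
    using Cons.prems by (intro sum.cong refl arg_cong2[of _ _ _ _ "(*)"] Cons.IH) auto
  finally show ?case by (simp only: foldr_Cons comp_apply step_def[of a])
qed

text \<open>The last step removes at most what is present and then adds a, so the chain ends at
  level a or higher. This is the lower limit d_r of the sums.\<close>

lemma G_fun_snoc_eq_0: "G_fun q \<mu> y p m (ds @ [a]) = 0" if "m < a"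
  unfolding G_fun_def
proof (intro sum.neutral ballI prod_zero bexI)
  let ?n = "length ds"
  fix ls assume ls: "ls \<in> {ls. length ls = length (ds @ [a]) \<and> sum_list ls + m = sum_list (ds @ [a]) + p}"
  then have "ls = take ?n ls @ [ls ! ?n]"
    by (metis (mono_tags, lifting) length_append_singleton lessI mem_Collect_eq order_refl take_Suc_conv_app_nth take_all)
  then have "sum_list ls = sum_list (take ?n ls) + ls ! ?n"
    by (metis add.right_neutral sum_list.Cons sum_list.Nil sum_list_append)
  then show "\<phi>_fun q \<mu> y (ls ! ?n) (int p + int (sum_list (take ?n (ds @ [a]))) - int (sum_list (take ?n ls))) = 0"
    using ls that by (auto simp: \<phi>_fun_def)
qed auto

lemma sum_G_fun_defects:
  assumes "1 \<le> r"
  shows "(\<Sum>m\<in>{d r..\<Sum>i=1..r. d i}. G_fun q \<mu> y 0 m (map d [1..<Suc r]) * f m) =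
    foldr step (map d [1..<Suc r]) f 0"
proof -
  have snoc: "map d [1..<Suc r] = map d [1..<r] @ [d r]" using assms by simp
  have "sum_list (map d [1..<Suc r]) = (\<Sum>i=1..r. d i)"
    unfolding interv_sum_list_conv_sum_set_nat by (rule sum.cong) auto
  then have "foldr step (map d [1..<Suc r]) f 0 =
      (\<Sum>m\<le>(\<Sum>i=1..r. d i). G_fun q \<mu> y 0 m (map d [1..<Suc r]) * f m)"
    by (subst sum_G_fun) auto
  also have "\<dots> = (\<Sum>m\<in>{d r..\<Sum>i=1..r. d i}. G_fun q \<mu> y 0 m (map d [1..<Suc r]) * f m)"
    unfolding snoc by (rule sum.mono_neutral_right) (auto simp: G_fun_snoc_eq_0)
  finally show ?thesis by simp
qed

end


section \<open>Density and currents\<close>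

lemma has_sum_finite_sum:
  fixes f :: "'i \<Rightarrow> 'a \<Rightarrow> 'b::topological_comm_monoid_add"
  assumes "\<And>i. i \<in> I \<Longrightarrow> (f i has_sum s i) A"
  shows "((\<lambda>x. \<Sum>i\<in>I. f i x) has_sum sum s I) A"
  using assms by (induction I rule: infinite_finite_induct) (simp_all add: has_sum_add)

context zero_range
begin

text \<open>For a \<le> m, the law of the number of second class particles at a site, given that the
  chain is at level m just after it.\<close>

definition site_pmf :: "nat \<Rightarrow> nat \<Rightarrow> nat \<Rightarrow> real" where
  "site_pmf a m n = gcoef q (\<mu> * q ^ a) n * (y * q ^ (m - a)) ^ n /
     qbinomial_series q (\<mu> * q ^ a) (y * q ^ (m - a))"

text \<open>The Euler operator \<open>z d/dz\<close> applied to the logarithm of \<open>1 / (z)\<^sub>\<infinity>\<close>.\<close>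

definition log_slope :: "real \<Rightarrow> real" where
  "log_slope z = qbinomial_euler_series q 0 z / qbinomial_series q 0 z"

lemma log_slope_sums: "(\<lambda>n. z * q ^ n / (1 - z * q ^ n)) sums log_slope z" if "0 \<le> z" "z < 1"
  using qbinomial_euler_ratio(1)[of 0 z] that by (simp add: log_slope_def)

lemma log_slope_telescope:
  "log_slope z - log_slope (z * q ^ m) = (\<Sum>k<m. z * q ^ k / (1 - z * q ^ k))" if "0 \<le> z" "z < 1"
  using qbinomial_euler_ratio(2)[of 0 z m] that by (simp add: log_slope_def)

lemma y_occupation: "y ^ n * occupation a n m = site_pmf a m n" if "a \<le> m"
proof -
  have "0 < qpoch q y (m - a)" "0 < qpoch q (\<mu> * y) m"
    using qpoch_pos mu_y y_pos y_less_1 by auto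
  moreover have "(y * q ^ (m - a)) ^ n = y ^ n * q ^ (n * (m - a))"
    by (metis power_mult_distrib power_mult mult.commute)
  ultimately show ?thesis
    using that lam_ge_1[of 0] by (simp add: site_pmf_def occupation_def qbinomial_series_shift mult_ac)
qed

lemma site_pmf_nonneg: "0 \<le> site_pmf a m n"
proof -
  have "1 \<le> qbinomial_series q (\<mu> * q ^ a) (y * q ^ (m - a))"
    using mu_q_power[of a] y_q_power[of "m - a"] by (intro qbinomial_series_ge_1) auto
  moreover have "0 \<le> gcoef q (\<mu> * q ^ a) n"
    using mu_q_power[of a] by (intro gcoef_nonneg) auto
  ultimately show ?thesis unfolding site_pmf_def using y_q_power[of "m - a"] by simp
qed

lemma site_pmf_sums: "site_pmf a m sums 1"
proof -
  let ?F = "qbinomial_series q (\<mu> * q ^ a) (y * q ^ (m - a))"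
  have "1 \<le> ?F"
    using mu_q_power[of a] y_q_power[of "m - a"] by (intro qbinomial_series_ge_1) auto
  have "(\<lambda>n. gcoef q (\<mu> * q ^ a) n * (y * q ^ (m - a)) ^ n) sums ?F"
    unfolding qbinomial_series_def
    using mu_q_power[of a] y_q_power[of "m - a"] by (intro summable_sums summable_qbinomial) auto
  from sums_divide[OF this, of ?F] show ?thesis using \<open>1 \<le> ?F\<close> by (simp add: site_pmf_def[abs_def])
qed

text \<open>The mean is z F'/F for F = (\<alpha>z)_\<infinity>/(z)_\<infinity>. The two products
  have arguments yq^(m-a) and \<mu>yq^m, whence the two different lengths of the finite
  corrections.\<close>

lemma site_mean:
  assumes "a \<le> m"
  shows "(\<lambda>n. of_nat n * site_pmf a m n) sums (log_slope (y * q ^ (m - a)) - log_slope (\<mu> * y * q ^ m))"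
proof -
  let ?z = "y * q ^ (m - a)" and ?\<alpha> = "\<mu> * q ^ a"
  let ?F = "qbinomial_series q ?\<alpha> ?z" and ?D = "qbinomial_euler_series q ?\<alpha> ?z"
  have bounds: "0 \<le> ?\<alpha>" "?\<alpha> \<le> 1" "0 \<le> ?z" "?z < 1"
    using mu_q_power[of a] y_q_power[of "m - a"] by auto
  have \<alpha>z: "?\<alpha> * ?z = \<mu> * y * q ^ m"
    using assms by (simp add: power_add[symmetric] mult_ac)
  have \<mu>y: "0 \<le> \<mu> * y * q ^ m" "\<mu> * y * q ^ m < 1"
    using mult_le_1_less_1[OF mu_y less_imp_le[OF q_power_pos] q_power_le_1] by auto
  have "(\<lambda>n. of_nat n * (gcoef q ?\<alpha> n * ?z ^ n)) sums ?D"
    unfolding qbinomial_euler_series_def using bounds by (intro summable_sums summable_qbinomial_euler)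
  from sums_divide[OF this, of ?F] have "(\<lambda>n. of_nat n * site_pmf a m n) sums (?D / ?F)"
    by (simp add: site_pmf_def)
  moreover have "?D / ?F = log_slope ?z - log_slope (?\<alpha> * ?z)"
  proof (rule sums_unique2)
    show "(\<lambda>n. ?z * q ^ n / (1 - ?z * q ^ n) - ?\<alpha> * ?z * q ^ n / (1 - ?\<alpha> * ?z * q ^ n)) sums (?D / ?F)"
      by (rule qbinomial_euler_ratio(1)[OF bounds])
    show "(\<lambda>n. ?z * q ^ n / (1 - ?z * q ^ n) - ?\<alpha> * ?z * q ^ n / (1 - ?\<alpha> * ?z * q ^ n)) sums
        (log_slope ?z - log_slope (?\<alpha> * ?z))"
      using bounds \<mu>y unfolding \<alpha>z by (intro sums_diff log_slope_sums)
  qed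
  ultimately show ?thesis unfolding \<alpha>z by simp
qed

lemma rho_bulk_sums: "\<rho>_bulk_term q \<mu> y sums (log_slope y - log_slope (\<mu> * y))"
proof -
  have "\<rho>_bulk_term q \<mu> y = (\<lambda>i. y * q ^ i / (1 - y * q ^ i) - \<mu> * y * q ^ i / (1 - \<mu> * y * q ^ i))"
  proof
    fix i
    have "1 - y * q ^ i \<noteq> 0" "1 - \<mu> * y * q ^ i \<noteq> 0"
      using one_minus_q_power_pos[of y i] one_minus_q_power_pos[OF mu_y, of i] y_pos y_less_1 by auto
    then show "\<rho>_bulk_term q \<mu> y i = y * q ^ i / (1 - y * q ^ i) - \<mu> * y * q ^ i / (1 - \<mu> * y * q ^ i)"
      unfolding \<rho>_bulk_term_def by (simp add: diff_frac_eq) (simp add: algebra_simps)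
  qed
  then show ?thesis
    using y_pos y_less_1 mu_y by (auto intro!: sums_diff log_slope_sums)
qed

lemma h_term_sums: "h_term q z sums lambert_series q z" if "0 \<le> z" "z < 1"
  using lambert_series_telescope(1)[OF that] by (simp add: h_term_def[abs_def])

text \<open>With j = n - l particles left behind, rate times weight factorises, so the double sum is
  a Lambert series times total mass 1.\<close>

lemma has_sum_current:
  assumes w: "\<And>l j. 1 \<le> l \<Longrightarrow> w l a (l + j) * site_pmf a m (l + j) = \<kappa> * (z ^ l / (1 - q ^ l)) * site_pmf a m j"
    and z: "0 \<le> z" "z < 1"
  shows "((\<lambda>(n, l). of_nat l * w l a n * site_pmf a m n) has_sum (\<kappa> * lambert_series q z)) {(n, l). 1 \<le> l \<and> l \<le> n}"
proof -
  define t where "t = (\<lambda>l. of_nat l * z ^ l / (1 - q ^ l))"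
  have t_nonneg: "0 \<le> t l" for l
    unfolding t_def using z q_power_le_1[of l] by simp
  have t: "(t has_sum lambert_series q z) UNIV"
    using sums_nonneg_imp_has_sum[OF summable_sums[OF summable_lambert[OF z]]] t_nonneg
    unfolding lambert_series_def t_def by blast
  \<comment> \<open>The term at 0 is 0/0 = 0, so dropping it changes nothing.\<close>
  have t': "(t has_sum lambert_series q z) {1..}"
    using t by (rule has_sum_cong_neutral[THEN iffD1, rotated -1]) (auto simp: t_def not_le)
  have g: "(site_pmf a m has_sum 1) UNIV"
    by (rule sums_nonneg_imp_has_sum[OF site_pmf_sums site_pmf_nonneg])
  have inner: "((\<lambda>j. (\<lambda>(l, j). t l * site_pmf a m j) (l, j)) has_sum t l) UNIV" for l
    using has_sum_cmult_right[OF g, of "t l"] by simp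
  have "((\<lambda>(l, j). t l * site_pmf a m j) has_sum lambert_series q z) ({1..} \<times> UNIV)"
  proof (rule has_sum_SigmaI[OF _ t'])
    show "(\<lambda>(l, j). t l * site_pmf a m j) summable_on {1..} \<times> UNIV"
      by (rule summable_on_SigmaI[where g = t])
        (use inner t' t_nonneg site_pmf_nonneg in \<open>auto dest: has_sum_imp_summable\<close>)
  qed (use inner in simp)
  from has_sum_cmult_right[OF this, of \<kappa>]
  have "((\<lambda>x. \<kappa> * (case x of (l, j) \<Rightarrow> t l * site_pmf a m j)) has_sum (\<kappa> * lambert_series q z)) ({1..} \<times> UNIV)" .
  also have "?this \<longleftrightarrow> ?thesis"
  proof (rule has_sum_reindex_bij_witness[of _ "\<lambda>(n, l). (l, n - l)" "\<lambda>(l, j). (l + j, l)"])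
    fix x assume "x \<in> {1::nat..} \<times> (UNIV :: nat set)"
    then obtain l j where x: "x = (l, j)" "1 \<le> l" by auto
    have "of_nat l * (w l a (l + j) * site_pmf a m (l + j)) = \<kappa> * (t l * site_pmf a m j)"
      unfolding w[OF x(2)] t_def by simp
    then show "(case (case x of (l, j) \<Rightarrow> (l + j, l)) of (n, l) \<Rightarrow> of_nat l * w l a n * site_pmf a m n) =
        \<kappa> * (case x of (l, j) \<Rightarrow> t l * site_pmf a m j)"
      by (simp add: x mult.assoc)
  qed auto
  finally show ?thesis .
qed

text \<open>The part common to both rates: (\<mu>q^a)_(l+j) contains the denominator of the rate as
  a factor, and (q)_(l-1)/(q)_l leaves 1/(1 - q^l).\<close>

lemma rate_pmf:
  assumes "1 \<le> l"
  shows "qpoch q q (l - 1) / qpoch q (\<mu> * q ^ (a + j)) l * qbinom q (l + j) l * site_pmf a m (l + j) =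
    (y * q ^ (m - a)) ^ l / (1 - q ^ l) * site_pmf a m j"
proof -
  obtain k where l: "l = Suc k" using assms by (cases l) auto
  have "qpoch q (\<mu> * q ^ a) (l + j) = qpoch q (\<mu> * q ^ a) j * qpoch q (\<mu> * q ^ (a + j)) l"
    by (subst add.commute) (simp add: qpoch_add power_add mult.assoc)
  moreover have "qpoch q q l = qpoch q q k * (1 - q ^ l)" by (simp add: l qpoch_Suc)
  moreover have "0 < qpoch q (\<mu> * q ^ (a + j)) l" "0 < qpoch q q k" "0 < qpoch q q j" "0 < qpoch q q (l + j)" "0 < qpoch q q l"
    using qpoch_q_pos qpoch_pos mu_q_power by auto
  ultimately show ?thesis
    by (simp add: site_pmf_def qbinom_def gcoef_def l power_add)
qed

lemma has_sum_current_minus: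
  "((\<lambda>(n, l). of_nat l * w_minus q \<mu> l a n * site_pmf a m n) has_sum lambert_series q (y * q ^ (m - a)))
    {(n, l). 1 \<le> l \<and> l \<le> n}"
proof -
  have "((\<lambda>(n, l). of_nat l * w_minus q \<mu> l a n * site_pmf a m n) has_sum 1 * lambert_series q (y * q ^ (m - a)))
    {(n, l). 1 \<le> l \<and> l \<le> n}"
  proof (rule has_sum_current)
    fix l j :: nat assume "1 \<le> l"
    from rate_pmf[OF this, of a j m] show "w_minus q \<mu> l a (l + j) * site_pmf a m (l + j) =
        1 * ((y * q ^ (m - a)) ^ l / (1 - q ^ l)) * site_pmf a m j"
      by (simp add: w_minus_def)
  qed (use y_q_power in auto)
  then show ?thesis by simp
qed

text \<open>The extra factor q^(al) \<mu>^(l-1) replaces the argument yq^(m-a) by \<mu>yq^m at the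
  cost of 1/\<mu>.\<close>

lemma has_sum_current_plus:
  assumes "a \<le> m"
  shows "((\<lambda>(n, l). of_nat l * w_plus q \<mu> l a n * site_pmf a m n) has_sum (inverse \<mu> * lambert_series q (\<mu> * y * q ^ m)))
    {(n, l). 1 \<le> l \<and> l \<le> n}"
proof (rule has_sum_current)
  fix l j :: nat assume l: "1 \<le> l"
  have \<alpha>z: "\<mu> * q ^ a * (y * q ^ (m - a)) = \<mu> * y * q ^ m"
    using assms by (simp add: power_add[symmetric] mult_ac)
  have coeff: "inverse \<mu> * (\<mu> * y * q ^ m) ^ l = q ^ (a * l) * \<mu> ^ (l - 1) * (y * q ^ (m - a)) ^ l"
    unfolding \<alpha>z[symmetric] power_mult_distrib[of "\<mu> * q ^ a"] power_mult_distrib[of \<mu>]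
    using mu_pos l by (cases l) (auto simp: power_mult power_add)
  have index: "a + (l + j) - l = a + j" by simp
  have "w_plus q \<mu> l a (l + j) * site_pmf a m (l + j) = q ^ (a * l) * \<mu> ^ (l - 1) *
      (qpoch q q (l - 1) / qpoch q (\<mu> * q ^ (a + j)) l * qbinom q (l + j) l * site_pmf a m (l + j))"
    by (simp only: w_plus_def index times_divide_eq_left times_divide_eq_right mult.assoc)
  also have "\<dots> = inverse \<mu> * (\<mu> * y * q ^ m) ^ l / (1 - q ^ l) * site_pmf a m j"
    unfolding rate_pmf[OF l] coeff by (simp only: times_divide_eq_left times_divide_eq_right mult.assoc)
  finally show "w_plus q \<mu> l a (l + j) * site_pmf a m (l + j) =
      inverse \<mu> * ((\<mu> * y * q ^ m) ^ l / (1 - q ^ l)) * site_pmf a m j"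
    by (simp only: times_divide_eq_right)
next
  show "0 \<le> \<mu> * y * q ^ m" "\<mu> * y * q ^ m < 1"
    using mult_le_1_less_1[OF mu_y less_imp_le[OF q_power_pos] q_power_le_1] by auto
qed

section \<open>Averages over the level reached at site r\<close>

context
  fixes s r :: nat and d :: "nat \<Rightarrow> nat"
  assumes r: "1 \<le> r" "r \<le> s"
begin

abbreviation levels :: "nat set" where
  "levels \<equiv> {d r..\<Sum>i=1..r. d i}"

abbreviation level_weight :: "nat \<Rightarrow> real" where
  "level_weight m \<equiv> G_fun q \<mu> y 0 m (map d [1..<Suc r])"

lemma sum_level_weight: "sum level_weight levels = 1"
  using sum_G_fun_defects[OF r(1), of d "\<lambda>_. 1"] by (simp only: foldr_step_const mult_1_right)

lemma P_fin_LIMSEQ: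
  "P_fin q \<mu> y s d r n \<longlonglongrightarrow> of_real (\<Sum>m\<in>levels. level_weight m * site_pmf (d r) m n)"
proof -
  have "y ^ n * foldr step (map d [1..<Suc r]) (occupation (d r) n) 0 =
      (\<Sum>m\<in>levels. level_weight m * site_pmf (d r) m n)"
    unfolding sum_G_fun_defects[OF r(1), symmetric] sum_distrib_left
    by (intro sum.cong) (auto simp: y_occupation[symmetric])
  then show ?thesis using defect_probability(3)[OF r, of d n] by simp
qed

lemma P_I_eq: "P_I q \<mu> y s d r n = of_real (\<Sum>m\<in>levels. level_weight m * site_pmf (d r) m n)"
  unfolding P_I_def by (rule limI[OF P_fin_LIMSEQ])

lemma P_I_formula: "P_I q \<mu> y s d r n = of_real (
    y ^ n * (qpoch q (q ^ d r * \<mu>) n * qpoch_inf q y / (qpoch q q n * qpoch_inf q (\<mu> * y)))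
    * (\<Sum>m\<in>levels. q ^ (n * (m - d r)) * (qpoch q (\<mu> * y) m / qpoch q y (m - d r)) * level_weight m))"
proof -
  have "lam 0 = qpoch_inf q (\<mu> * y) / qpoch_inf q y"
    unfolding lam_def using mu_pos mu_less_1 y_pos y_less_1 by (subst qbinomial_theorem) auto
  then have summand: "level_weight m * site_pmf (d r) m n =
      y ^ n * (qpoch q (q ^ d r * \<mu>) n * qpoch_inf q y / (qpoch q q n * qpoch_inf q (\<mu> * y))) *
      (q ^ (n * (m - d r)) * (qpoch q (\<mu> * y) m / qpoch q y (m - d r)) * level_weight m)" if "m \<in> levels" for m
    using that by (simp add: y_occupation[symmetric] occupation_def gcoef_def mult_ac)
  show ?thesis
    unfolding P_I_eq sum_distrib_left by (intro arg_cong[of _ _ of_real] sum.cong refl summand)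
qed

lemma rho_I_sums: "(\<lambda>n. of_nat n * P_I q \<mu> y s d r n) sums of_real (\<Sum>m\<in>levels.
    level_weight m * (log_slope (y * q ^ (m - d r)) - log_slope (\<mu> * y * q ^ m)))"
proof -
  have "(\<lambda>n. \<Sum>m\<in>levels. level_weight m * (of_nat n * site_pmf (d r) m n)) sums (\<Sum>m\<in>levels.
    level_weight m * (log_slope (y * q ^ (m - d r)) - log_slope (\<mu> * y * q ^ m)))"
    by (intro sums_sum sums_mult site_mean) auto
  then have "(\<lambda>n. complex_of_real (\<Sum>m\<in>levels. level_weight m * (of_nat n * site_pmf (d r) m n))) sums of_real (\<Sum>m\<in>levels.
    level_weight m * (log_slope (y * q ^ (m - d r)) - log_slope (\<mu> * y * q ^ m)))"
    by (rule sums_of_real)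
  moreover have "complex_of_real (\<Sum>m\<in>levels. level_weight m * (of_nat n * site_pmf (d r) m n)) =
      of_nat n * P_I q \<mu> y s d r n" for n
  proof -
    have "(\<Sum>m\<in>levels. level_weight m * (of_nat n * site_pmf (d r) m n)) =
        of_nat n * (\<Sum>m\<in>levels. level_weight m * site_pmf (d r) m n)"
      unfolding sum_distrib_left by (intro sum.cong) auto
    then show ?thesis by (simp only: P_I_eq of_real_mult of_real_of_nat_eq)
  qed
  ultimately show ?thesis by simp
qed

text \<open>The weights have total mass 1, so a bulk value can be subtracted inside the
  mixture.\<close>

lemma sum_level_weight_diff:
  assumes "\<And>m. m \<in> levels \<Longrightarrow> f m - c = g m"
  shows "(\<Sum>m\<in>levels. level_weight m * f m) - c = (\<Sum>m\<in>levels. level_weight m * g m)"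
proof -
  have "(\<Sum>m\<in>levels. level_weight m * g m) = (\<Sum>m\<in>levels. level_weight m * f m - level_weight m * c)"
    by (intro sum.cong refl) (simp only: assms[symmetric] right_diff_distrib)
  also have "\<dots> = (\<Sum>m\<in>levels. level_weight m * f m) - sum level_weight levels * c"
    by (simp only: sum_subtractf sum_distrib_right)
  finally show ?thesis unfolding sum_level_weight by simp
qed

lemma rho_I_formula: "\<rho>_I q \<mu> y s d r - of_real (\<rho>_bulk q \<mu> y) = of_real (
    \<Sum>m\<in>levels. level_weight m * ((\<Sum>k<m. \<mu> * y * q ^ k / (1 - \<mu> * y * q ^ k))
      - (\<Sum>k<m - d r. y * q ^ k / (1 - y * q ^ k))))"
proof -
  have "(\<Sum>m\<in>levels. level_weight m * (log_slope (y * q ^ (m - d r)) - log_slope (\<mu> * y * q ^ m)))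
      - (log_slope y - log_slope (\<mu> * y)) =
    (\<Sum>m\<in>levels. level_weight m * ((\<Sum>k<m. \<mu> * y * q ^ k / (1 - \<mu> * y * q ^ k))
      - (\<Sum>k<m - d r. y * q ^ k / (1 - y * q ^ k))))"
    using y_pos y_less_1 mu_y
    by (intro sum_level_weight_diff) (simp add: log_slope_telescope[symmetric])
  then show ?thesis
    unfolding \<rho>_I_def \<rho>_bulk_def sums_unique[OF rho_I_sums, symmetric] sums_unique[OF rho_bulk_sums, symmetric]
    by (simp only: of_real_diff[symmetric])
qed

lemma J_term_has_sum:
  assumes "\<And>m. m \<in> levels \<Longrightarrow>
    ((\<lambda>(n, l). of_nat l * w l (d r) n * site_pmf (d r) m n) has_sum c m) {(n, l). 1 \<le> l \<and> l \<le> n}"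
  shows "(J_term w q \<mu> y s d r has_sum of_real (\<Sum>m\<in>levels. level_weight m * c m)) {(n, l). 1 \<le> l \<and> l \<le> n}"
proof -
  have "((\<lambda>x. \<Sum>m\<in>levels. level_weight m * (case x of (n, l) \<Rightarrow> of_nat l * w l (d r) n * site_pmf (d r) m n)) has_sum
      (\<Sum>m\<in>levels. level_weight m * c m)) {(n, l). 1 \<le> l \<and> l \<le> n}"
    by (intro has_sum_finite_sum has_sum_cmult_right assms)
  then have "((\<lambda>x. complex_of_real (\<Sum>m\<in>levels. level_weight m * (case x of (n, l) \<Rightarrow> of_nat l * w l (d r) n * site_pmf (d r) m n))) has_sum
      of_real (\<Sum>m\<in>levels. level_weight m * c m)) {(n, l). 1 \<le> l \<and> l \<le> n}"
    by (rule has_sum_of_real)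
  moreover have "complex_of_real (\<Sum>m\<in>levels. level_weight m * (case x of (n, l) \<Rightarrow> of_nat l * w l (d r) n * site_pmf (d r) m n)) =
      J_term w q \<mu> y s d r x" for x
  proof -
    obtain n l where x: "x = (n, l)" by (cases x)
    have "(\<Sum>m\<in>levels. level_weight m * (of_nat l * w l (d r) n * site_pmf (d r) m n)) =
        of_nat l * w l (d r) n * (\<Sum>m\<in>levels. level_weight m * site_pmf (d r) m n)"
      unfolding sum_distrib_left by (intro sum.cong) auto
    then show ?thesis
      by (simp only: x J_term_def case_prod_conv P_I_eq of_real_mult of_real_of_nat_eq)
  qed
  ultimately show ?thesis by simp
qed

lemma J_plus_has_sum: "(J_term (w_plus q \<mu>) q \<mu> y s d r has_sum
    of_real (\<Sum>m\<in>levels. level_weight m * (inverse \<mu> * lambert_series q (\<mu> * y * q ^ m)))) {(n, l). 1 \<le> l \<and> l \<le> n}"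
  by (rule J_term_has_sum) (rule has_sum_current_plus, simp)

lemma J_minus_has_sum: "(J_term (w_minus q \<mu>) q \<mu> y s d r has_sum
    of_real (\<Sum>m\<in>levels. level_weight m * lambert_series q (y * q ^ (m - d r)))) {(n, l). 1 \<le> l \<and> l \<le> n}"
  by (rule J_term_has_sum) (rule has_sum_current_minus)

lemma J_plus_formula: "J_I_plus q \<mu> y s d r - of_real (J_plus_bulk q \<mu> y) = of_real (
    - (\<Sum>m\<in>levels. level_weight m * (\<Sum>k<m. y * q ^ k / (1 - \<mu> * y * q ^ k)\<^sup>2)))"
proof -
  have "(\<Sum>m\<in>levels. level_weight m * (inverse \<mu> * lambert_series q (\<mu> * y * q ^ m)))
      - inverse \<mu> * lambert_series q (\<mu> * y) =
    (\<Sum>m\<in>levels. level_weight m * - (\<Sum>k<m. y * q ^ k / (1 - \<mu> * y * q ^ k)\<^sup>2))"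
  proof (rule sum_level_weight_diff)
    fix m
    \<comment> \<open>The telescoping runs with argument \<mu>y, and the prefactor 1/\<mu> removes
      \<mu> from the numerators.\<close>
    have "(\<Sum>k<m. y * q ^ k / (1 - \<mu> * y * q ^ k)\<^sup>2) = inverse \<mu> * (\<Sum>k<m. \<mu> * y * q ^ k / (1 - \<mu> * y * q ^ k)\<^sup>2)"
      unfolding sum_distrib_left using mu_pos by (intro sum.cong) auto
    then show "inverse \<mu> * lambert_series q (\<mu> * y * q ^ m) - inverse \<mu> * lambert_series q (\<mu> * y) =
        - (\<Sum>k<m. y * q ^ k / (1 - \<mu> * y * q ^ k)\<^sup>2)"
      unfolding lambert_series_telescope(2)[OF mu_y, of m, symmetric] by (simp add: algebra_simps)
  qed
  moreover have "J_plus_bulk q \<mu> y = inverse \<mu> * lambert_series q (\<mu> * y)"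
    using sums_unique[OF h_term_sums[OF mu_y]] by (simp add: J_plus_bulk_def h_fun_def)
  ultimately show ?thesis
    unfolding J_I_plus_def infsumI[OF J_plus_has_sum]
    by (simp only: of_real_diff[symmetric] mult_minus_right sum_negf)
qed

lemma J_minus_formula: "J_I_minus q \<mu> y s d r - of_real (J_minus_bulk q y) = of_real (
    - (\<Sum>m\<in>levels. level_weight m * (\<Sum>k<m - d r. y * q ^ k / (1 - y * q ^ k)\<^sup>2)))"
proof -
  have y: "0 \<le> y" "y < 1" using y_pos y_less_1 by auto
  have "(\<Sum>m\<in>levels. level_weight m * lambert_series q (y * q ^ (m - d r))) - lambert_series q y =
    (\<Sum>m\<in>levels. level_weight m * - (\<Sum>k<m - d r. y * q ^ k / (1 - y * q ^ k)\<^sup>2))"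
    by (rule sum_level_weight_diff) (simp add: lambert_series_telescope(2)[OF y, symmetric])
  moreover have "J_minus_bulk q y = lambert_series q y"
    using sums_unique[OF h_term_sums[OF y]] by (simp add: J_minus_bulk_def h_fun_def)
  ultimately show ?thesis
    unfolding J_I_minus_def infsumI[OF J_minus_has_sum]
    by (simp only: of_real_diff[symmetric] mult_minus_right sum_negf)
qed

end

end

theorem theorem4:
  fixes q \<mu> y :: real and s :: nat and d :: "nat \<Rightarrow> nat" and r n :: nat
  assumes "0 < q" "q < 1" "0 < \<mu>" "\<mu> < 1" "0 < y" "y < 1"
    and "1 \<le> s" "1 \<le> d 1" "1 \<le> d s"
    and "1 \<le> r" "r \<le> s"
  shows
    \<comment> \<open>all limits and infinite sums converge\<close>
    "(\<forall>L\<ge>s. summable (\<lambda>N. Tr_coeff q (word_num q \<mu> s d r n L) N * of_real y ^ N)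
          \<and> summable (\<lambda>N. Tr_coeff q (word_den q \<mu> s d L) N * of_real y ^ N))
     \<and> convergent (\<lambda>L. P_fin q \<mu> y s d r n L)
     \<and> summable (\<lambda>n. of_nat n * P_I q \<mu> y s d r n)
     \<and> J_term (w_plus q \<mu>) q \<mu> y s d r summable_on {(n, l). 1 \<le> l \<and> l \<le> n}
     \<and> J_term (w_minus q \<mu>) q \<mu> y s d r summable_on {(n, l). 1 \<le> l \<and> l \<le> n}
     \<and> summable (\<rho>_bulk_term q \<mu> y) \<and> summable (h_term q (\<mu> * y)) \<and> summable (h_term q y)
     \<comment> \<open>the four formulas\<close>
     \<and> P_I q \<mu> y s d r n = of_real (
          y ^ n * (qpoch q (q ^ d r * \<mu>) n * qpoch_inf q y / (qpoch q q n * qpoch_inf q (\<mu> * y)))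
          * (\<Sum>m\<in>{d r..\<Sum>i=1..r. d i}. q ^ (n * (m - d r)) * (qpoch q (\<mu> * y) m / qpoch q y (m - d r)) * G_fun q \<mu> y 0 m (map d [1..<Suc r])))
     \<and> \<rho>_I q \<mu> y s d r - of_real (\<rho>_bulk q \<mu> y) = of_real (
          \<Sum>m\<in>{d r..\<Sum>i=1..r. d i}. G_fun q \<mu> y 0 m (map d [1..<Suc r]) * ((\<Sum>k<m. \<mu> * y * q ^ k / (1 - \<mu> * y * q ^ k))
                          - (\<Sum>k<m - d r. y * q ^ k / (1 - y * q ^ k))))
     \<and> J_I_plus q \<mu> y s d r - of_real (J_plus_bulk q \<mu> y) = of_real (
          - (\<Sum>m\<in>{d r..\<Sum>i=1..r. d i}. G_fun q \<mu> y 0 m (map d [1..<Suc r]) * (\<Sum>k<m. y * q ^ k / (1 - \<mu> * y * q ^ k)\<^sup>2)))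
     \<and> J_I_minus q \<mu> y s d r - of_real (J_minus_bulk q y) = of_real (
          - (\<Sum>m\<in>{d r..\<Sum>i=1..r. d i}. G_fun q \<mu> y 0 m (map d [1..<Suc r]) * (\<Sum>k<m - d r. y * q ^ k / (1 - y * q ^ k)\<^sup>2)))"
proof -
  interpret zero_range q \<mu> y
    using assms by unfold_locales auto
  note r = \<open>1 \<le> r\<close> \<open>r \<le> s\<close>
  have conv: "convergent (P_fin q \<mu> y s d r n)"
    using P_fin_LIMSEQ[OF r] by (rule convergentI)
  have y: "0 \<le> y" "y < 1" using assms by auto
  show ?thesis
    using defect_probability(1,2)[OF r] conv
      sums_summable[OF rho_I_sums[OF r]]
      has_sum_imp_summable[OF J_plus_has_sum[OF r]] has_sum_imp_summable[OF J_minus_has_sum[OF r]]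
      sums_summable[OF rho_bulk_sums] sums_summable[OF h_term_sums[OF mu_y]] sums_summable[OF h_term_sums[OF y]]
      P_I_formula[OF r] rho_I_formula[OF r] J_plus_formula[OF r] J_minus_formula[OF r]
    by (intro conjI allI impI)
qed

end
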